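(* Let $d\ge 2$, let $k>0$, let $l_k=\frac{\pi}{2\sqrt{k}}$, let $\mathbb{M}_k^d$ be the $d$-dimensional sphere of constant curvature $k$, and let $L\subset\mathbb{M}_k^d$ be a totally geodesic hypersurface. Let $\xi_d$ be the isometry-invariant random ball process in $\mathbb{M}_k^d$ with intensity $N_d$ and radius distribution $\nu_d$, and let $N_{d-1}$ and $\nu_{d-1}$ be the intensity and radius distribution of the process of balls it induces in $L$ (as defined in the context). Then for any $a\in(0,l_k)$, $$\nu_d((a,l_k])=\frac{N_{d-1}\sqrt{k}}{N_d\,\pi}\Bigg(\frac{1}{\cos^{d-2}(\sqrt{k}\,a)}\int_{(a,l_k]}\frac{\cos^{d-1}(\sqrt{k}\,y)}{\sqrt{\cos^2(\sqrt{k}\,a)-\cos^2(\sqrt{k}\,y)}}\,\nu_{d-1}(\mathrm{d}y)$$ $$\qquad\qquad +\,(d-1)\int_{(a,l_k]}\int_0^{\arccos\left(\frac{\cos(\sqrt{k}\,y)}{\cos(\sqrt{k}\,a)}\right)}\cos^{d-2}\theta\,\mathrm{d}\theta\,\nu_{d-1}(\mathrm{d}y)\Bigg).$$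
   Context: Space. $\mathbb{M}_k^d$ ($k>0$) is the sphere of radius $1/\sqrt{k}$ in $\mathbb{R}^{d+1}$, with its geodesic distance and Riemannian volume measure $\mu_{k,d}$. A totally geodesic hypersurface $L$ is a great subsphere of dimension $d-1$; $\mu_{k,L}$ is its Riemannian volume measure. Ball process. $\eta_d$ is a point process on $\mathbb{M}_k^d$ whose distribution is invariant under all isometries of $\mathbb{M}_k^d$, with intensity measure $N_d\,\mu_{k,d}$, $N_d\in(0,\infty)$. $\nu_d$ is a probability measure on $(0,\infty)$, concentrated on $(0,l_k]$. $\xi_d$ is the independent $\nu_d$-marking of $\eta_d$; it has intensity measure $N_d\,\mu_{k,d}\otimes\nu_d$, and a point $(x,R)$ of $\xi_d$ represents the ball $B(x,R)$ with centre $x$ and radius $R$. Induced process. Intersecting with $L$ the balls of $\xi_d$ that hit $L$ gives balls in $L$. Such a ball is represented by (its centre in $L$, its radius), where the centre is the orthogonal projection of $x$ onto $L$. They form a marked point process $\xi_{d-1}$ on $L$. By invariance its intensity measure has the form $N_{d-1}\,\mu_{k,L}\otimes\nu_{d-1}$ with $N_{d-1}\in(0,\infty)$ and $\nu_{d-1}$ a probability measure on $(0,\infty)$ (concentrated on $(0,l_k]$). *)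

theory Defs
  imports "HOL-Probability.Probability" "HOL-Library.Multiset"
begin

section \<open>Riemannian volume of submanifolds of Euclidean space\<close>

text \<open>
  A \<open>C\<^sup>1\<close> local parametrization \<open>\<phi>\<close> (inverse of a chart) of an \<open>m\<close>-dimensional submanifold
  \<open>M\<close> of Euclidean space, defined on the open set \<open>U\<close>; \<open>J x\<close> is the Jacobian matrix of \<open>\<phi>\<close>
  at \<open>x\<close>. The dimension \<open>m\<close> is the cardinality of the index type \<open>'m\<close>.
\<close>

definition local_parametrization ::
  "(real ^ 'n) set \<Rightarrow> (real ^ 'm) set \<Rightarrow> (real ^ 'm \<Rightarrow> real ^ 'n) \<Rightarrow> (real ^ 'm \<Rightarrow> real ^ 'm ^ 'n) \<Rightarrow> bool"
  where "local_parametrization M U \<phi> J \<longleftrightarrow>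
    open U \<and> openin (top_of_set M) (\<phi> ` U) \<and> (\<exists>\<psi>. homeomorphism U (\<phi> ` U) \<phi> \<psi>) \<and>
    (\<forall>x\<in>U. (\<phi> has_derivative (\<lambda>h. J x *v h)) (at x) \<and> inj (\<lambda>h. J x *v h)) \<and>
    continuous_on U J"

text \<open>
  \<open>\<mu>\<close> is the Riemannian volume measure of \<open>M\<close> for the metric induced from the ambient space:
  in every chart it has the Lebesgue density \<open>sqrt (det g)\<close>, where the matrix of the metric tensor
  is \<open>g = J\<^sup>T J\<close>. As the chart images cover a submanifold, this determines \<open>\<mu>\<close>. The type argument
  carries the dimension of \<open>M\<close>.
\<close>

definition riemannian_volume :: "'m::finite itself \<Rightarrow> (real ^ 'n) set \<Rightarrow> (real ^ 'n) measure \<Rightarrow> bool"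
  where "riemannian_volume _ M \<mu> \<longleftrightarrow>
    sets \<mu> = sets (restrict_space borel M) \<and>
    (\<forall>(U :: (real ^ 'm) set) \<phi> J V.
       local_parametrization M U \<phi> J \<longrightarrow> V \<in> sets borel \<longrightarrow> V \<subseteq> U \<longrightarrow>
       emeasure \<mu> (\<phi> ` V) = (\<integral>\<^sup>+x\<in>V. ennreal (sqrt (det (transpose (J x) ** J x))) \<partial>lborel))"


section \<open>The sphere of constant curvature\<close>

definition space_form :: "real \<Rightarrow> (real ^ 'n) set"
  where "space_form k = sphere 0 (1 / sqrt k)"

text \<open>Great-circle distance: radius \<open>1 / sqrt k\<close> times the angle between \<open>x\<close> and \<open>y\<close>.\<close>

definition gdist :: "real \<Rightarrow> real ^ 'n \<Rightarrow> real ^ 'n \<Rightarrow> real"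
  where "gdist k x y = arccos (k * (x \<bullet> y)) / sqrt k"

definition gball :: "real \<Rightarrow> real ^ 'n \<Rightarrow> real \<Rightarrow> (real ^ 'n) set"
  where "gball k x R = {y \<in> space_form k. gdist k x y \<le> R}"

definition isometry :: "real \<Rightarrow> (real ^ 'n \<Rightarrow> real ^ 'n) \<Rightarrow> bool"
  where "isometry k f \<longleftrightarrow> bij_betw f (space_form k) (space_form k) \<and>
    (\<forall>x\<in>space_form k. \<forall>y\<in>space_form k. gdist k (f x) (f y) = gdist k x y)"

text \<open>Great subspheres of codimension one.\<close>

definition geodesic_hypersurface :: "real \<Rightarrow> (real ^ 'n) set \<Rightarrow> bool"
  where "geodesic_hypersurface k L \<longleftrightarrow>
    (\<exists>H. subspace H \<and> dim H + 1 = CARD('n) \<and> L = space_form k \<inter> H)"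

definition max_radius :: "real \<Rightarrow> real"
  where "max_radius k = pi / (2 * sqrt k)"

text \<open>
  Nearest point of \<open>L\<close> (the foot of the shortest perpendicular). It is unique except when \<open>x\<close> is one
  of the two poles of \<open>L\<close>, where an arbitrary point of \<open>L\<close> is chosen.
\<close>

definition gproj :: "real \<Rightarrow> (real ^ 'n) set \<Rightarrow> real ^ 'n \<Rightarrow> real ^ 'n"
  where "gproj k L x = (SOME y. y \<in> L \<and> (\<forall>z\<in>L. gdist k x y \<le> gdist k x z))"

text \<open>
  The radius of the ball \<open>gball k x R \<inter> L\<close> in \<open>L\<close>. For \<open>0 < R \<le> max_radius k\<close> and a ball that hits
  \<open>L\<close> it exists and is unique, except when \<open>x\<close> is a pole of \<open>L\<close> and \<open>R = max_radius k\<close> (then the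
  intersection is all of \<open>L\<close>).
\<close>

definition section_radius :: "real \<Rightarrow> (real ^ 'n) set \<Rightarrow> real ^ 'n \<Rightarrow> real \<Rightarrow> real"
  where "section_radius k L x R =
    (THE r. 0 \<le> r \<and> r \<le> max_radius k \<and> gball k x R \<inter> L = gball k (gproj k L x) r \<inter> L)"


section \<open>Point processes\<close>

text \<open>
  On a compact space point processes are a.s. finite, so configurations are represented by finite
  multisets, with the \<open>\<sigma>\<close>-algebra generated by the counting maps.
\<close>

definition points_in :: "'x set \<Rightarrow> 'x multiset \<Rightarrow> nat"
  where "points_in A m = size (filter_mset (\<lambda>x. x \<in> A) m)"

definition config_space :: "'x measure \<Rightarrow> 'x multiset measure"
  where "config_space S = sigma {m. set_mset m \<subseteq> space S}
    {{m. set_mset m \<subseteq> space S \<and> points_in A m = n} |A n. A \<in> sets S}"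

definition point_process :: "'w measure \<Rightarrow> 'x measure \<Rightarrow> ('w \<Rightarrow> 'x multiset) \<Rightarrow> bool"
  where "point_process P S \<eta> \<longleftrightarrow> \<eta> \<in> P \<rightarrow>\<^sub>M config_space S"

definition has_intensity :: "'w measure \<Rightarrow> ('w \<Rightarrow> 'x multiset) \<Rightarrow> 'x measure \<Rightarrow> bool"
  where "has_intensity P \<eta> \<Lambda> \<longleftrightarrow>
    (\<forall>A\<in>sets \<Lambda>. (\<integral>\<^sup>+\<omega>. of_nat (points_in A (\<eta> \<omega>)) \<partial>P) = emeasure \<Lambda> A)"

definition isometry_invariant ::
  "real \<Rightarrow> 'w measure \<Rightarrow> ('w \<Rightarrow> (real ^ 'n) multiset) \<Rightarrow> bool"
  where "isometry_invariant k P \<eta> \<longleftrightarrow>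
    (let C = config_space (restrict_space borel (space_form k))
     in \<forall>f. isometry k f \<longrightarrow> distr P C (\<lambda>\<omega>. image_mset f (\<eta> \<omega>)) = distr P C \<eta>)"

text \<open>
  \<open>\<xi>\<close> is an independent \<open>\<nu>\<close>-marking of \<open>\<eta>\<close>: the points of \<open>\<eta>\<close> can be enumerated as
  \<open>X 0, \<dots>, X (\<kappa> - 1)\<close> and carry marks \<open>R 0, \<dots>, R (\<kappa> - 1)\<close> from an i.i.d. sequence with
  distribution \<open>\<nu>\<close> that is independent of \<open>(\<kappa>, X)\<close>; that is, the joint law of \<open>(\<kappa>, X)\<close> and
  \<open>R\<close> is the product of the law of \<open>(\<kappa>, X)\<close> with the infinite power of \<open>\<nu>\<close>.
\<close>

definition independent_marking ::
  "'w measure \<Rightarrow> 'x measure \<Rightarrow> ('w \<Rightarrow> 'x multiset) \<Rightarrow> real measure \<Rightarrow> ('w \<Rightarrow> ('x \<times> real) multiset) \<Rightarrow> bool"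
  where "independent_marking P S \<eta> \<nu> \<xi> \<longleftrightarrow>
    point_process P (S \<Otimes>\<^sub>M borel) \<xi> \<and>
    (\<exists>(\<kappa> :: 'w \<Rightarrow> nat) (X :: nat \<Rightarrow> 'w \<Rightarrow> 'x) (R :: nat \<Rightarrow> 'w \<Rightarrow> real).
       let E = count_space UNIV \<Otimes>\<^sub>M Pi\<^sub>M UNIV (\<lambda>_. S);
           F = Pi\<^sub>M UNIV (\<lambda>_. borel);
           Z = (\<lambda>\<omega>. (\<kappa> \<omega>, \<lambda>i. X i \<omega>));
           W = (\<lambda>\<omega> i. R i \<omega>)
       in Z \<in> P \<rightarrow>\<^sub>M E \<and> W \<in> P \<rightarrow>\<^sub>M F \<and>
       distr P (E \<Otimes>\<^sub>M F) (\<lambda>\<omega>. (Z \<omega>, W \<omega>)) = distr P E Z \<Otimes>\<^sub>M Pi\<^sub>M UNIV (\<lambda>_. \<nu>) \<and>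
       (AE \<omega> in P.
          \<eta> \<omega> = image_mset (\<lambda>i. X i \<omega>) (mset_set {..<\<kappa> \<omega>}) \<and>
          \<xi> \<omega> = image_mset (\<lambda>i. (X i \<omega>, R i \<omega>)) (mset_set {..<\<kappa> \<omega>})))"

text \<open>A marked point \<open>(x, R)\<close> represents the ball \<open>gball k x R\<close>, or \<open>gball k x R \<inter> L\<close> in \<open>L\<close>.\<close>

definition induced_balls ::
  "real \<Rightarrow> (real ^ 'n) set \<Rightarrow> ((real ^ 'n) \<times> real) multiset \<Rightarrow> ((real ^ 'n) \<times> real) multiset"
  where "induced_balls k L m =
    image_mset (\<lambda>(x, R). (gproj k L x, section_radius k L x R))
      (filter_mset (\<lambda>(x, R). gball k x R \<inter> L \<noteq> {}) m)"

end

(*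
  Write t for the signed latitude of a point of the sphere with respect to L. In the coordinates
  "foot of the perpendicular on L, latitude" the volume of the sphere is that of L times
  cos^(d-1) t dt / sqrt k, and a ball of radius R centred at latitude t meets L iff |t| <= sqrt k R,
  in a ball of radius rho with cos (sqrt k rho) = cos (sqrt k R) / cos t. Since the marks are
  independent, Campbell's formula expresses nu_(d-1) as the image of
  (N_d / (N_(d-1) sqrt k)) cos^(d-1) t dt nu_d(dR) under (t, R) |-> rho.

  It remains to integrate the kernel of the theorem against this image. For fixed R > a put
  q = cos (sqrt k R) / cos (sqrt k a). The first summand contributes pi q^(d-1) by the elementary
  integral of cos t / sqrt (cos^2 t - q^2) over [0, arccos q], which is pi/2. In the second summand
  the substitution p = cos t cos theta and Fubini reduce to the same integral and give
  pi (1 - q^(d-1)). The sum pi does not depend on R, and for R <= a nothing contributes.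
*)
theory Submission imports Defs begin

section \<open>The trigonometric inversion kernel\<close>

text \<open>The volume measure is known only through charts, so each chart yields the volume of its
  own image and whatever it misses must be shown to be null separately; a second chart recovers the
  meridian that the first one omits. Nearest point and section radius are choices, without geometric
  meaning at the poles of \<open>L\<close> or for radii outside the admissible range. The expected
  number of such marked points is 0, so almost surely there are none, and only then may the geometry
  be replaced by a measurable function of latitude and radius. The volume of \<open>L\<close> occurs
  on both sides of the count of induced balls; it cancels, being positive and finite.

  The kernel comes from an Abel equation. In scaled radii the map from t to rho gives, for fixed R,
  a density with the factor 1 / sqrt (cos^2 rho - cos^2 R), and the root in the first summand of the
  theorem is the matching Abel kernel. The second summand corrects for the powers of the cosine,
  which keep the first from giving a constant. All computations use nonnegative integrals, where the
  singularity is harmless; integrability follows from the finite total.\<close>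

lemma nn_integral_even_set:
  fixes f :: "real \<Rightarrow> ennreal"
  assumes [measurable]: "f \<in> borel_measurable borel" and even: "\<And>x. f (- x) = f x"
  shows "(\<integral>\<^sup>+x. f x \<partial>lborel) = 2 * (\<integral>\<^sup>+x. f x * indicator {0..} x \<partial>lborel)"
proof -
  have "(\<integral>\<^sup>+x. f x \<partial>lborel) = (\<integral>\<^sup>+x. f x * indicator {0..} x + f x * indicator {..0} x \<partial>lborel)"
    by (intro nn_integral_cong_AE eventually_mono[OF AE_lborel_singleton[of 0]])
       (auto simp: indicator_def)
  also have "\<dots> = (\<integral>\<^sup>+x. f x * indicator {0..} x \<partial>lborel) + (\<integral>\<^sup>+x. f x * indicator {..0} x \<partial>lborel)"
    by (rule nn_integral_add) auto
  also have "(\<integral>\<^sup>+x. f x * indicator {..0} x \<partial>lborel) = (\<integral>\<^sup>+x. f x * indicator {0..} x \<partial>lborel)"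
    by (subst nn_integral_real_affine[where c="-1" and t=0])
       (auto simp: even indicator_def intro!: nn_integral_cong)
  finally show ?thesis by (simp add: mult_2)
qed

lemma arccos_bounds_unit:
  fixes q :: real assumes "0 \<le> q" "q \<le> 1"
  shows "0 \<le> arccos q" "arccos q \<le> pi / 2" "cos (arccos q) = q"
  using assms arccos_le_pi2[of q] by (auto simp: arccos_lbound)

lemma cos_gt_iff_less_arccos:
  fixes q s :: real assumes "0 \<le> q" "q \<le> 1" "0 \<le> s" "s \<le> pi"
  shows "q < cos s \<longleftrightarrow> s < arccos q" "q \<le> cos s \<longleftrightarrow> s \<le> arccos q"
  using cos_mono_less_eq[of "arccos q" s] cos_mono_le_eq[of "arccos q" s] arccos_bounds_unit[of q] assms
  by auto

text \<open>The primitive is \<open>arcsin (sin s / sqrt (1 - q^2))\<close>. It runs from 0 to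
  \<open>pi / 2\<close>, because \<open>sqrt (1 - q^2)\<close> is the sine of the upper limit
  \<open>arccos q\<close>; hence the value does not depend on \<open>q\<close>.\<close>

lemma nn_integral_arcsin_kernel:
  fixes q :: real
  assumes q: "0 \<le> q" "q < 1"
  shows "(\<integral>\<^sup>+s. ennreal (cos s / sqrt ((cos s)\<^sup>2 - q\<^sup>2)) * indicator {0..arccos q} s \<partial>lborel) = ennreal (pi / 2)"
proof -
  define b where "b = arccos q"
  define c where "c = sqrt (1 - q\<^sup>2)"
  have c0: "c > 0" using q by (simp add: c_def power_less_one_iff abs_square_less_1)
  have b: "0 < b" "b \<le> pi / 2" "cos b = q" "sin b = c"
    using q arccos_bounds_unit[of q] arccos_less_arccos[of q 1] by (auto simp: b_def c_def sin_arccos)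
  define F where "F s = arcsin (sin s / c)" for s
  define f where "f s = cos s / sqrt ((cos s)\<^sup>2 - q\<^sup>2)" for s
  have cosgt: "q < cos s" if "0 < s" "s < b" for s
    using cos_gt_iff_less_arccos(1)[of q s] that b q by (auto simp: b_def[symmetric])
  have cq: "(cos s)\<^sup>2 - q\<^sup>2 > 0" if "0 < s" "s < b" for s
    using cosgt[OF that] q power_strict_mono[of q "cos s" 2] by simp
  have sinle: "0 \<le> sin s" "sin s \<le> c" if "0 \<le> s" "s \<le> b" for s
    using that b sin_monotone_2pi_le[of s b] sin_ge_zero[of s] by auto
  have dF: "DERIV F s :> f s" if s: "0 < s" "s < b" for s
  proof -
    have sl: "sin s < c" using s b sin_monotone_2pi[of s b] by simp
    have e: "c * sqrt (1 - (sin s / c)\<^sup>2) = sqrt ((cos s)\<^sup>2 - q\<^sup>2)"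
    proof -
      have "c * sqrt (1 - (sin s / c)\<^sup>2) = sqrt (c\<^sup>2 * (1 - (sin s / c)\<^sup>2))"
        using c0 by (simp add: real_sqrt_mult)
      also have "c\<^sup>2 * (1 - (sin s / c)\<^sup>2) = c\<^sup>2 - (sin s)\<^sup>2"
        using c0 by (simp add: field_simps power_divide)
      also have "\<dots> = (cos s)\<^sup>2 - q\<^sup>2"
        using q by (simp add: c_def cos_squared_eq power_le_one)
      finally show ?thesis .
    qed
    have "DERIV F s :> inverse (sqrt (1 - (sin s / c)\<^sup>2)) * (cos s / c)"
      unfolding F_def using sl sinle(1)[of s] s c0
      by (auto intro!: derivative_eq_intros simp: divide_less_eq less_divide_eq)
    also have "inverse (sqrt (1 - (sin s / c)\<^sup>2)) * (cos s / c) = f s"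
      unfolding f_def e[symmetric] by (simp add: field_simps)
    finally show ?thesis .
  qed
  have contF: "continuous_on {0..b} F"
    unfolding F_def using c0 sinle
    by (intro continuous_intros) (auto simp: field_simps intro: order_trans[of _ 0])
  have fnn: "0 \<le> f s" if "0 < s" "s < b" for s
    unfolding f_def using cosgt[OF that] q by simp
  \<comment> \<open>The integrand may blow up at \<open>b\<close>, so the fundamental theorem is
    applied on the open interval, with the values of \<open>F\<close> at the ends supplied as
    one-sided limits.\<close>
  have lim0: "((F \<circ> real_of_ereal) \<longlongrightarrow> F 0) (at_right (ereal 0))"
    unfolding ereal_tendsto_simps
    using contF b by (auto simp: continuous_on_Icc_at_rightD)
  have limb: "((F \<circ> real_of_ereal) \<longlongrightarrow> F b) (at_left (ereal b))"
    unfolding ereal_tendsto_simps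
    using contF b by (auto simp: continuous_on_Icc_at_leftD)
  have isf: "isCont f s" if "0 < s" "s < b" for s
    unfolding f_def using cq[OF that] by (intro continuous_intros) auto
  note ftc = interval_integral_FTC_nonneg[of "ereal 0" "ereal b" F f "F 0" "F b"]
  have int: "set_integrable lborel (einterval (ereal 0) (ereal b)) f"
    and val: "(LBINT s=ereal 0..ereal b. f s) = F b - F 0"
    by (rule ftc; use b dF isf fnn lim0 limb in \<open>simp\<close>)+
  have val': "(LINT s|lborel. indicator {0<..<b} s * f s) = pi / 2"
    using val b c0 by (simp add: interval_lebesgue_integral_def set_lebesgue_integral_def F_def)
  have "(\<integral>\<^sup>+s. ennreal (f s) * indicator {0..b} s \<partial>lborel) = (\<integral>\<^sup>+s. ennreal (indicator {0<..<b} s * f s) \<partial>lborel)"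
    by (intro nn_integral_cong_AE eventually_mono[OF AE_conjI[OF AE_lborel_singleton[of 0] AE_lborel_singleton[of b]]])
       (auto simp: indicator_def)
  also have "\<dots> = ennreal (LINT s|lborel. indicator {0<..<b} s * f s)"
    using int fnn by (intro nn_integral_eq_integral) (auto simp: set_integrable_def indicator_def)
  finally show ?thesis unfolding val' unfolding f_def b_def .
qed

definition cos_power_integral :: "nat \<Rightarrow> real \<Rightarrow> real"
  where "cos_power_integral n q = (LINT \<theta>:{0..arccos q}|lborel. cos \<theta> ^ n)"

lemma cos_power_set_integrable: "set_integrable lborel {0..b} (\<lambda>\<theta>::real. cos \<theta> ^ n)"
  by (intro borel_integrable_atLeastAtMost' continuous_intros)

lemma cos_power_integral_nonneg:
  assumes "0 \<le> q" "q \<le> 1" shows "0 \<le> cos_power_integral n q"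
  unfolding cos_power_integral_def set_lebesgue_integral_def
  by (rule Bochner_Integration.integral_nonneg) (use arccos_bounds_unit[OF assms] in \<open>auto simp: indicator_def intro!: zero_le_power cos_ge_zero\<close>)

lemma ennreal_cos_power_integral:
  assumes "0 \<le> q" "q \<le> 1"
  shows "ennreal (cos_power_integral n q) = (\<integral>\<^sup>+\<theta>. ennreal (cos \<theta> ^ n) * indicator {0..arccos q} \<theta> \<partial>lborel)"
proof -
  have nn: "0 \<le> cos \<theta> ^ n" if "\<theta> \<in> {0..arccos q}" for \<theta>
    using that arccos_bounds_unit[OF assms] by (auto intro!: zero_le_power cos_ge_zero)
  have "(\<integral>\<^sup>+\<theta>. ennreal (cos \<theta> ^ n) * indicator {0..arccos q} \<theta> \<partial>lborel)
      = (\<integral>\<^sup>+\<theta>. ennreal (indicator {0..arccos q} \<theta> *\<^sub>R cos \<theta> ^ n) \<partial>lborel)"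
    by (intro nn_integral_cong) (auto simp: indicator_def)
  also have "\<dots> = ennreal (cos_power_integral n q)"
    unfolding cos_power_integral_def set_lebesgue_integral_def using cos_power_set_integrable nn
    by (intro nn_integral_eq_integral) (auto simp: set_integrable_def indicator_def)
  finally show ?thesis by simp
qed

text \<open>\<open>arccos\<close> has a meaning only on \<open>{-1..1}\<close>. Clamping the
  argument extends it continuously to the whole line, so that functions built from it are measurable
  without side conditions; where the formulas are used, the clamp is inactive.\<close>

lemma borel_measurable_arccos_clamp [measurable]:
  "(\<lambda>x::real. arccos (max (-1) (min 1 x))) \<in> borel_measurable borel"
  by (intro borel_measurable_continuous_onI continuous_intros) auto

text \<open>The parameter sits in the domain of integration; writing the domain as a condition on
  the pair \<open>(q, \<theta>)\<close> turns this into the measurability of a parameter integral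
  with a jointly measurable integrand.\<close>

lemma borel_measurable_cos_power_integral_clamp [measurable]:
  "(\<lambda>q. cos_power_integral n (max (-1) (min 1 q))) \<in> borel_measurable borel"
proof -
  have "(\<lambda>(q, \<theta>). (if 0 \<le> \<theta> \<and> \<theta> \<le> arccos (max (-1) (min 1 q)) then cos \<theta> ^ n else 0) :: real)
      \<in> borel_measurable (borel \<Otimes>\<^sub>M lborel)"
    by measurable
  from sigma_finite_measure.borel_measurable_lebesgue_integral[OF lborel.sigma_finite_measure_axioms this]
  show ?thesis
    unfolding cos_power_integral_def set_lebesgue_integral_def
    by (rule measurable_cong[THEN iffD1, rotated])
       (auto simp: indicator_def intro!: Bochner_Integration.integral_cong)
qed

text \<open>Substituting \<open>p = cos t cos \<theta>\<close>.\<close>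

lemma cos_power_integral_substitution:
  fixes q t :: real
  assumes q: "0 \<le> q" "q < cos t"
  shows "ennreal (cos t ^ (n + 1) * (real n + 1) * cos_power_integral n (q / cos t)) =
    (\<integral>\<^sup>+p. ennreal ((real n + 1) * p ^ n) * ennreal (cos t / sqrt ((cos t)\<^sup>2 - p\<^sup>2)) * indicator {q..cos t} p \<partial>lborel)"
proof -
  define c where "c = cos t"
  have c: "0 < c" "q < c" using q by (auto simp: c_def)
  define b where "b = arccos (q / c)"
  have qc: "0 \<le> q / c" "q / c < 1" using c q by auto
  have b: "0 \<le> b" "b \<le> pi / 2" "cos b = q / c"
    using arccos_bounds_unit[of "q / c"] qc by (auto simp: b_def)
  \<comment> \<open>\<open>f z\<close> is the integrand at \<open>p = - z\<close>. The sign makes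
    the substitution function \<open>g\<close> increasing in \<theta>; it is undone at the end by a
    reflection.\<close>
  define f where "f z = (real n + 1) * (- z) ^ n * (c / sqrt (c\<^sup>2 - z\<^sup>2))" for z :: real
  define g where "g \<theta> = - (c * cos \<theta>)" for \<theta> :: real
  have [measurable]: "f \<in> borel_measurable borel" unfolding f_def by measurable
  have subst: "(\<integral>\<^sup>+z. ennreal (f z) * indicator {g 0..g b} z \<partial>lborel) =
      (\<integral>\<^sup>+\<theta>. ennreal (f (g \<theta>) * (c * sin \<theta>)) * indicator {0..b} \<theta> \<partial>lborel)"
  proof -
    have "(\<integral>\<^sup>+z. ennreal (f z * indicator {g 0..g b} z) \<partial>lborel) =
        (\<integral>\<^sup>+\<theta>. ennreal (f (g \<theta>) * (c * sin \<theta>) * indicator {0..b} \<theta>) \<partial>lborel)"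
      by (rule nn_integral_substitution)
         (use b c in \<open>auto simp: g_def set_borel_measurable_def intro!: derivative_eq_intros continuous_intros mult_nonneg_nonneg sin_ge_zero\<close>)
    moreover have "ennreal (x * indicator A z) = ennreal x * indicator A z" for x and A :: "real set" and z
      by (auto simp: indicator_def)
    ultimately show ?thesis by simp
  qed
  \<comment> \<open>The derivative \<open>c * sin \<theta>\<close> of the substitution cancels the
    root in \<open>f\<close>, so nothing singular remains. Both vanish at \<theta> = 0, a null
    set.\<close>
  have fg: "f (g \<theta>) * (c * sin \<theta>) = (real n + 1) * c ^ (n + 1) * cos \<theta> ^ n" if "0 < \<theta>" "\<theta> \<le> b" for \<theta>
  proof -
    have s: "sin \<theta> > 0" using that b by (intro sin_gt_zero) (auto intro: order.strict_trans1)
    have "sqrt (c\<^sup>2 - (g \<theta>)\<^sup>2) = sqrt ((c * sin \<theta>)\<^sup>2)"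
      by (simp add: g_def power_mult_distrib sin_squared_eq algebra_simps)
    also have "\<dots> = c * sin \<theta>" using s c by simp
    finally have e: "sqrt (c\<^sup>2 - (g \<theta>)\<^sup>2) = c * sin \<theta>" .
    show ?thesis unfolding f_def e using s c
      by (simp add: g_def power_mult_distrib algebra_simps)
  qed
  have "ennreal (cos t ^ (n + 1) * (real n + 1) * cos_power_integral n (q / cos t))
     = ennreal ((real n + 1) * c ^ (n + 1)) * (\<integral>\<^sup>+\<theta>. ennreal (cos \<theta> ^ n) * indicator {0..b} \<theta> \<partial>lborel)"
    unfolding b_def c_def[symmetric] using qc c
    by (subst ennreal_cos_power_integral[symmetric])
       (auto simp: ennreal_mult'[symmetric] ennreal_mult''[symmetric] cos_power_integral_nonneg ac_simps)
  also have "\<dots> = (\<integral>\<^sup>+\<theta>. ennreal ((real n + 1) * c ^ (n + 1)) * (ennreal (cos \<theta> ^ n) * indicator {0..b} \<theta>) \<partial>lborel)"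
    by (rule nn_integral_cmult[symmetric]) auto
  also have "\<dots> = (\<integral>\<^sup>+\<theta>. ennreal (f (g \<theta>) * (c * sin \<theta>)) * indicator {0..b} \<theta> \<partial>lborel)"
    by (intro nn_integral_cong_AE eventually_mono[OF AE_lborel_singleton[of 0]])
       (use c in \<open>auto simp: indicator_def fg ennreal_mult'\<close>)
  also have "\<dots> = (\<integral>\<^sup>+z. ennreal (f z) * indicator {-c..-q} z \<partial>lborel)"
    unfolding subst[symmetric] using b c by (simp add: g_def)
  also have "\<dots> = (\<integral>\<^sup>+p. ennreal (f (- p)) * indicator {q..c} p \<partial>lborel)"
    by (subst nn_integral_real_affine[where c="-1" and t=0])
       (auto simp: indicator_def intro!: nn_integral_cong)
  also have "\<dots> = (\<integral>\<^sup>+p. ennreal ((real n + 1) * p ^ n) * ennreal (c / sqrt (c\<^sup>2 - p\<^sup>2)) * indicator {q..c} p \<partial>lborel)"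
    using q by (intro nn_integral_cong) (auto simp: f_def indicator_def ennreal_mult'[symmetric])
  finally show ?thesis unfolding c_def .
qed

lemma nn_integral_power_Suc:
  fixes q :: real assumes "0 \<le> q" "q \<le> 1"
  shows "(\<integral>\<^sup>+p. ennreal ((real n + 1) * p ^ n) * indicator {q..1} p \<partial>lborel) = ennreal (1 - q ^ (n + 1))"
proof -
  have "(\<integral>\<^sup>+p. ennreal ((real n + 1) * p ^ n) * indicator {q..1} p \<partial>lborel) = ennreal (1 ^ (n + 1) - q ^ (n + 1))"
  proof (rule nn_integral_FTC_Icc[where F="\<lambda>p. p ^ (n + 1)"])
    show "((\<lambda>p. p ^ (n + 1)) has_real_derivative (real n + 1) * p ^ n) (at p)" for p :: real
      using DERIV_pow[of "n + 1" p] by (simp add: add.commute)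
  qed (use assms in auto)
  then show ?thesis by simp
qed

text \<open>After the substitution the region is \<open>q \<le> p \<le> cos t\<close>. With the
  order of integration exchanged, \<open>t\<close> runs over \<open>{0..arccos p}\<close> and
  contributes \<open>pi / 2\<close> for every \<open>p < 1\<close>; only the integral of
  \<open>(n + 1) * p ^ n\<close> from \<open>q\<close> to 1 is left.\<close>

lemma nn_integral_double_cos_power:
  fixes q :: real
  assumes q: "0 \<le> q" "q < 1"
  shows "(\<integral>\<^sup>+t. ennreal (cos t ^ (n + 1) * (real n + 1) * cos_power_integral n (q / cos t)) * indicator {0..arccos q} t \<partial>lborel)
    = ennreal (pi / 2 * (1 - q ^ (n + 1)))"
proof -
  have b: "0 \<le> arccos q" "arccos q \<le> pi / 2" using arccos_bounds_unit[of q] q by auto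
  define h where "h t p = ennreal ((real n + 1) * p ^ n) * ennreal (cos t / sqrt ((cos t)\<^sup>2 - p\<^sup>2)) *
      (if 0 \<le> t \<and> t \<le> pi / 2 \<and> q \<le> p \<and> p \<le> cos t then 1 else 0)" for t p :: real
  have [measurable]: "case_prod h \<in> borel_measurable (borel \<Otimes>\<^sub>M borel)"
    unfolding h_def by measurable
  have "(\<integral>\<^sup>+t. ennreal (cos t ^ (n + 1) * (real n + 1) * cos_power_integral n (q / cos t)) * indicator {0..arccos q} t \<partial>lborel)
     = (\<integral>\<^sup>+t. (\<integral>\<^sup>+p. h t p \<partial>lborel) \<partial>lborel)"
  \<comment> \<open>The substitution needs the strict inequality \<open>q < cos t\<close>, which
    fails only at the endpoint \<open>arccos q\<close> of the interval.\<close>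
  proof (intro nn_integral_cong_AE eventually_mono[OF AE_lborel_singleton[of "arccos q"]])
    fix t assume ne: "t \<noteq> arccos q"
    show "ennreal (cos t ^ (n + 1) * (real n + 1) * cos_power_integral n (q / cos t)) * indicator {0..arccos q} t
      = (\<integral>\<^sup>+p. h t p \<partial>lborel)"
    proof (cases "0 \<le> t \<and> t \<le> arccos q")
      case True
      then have "q < cos t" using ne cos_gt_iff_less_arccos[of q t] q b by auto
      then show ?thesis using True b
        by (subst cos_power_integral_substitution)
           (auto simp: q h_def indicator_def intro!: nn_integral_cong)
    next
      case False
      then have "h t p = 0" for p
        using cos_gt_iff_less_arccos(2)[of q t] q by (auto simp: h_def)
      then show ?thesis using False by auto
    qed
  qed
  also have "\<dots> = (\<integral>\<^sup>+p. (\<integral>\<^sup>+t. h t p \<partial>lborel) \<partial>lborel)"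
    by (rule lborel_pair.Fubini') simp
  also have "\<dots> = (\<integral>\<^sup>+p. (ennreal ((real n + 1) * p ^ n) * indicator {q..1} p) * ennreal (pi / 2) \<partial>lborel)"
  proof (intro nn_integral_cong_AE eventually_mono[OF AE_lborel_singleton[of 1]])
    fix p :: real assume ne: "p \<noteq> 1"
    show "(\<integral>\<^sup>+t. h t p \<partial>lborel) = (ennreal ((real n + 1) * p ^ n) * indicator {q..1} p) * ennreal (pi / 2)"
    proof (cases "q \<le> p \<and> p < 1")
      case True
      then have p: "0 \<le> p" "p < 1" using q by auto
      have eq: "(0 \<le> t \<and> t \<le> pi / 2 \<and> q \<le> p \<and> p \<le> cos t) \<longleftrightarrow> t \<in> {0..arccos p}" for t
        using cos_gt_iff_less_arccos(2)[of p t] p True arccos_bounds_unit[of p] by auto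
      have "(\<integral>\<^sup>+t. h t p \<partial>lborel) = (\<integral>\<^sup>+t. ennreal ((real n + 1) * p ^ n) *
          (ennreal (cos t / sqrt ((cos t)\<^sup>2 - p\<^sup>2)) * indicator {0..arccos p} t) \<partial>lborel)"
        unfolding h_def eq by (intro nn_integral_cong) (auto simp: indicator_def)
      also have "\<dots> = ennreal ((real n + 1) * p ^ n) * ennreal (pi / 2)"
        by (subst nn_integral_cmult) (auto simp: nn_integral_arcsin_kernel[OF p])
      finally show ?thesis using True by simp
    next
      case False
      then have "\<not> (q \<le> p \<and> p \<le> cos t)" for t using ne cos_le_one[of t] by linarith
      then have "h t p = 0" for t by (auto simp: h_def)
      then show ?thesis using False ne by (auto simp: indicator_def)
    qed
  qed
  also have "\<dots> = ennreal (1 - q ^ (n + 1)) * ennreal (pi / 2)"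
    using q by (subst nn_integral_multc) (auto simp: nn_integral_power_Suc)
  finally show ?thesis using q
    by (simp add: ennreal_mult'[symmetric] power_le_one mult.commute del: power_Suc)
qed

text \<open>The integrand on the right-hand side of the theorem, with \<open>n = d - 2\<close> and the angles not yet scaled by \<open>sqrt k\<close>.\<close>

definition inversion_kernel :: "nat \<Rightarrow> real \<Rightarrow> real \<Rightarrow> real"
  where "inversion_kernel n a y = cos y ^ (n + 1) / sqrt ((cos a)\<^sup>2 - (cos y)\<^sup>2) / cos a ^ n
    + (real n + 1) * cos_power_integral n (cos y / cos a)"

text \<open>The condition \<open>cos R < cos a * cos t\<close> says that a ball of angular radius
  \<open>R\<close> centred at latitude \<open>t\<close> has a section of radius larger than
  \<open>a\<close>. That the result is the same for every \<open>R > a\<close> is what makes the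
  kernel invert the passage to sections. Measurability is stated as well, because the integrand
  contains an unclamped \<open>arccos\<close> and is well behaved only under the indicator.\<close>

theorem nn_integral_inversion_kernel:
  fixes a R :: real
  assumes a: "0 < a" "a < R" and R: "R \<le> pi / 2"
  shows "(\<lambda>t. ennreal (cos t ^ (n + 1)) * ennreal (inversion_kernel n a (arccos (cos R / cos t))) *
     indicator {t. -R \<le> t \<and> t \<le> R \<and> cos R < cos a * cos t} t) \<in> borel_measurable borel" (is ?measurable)
    and "(\<integral>\<^sup>+t. ennreal (cos t ^ (n + 1)) * ennreal (inversion_kernel n a (arccos (cos R / cos t))) *
     indicator {t. -R \<le> t \<and> t \<le> R \<and> cos R < cos a * cos t} t \<partial>lborel) = ennreal pi" (is ?integral)
proof -
  \<comment> \<open>\<open>arccos q\<close> is the latitude of the centre at which the section has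
    radius exactly \<open>a\<close>.\<close>
  define q where "q = cos R / cos a"
  have ca: "cos a > 0" using a R by (intro cos_gt_zero) auto
  have cR: "0 \<le> cos R" "cos R < cos a"
    using a R by (auto intro!: cos_ge_zero cos_monotone_0_pi)
  have q: "0 \<le> q" "q < 1" using ca cR by (auto simp: q_def)
  have b: "0 \<le> arccos q" "arccos q \<le> pi / 2" using arccos_bounds_unit[of q] q by auto
  have Req: "R = arccos (cos R)" using a R by (simp add: arccos_cos)
  \<comment> \<open>Since \<open>cos R \<le> q\<close>, the bound
    \<open>\<bar>t\<bar> \<le> R\<close> is implied by \<open>\<bar>t\<bar> \<le> arccos q\<close>
    and disappears from the domain.\<close>
  have bR: "arccos q \<le> R"
    by (subst Req, rule arccos_le_arccos) (use q cR ca a R in \<open>auto simp: q_def field_simps mult_left_le\<close>)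
  define f1 where "f1 t = q ^ (n + 1) * (cos t / sqrt ((cos t)\<^sup>2 - q\<^sup>2))" for t
  define f2 where "f2 t = cos t ^ (n + 1) * (real n + 1) * cos_power_integral n (q / cos t)" for t
  define f2' where "f2' t = cos t ^ (n + 1) * (real n + 1) * cos_power_integral n (max (-1) (min 1 (q / cos t)))" for t
  have [measurable]: "f1 \<in> borel_measurable borel" "f2' \<in> borel_measurable borel"
    unfolding f1_def f2'_def by measurable
  define F where "F t = ennreal (cos t ^ (n + 1)) * ennreal (inversion_kernel n a (arccos (cos R / cos t))) *
     indicator {t. -R \<le> t \<and> t \<le> R \<and> cos R < cos a * cos t} t" for t
  define G where "G t = (ennreal (f1 t) + ennreal (f2' t)) * indicator {t. -R \<le> t \<and> t \<le> R \<and> q < cos t} t" for t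
  have [measurable]: "G \<in> borel_measurable borel" unfolding G_def by measurable
  have iff: "cos R < cos a * cos t \<longleftrightarrow> q < cos t" for t
    using ca by (simp add: q_def field_simps)
  have FG: "F t = G t" for t
  proof (cases "-R \<le> t \<and> t \<le> R \<and> q < cos t")
    case True
    then have ct: "0 < cos t" "q < cos t" using q by auto
    have r: "cos R / cos t = cos a * (q / cos t)" using ca by (simp add: q_def)
    have qt: "0 \<le> q / cos t" "q / cos t < 1" using ct q by auto
    have "cos R / cos t \<le> cos R / cos R" if "cos R > 0"
    proof -
      have "cos R \<le> cos \<bar>t\<bar>" using True a R by (intro cos_monotone_0_pi_le) auto
      then show ?thesis using that by (intro divide_left_mono mult_pos_pos) auto
    qed
    then have le1: "0 \<le> cos R / cos t" "cos R / cos t \<le> 1"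
      using cR ct by (cases "cos R = 0"; force)+
    have cy: "cos (arccos (cos R / cos t)) = cos R / cos t" using le1 by simp
    \<comment> \<open>The weight cancels the powers of \<open>cos t\<close> in the numerator of the
      kernel. Scaling the root produces one more factor \<open>cos a\<close>, which completes
      \<open>cos a ^ n\<close> to the power needed for \<open>q ^ (n + 1)\<close>, and a factor
      \<open>1 / cos t\<close>, which leaves \<open>cos t\<close> in the numerator of
      \<open>f1\<close>.\<close>
    have k1: "cos t ^ (n + 1) * ((cos R / cos t) ^ (n + 1) / sqrt ((cos a)\<^sup>2 - (cos R / cos t)\<^sup>2) / cos a ^ n) = f1 t"
    proof -
      have "sqrt ((cos a)\<^sup>2 - (cos R / cos t)\<^sup>2) = sqrt ((cos a / cos t)\<^sup>2 * ((cos t)\<^sup>2 - q\<^sup>2))"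
        using ct ca by (simp add: q_def field_simps power_divide)
      also have "\<dots> = cos a / cos t * sqrt ((cos t)\<^sup>2 - q\<^sup>2)"
        using ct ca by (simp add: real_sqrt_mult)
      finally have s: "sqrt ((cos a)\<^sup>2 - (cos R / cos t)\<^sup>2) = cos a / cos t * sqrt ((cos t)\<^sup>2 - q\<^sup>2)" .
      have qp: "q ^ (n + 1) = cos R ^ (n + 1) / cos a ^ (n + 1)" by (simp add: q_def power_divide)
      show ?thesis unfolding s f1_def qp using ct ca by (simp add: power_divide field_simps)
    qed
    have nn1: "0 \<le> f1 t" unfolding f1_def using q ct by simp
    have nn2: "0 \<le> f2 t" unfolding f2_def using qt ct by (intro mult_nonneg_nonneg cos_power_integral_nonneg) auto
    have "cos t ^ (n + 1) * inversion_kernel n a (arccos (cos R / cos t)) = f1 t + f2 t"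
      unfolding inversion_kernel_def cy distrib_left k1 f2_def
      using ca by (simp add: q_def field_simps)
    moreover have "f2' t = f2 t" unfolding f2_def f2'_def using qt by (simp add: max_def min_def)
    ultimately show ?thesis unfolding F_def G_def iff using True nn1 nn2 ct
      by (simp add: ennreal_mult'[symmetric] ennreal_plus[symmetric] del: ennreal_plus)
  qed (auto simp: F_def G_def iff)
  have "F \<in> borel_measurable borel" unfolding FG[abs_def] by simp
  then show ?measurable unfolding F_def[abs_def] .
  have "(\<integral>\<^sup>+t. F t \<partial>lborel) = (\<integral>\<^sup>+t. G t \<partial>lborel)" by (simp add: FG)
  also have "\<dots> = 2 * (\<integral>\<^sup>+t. G t * indicator {0..} t \<partial>lborel)"
    by (rule nn_integral_even_set) (auto simp: G_def f1_def f2'_def indicator_def)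
  also have "(\<integral>\<^sup>+t. G t * indicator {0..} t \<partial>lborel) =
      (\<integral>\<^sup>+t. ennreal (f1 t) * indicator {0..arccos q} t + ennreal (f2' t) * indicator {0..arccos q} t \<partial>lborel)"
  proof (intro nn_integral_cong_AE eventually_mono[OF AE_lborel_singleton[of "arccos q"]])
    fix t assume "t \<noteq> arccos q"
    then have "(-R \<le> t \<and> t \<le> R \<and> q < cos t) \<and> 0 \<le> t \<longleftrightarrow> t \<in> {0..arccos q}"
      using cos_gt_iff_less_arccos(1)[of q t] q b bR R pi_gt_zero by auto
    then show "G t * indicator {0..} t = ennreal (f1 t) * indicator {0..arccos q} t + ennreal (f2' t) * indicator {0..arccos q} t"
      unfolding G_def by (auto simp: indicator_def)
  qed
  also have "\<dots> = (\<integral>\<^sup>+t. ennreal (f1 t) * indicator {0..arccos q} t \<partial>lborel) + (\<integral>\<^sup>+t. ennreal (f2' t) * indicator {0..arccos q} t \<partial>lborel)"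
    by (rule nn_integral_add) auto
  also have "(\<integral>\<^sup>+t. ennreal (f1 t) * indicator {0..arccos q} t \<partial>lborel) = ennreal (q ^ (n + 1) * (pi / 2))"
  proof -
    have "(\<integral>\<^sup>+t. ennreal (f1 t) * indicator {0..arccos q} t \<partial>lborel) = (\<integral>\<^sup>+t. ennreal (q ^ (n + 1)) *
       (ennreal (cos t / sqrt ((cos t)\<^sup>2 - q\<^sup>2)) * indicator {0..arccos q} t) \<partial>lborel)"
      by (intro nn_integral_cong) (simp only: f1_def ennreal_mult'[OF zero_le_power[OF q(1)]] mult.assoc)
    also have "\<dots> = ennreal (q ^ (n + 1)) * ennreal (pi / 2)"
      by (subst nn_integral_cmult) (auto simp: nn_integral_arcsin_kernel[OF q] simp del: power_Suc)
    finally show ?thesis using q by (simp only: ennreal_mult'[OF zero_le_power[OF q(1)]])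
  qed
  also have "(\<integral>\<^sup>+t. ennreal (f2' t) * indicator {0..arccos q} t \<partial>lborel) = (\<integral>\<^sup>+t. ennreal (f2 t) * indicator {0..arccos q} t \<partial>lborel)"
  proof (intro nn_integral_cong_AE eventually_mono[OF AE_lborel_singleton[of "arccos q"]])
    fix t assume "t \<noteq> arccos q"
    then have "q / cos t \<in> {0..1}" if "t \<in> {0..arccos q}"
      using that cos_gt_iff_less_arccos(1)[of q t] q b by auto
    then show "ennreal (f2' t) * indicator {0..arccos q} t = ennreal (f2 t) * indicator {0..arccos q} t"
      by (auto simp: f2_def f2'_def indicator_def max_def min_def)
  qed
  also have "\<dots> = ennreal (pi / 2 * (1 - q ^ (n + 1)))"
    unfolding f2_def by (rule nn_integral_double_cos_power[OF q])
  also have "2 * (ennreal (q ^ (n + 1) * (pi / 2)) + ennreal (pi / 2 * (1 - q ^ (n + 1)))) = ennreal pi"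
  proof -
    have "ennreal (q ^ (n + 1) * (pi / 2)) + ennreal (pi / 2 * (1 - q ^ (n + 1))) = ennreal (pi / 2)"
      using q by (subst ennreal_plus[symmetric]) (auto simp: power_le_one algebra_simps mult_left_le_one_le simp del: power_Suc)
    moreover have "2 * ennreal (pi / 2) = ennreal pi"
      by (simp add: ennreal_mult'[symmetric] flip: ennreal_numeral)
    ultimately show ?thesis by simp
  qed
  finally show ?integral unfolding F_def .
qed

section \<open>Charts of the sphere\<close>

lemma prod_Basis_cart:
  fixes f :: "real ^ 'm::finite \<Rightarrow> 'b::comm_monoid_mult"
  shows "(\<Prod>b\<in>Basis. f b) = (\<Prod>i\<in>UNIV. f (axis i 1))"
proof -
  have B: "Basis = (\<lambda>i::'m. axis i (1::real)) ` UNIV" by (auto simp: Basis_vec_def)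
  have inj: "inj (\<lambda>i::'m. axis i (1::real))" by (auto simp: inj_on_def axis_eq_axis)
  show ?thesis unfolding B by (subst prod.reindex[OF inj]) simp
qed

lemma emeasure_lborel_box_cart:
  fixes l u :: "real ^ 'm"
  assumes "\<And>i. l $ i \<le> u $ i"
  shows "emeasure lborel (box l u) = ennreal (\<Prod>i\<in>UNIV. (u - l) $ i)"
proof -
  have "emeasure lborel (box l u) = ennreal (\<Prod>b\<in>Basis. (u - l) \<bullet> b)"
    by (rule emeasure_lborel_box) (use assms in \<open>auto simp: Basis_vec_def inner_axis\<close>)
  then show ?thesis by (simp add: prod_Basis_cart inner_axis)
qed

definition vec_join :: "('l \<Rightarrow> 'm) \<Rightarrow> 'm \<Rightarrow> real ^ 'l \<Rightarrow> real \<Rightarrow> real ^ 'm"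
  where "vec_join e z u t = (\<chi> i. if i = z then t else u $ (inv e i))"

lemma continuous_on_vec_join:
  assumes "continuous_on A f" "continuous_on A g"
  shows "continuous_on A (\<lambda>x. vec_join e z (f x) (g x))"
  unfolding vec_join_def
proof (rule continuous_on_vec_lambda)
  show "continuous_on A (\<lambda>x. if i = z then g x else f x $ inv e i)" for i
    using assms by (cases "i = z") (auto intro: continuous_on_component)
qed

text \<open>The dimensions are carried by index types related only through their cardinalities. The
  injection \<open>e\<close>, which misses exactly the index \<open>z\<close>, is what identifies
  the space indexed by \<open>'m\<close> with the product of the space indexed by \<open>'l\<close>
  and a line.\<close>

locale coordinate_split =
  fixes e :: "'l::finite \<Rightarrow> 'm::finite" and z :: 'm
  assumes inj_e: "inj e" and range_e: "range e = UNIV - {z}"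
begin

lemma e_neq: "e j \<noteq> z" using range_e by auto

lemma vec_join_nth: "vec_join e z u t $ z = t" "vec_join e z u t $ e j = u $ j"
  by (auto simp: vec_join_def e_neq inv_f_f[OF inj_e])

lemma index_cases: obtains "i = z" | j where "i = e j"
  using range_e by blast

lemma prod_split:
  fixes f :: "'m \<Rightarrow> 'b::comm_monoid_mult"
  shows "(\<Prod>i\<in>UNIV. f i) = f z * (\<Prod>j\<in>UNIV. f (e j))"
proof -
  have "(\<Prod>i\<in>UNIV. f i) = f z * (\<Prod>i\<in>range e. f i)"
    unfolding range_e by (rule prod.remove) auto
  then show ?thesis by (simp add: prod.reindex[OF inj_e])
qed


lemma vec_join_measurable [measurable]:
  "(\<lambda>(u, t). vec_join e z u t) \<in> borel_measurable (lborel \<Otimes>\<^sub>M lborel)"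
proof -
  have "continuous_on UNIV (\<lambda>(u, t). vec_join e z u t)"
    unfolding case_prod_unfold by (intro continuous_on_vec_join continuous_intros)
  then have "(\<lambda>(u, t). vec_join e z u t) \<in> borel_measurable borel"
    by (rule borel_measurable_continuous_onI)
  then show ?thesis
    by (simp only: borel_prod measurable_cong_sets[OF sets_pair_measure_cong[OF sets_lborel sets_lborel] refl])
qed

text \<open>Lebesgue measure is determined by the volumes of boxes, and the preimage of a box is a
  box times an interval.\<close>

lemma lborel_eq_distr_vec_join:
  "(lborel :: (real ^ 'm) measure) = distr (lborel \<Otimes>\<^sub>M lborel) borel (\<lambda>(u, t). vec_join e z u t)"
proof (rule lborel_eqI)
  fix l u :: "real ^ 'm"
  assume "\<And>b. b \<in> Basis \<Longrightarrow> l \<bullet> b \<le> u \<bullet> b"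
  then have le: "l $ i \<le> u $ i" for i
    by (metis axis_in_Basis_iff inner_axis inner_commute inner_real_def mult.right_neutral Basis_real_def insertI1)
  define l' u' :: "real ^ 'l" where "l' = (\<chi> j. l $ e j)" and "u' = (\<chi> j. u $ e j)"
  have "(\<lambda>(u, t). vec_join e z u t) -` box l u \<inter> space (lborel \<Otimes>\<^sub>M lborel) = box l' u' \<times> {l $ z<..<u $ z}"
  proof -
    have "vec_join e z v t \<in> box l u \<longleftrightarrow> v \<in> box l' u' \<and> t \<in> {l $ z<..<u $ z}" for v t
      unfolding mem_box_cart l'_def u'_def
      by (auto simp: vec_join_nth) (metis index_cases vec_join_nth)+
    then show ?thesis by (auto simp: space_pair_measure)
  qed
  then have "emeasure (distr (lborel \<Otimes>\<^sub>M lborel) borel (\<lambda>(u, t). vec_join e z u t)) (box l u)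
    = emeasure lborel (box l' u') * emeasure lborel {l $ z<..<u $ z}"
    by (subst emeasure_distr) (auto simp: lborel.emeasure_pair_measure_Times)
  also have "\<dots> = ennreal (\<Prod>j\<in>UNIV. (u' - l') $ j) * ennreal (u $ z - l $ z)"
    using le by (subst emeasure_lborel_box_cart) (auto simp: l'_def u'_def)
  also have "\<dots> = ennreal ((\<Prod>j\<in>UNIV. (u - l) $ e j) * (u $ z - l $ z))"
    using le by (simp add: l'_def u'_def ennreal_mult' prod_nonneg)
  also have "\<dots> = ennreal (\<Prod>b\<in>Basis. (u - l) \<bullet> b)"
    by (simp add: prod_Basis_cart inner_axis prod_split mult.commute)
  finally show "emeasure (distr (lborel \<Otimes>\<^sub>M lborel) borel (\<lambda>(u, t). vec_join e z u t)) (box l u) =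
    ennreal (\<Prod>b\<in>Basis. (u - l) \<bullet> b)" .
qed simp

text \<open>Product integrands suffice: the volume density of the suspension chart factors into a
  function of the latitude and a function of the remaining coordinates.\<close>

lemma nn_integral_lborel_split:
  fixes f :: "real \<Rightarrow> ennreal" and g :: "real ^ 'l \<Rightarrow> ennreal"
  assumes [measurable]: "f \<in> borel_measurable borel" "g \<in> borel_measurable borel"
  shows "(\<integral>\<^sup>+x. f (x $ z) * g (\<chi> j. x $ e j) \<partial>lborel) = (\<integral>\<^sup>+t. f t \<partial>lborel) * (\<integral>\<^sup>+u. g u \<partial>lborel)"
proof -
  have [measurable]: "(\<lambda>x. \<chi> j. x $ e j) \<in> borel_measurable (borel :: (real ^ 'm) measure)"
    by (intro borel_measurable_continuous_onI continuous_on_vec_lambda continuous_intros)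
  have [measurable]: "(\<lambda>x. x $ z) \<in> borel_measurable (borel :: (real ^ 'm) measure)"
    by (intro borel_measurable_continuous_onI continuous_intros)
  have "(\<integral>\<^sup>+x. f (x $ z) * g (\<chi> j. x $ e j) \<partial>lborel) = (\<integral>\<^sup>+(u, t). f t * g u \<partial>(lborel \<Otimes>\<^sub>M lborel))"
    by (subst lborel_eq_distr_vec_join, subst nn_integral_distr)
       (auto simp: vec_join_nth case_prod_unfold)
  also have "\<dots> = (\<integral>\<^sup>+u. \<integral>\<^sup>+t. f t * g u \<partial>lborel \<partial>lborel)"
    by (subst lborel.nn_integral_fst[symmetric]) auto
  also have "\<dots> = (\<integral>\<^sup>+t. f t \<partial>lborel) * (\<integral>\<^sup>+u. g u \<partial>lborel)"
    by (simp add: nn_integral_multc nn_integral_cmult)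
  finally show ?thesis .
qed

end

section \<open>Charts and metric tensors computed from the derivative as a linear map\<close>

lemma gram_entry:
  fixes A :: "real ^ 'm ^ 'n"
  shows "(transpose A ** A) $ i $ j = (A *v axis i 1) \<bullet> (A *v axis j 1)"
  by (simp add: matrix_matrix_mult_def transpose_def matrix_vector_mul_component inner_vec_def
      matrix_vector_mult_basis column_def)

text \<open>The derivative is given as a family of linear maps, so that inner products of tangent
  vectors can be computed without matrices. Continuity of the Jacobian matrix needs only continuity
  for each fixed direction, since its columns are the images of the unit vectors.\<close>

lemma local_parametrizationI:
  fixes \<phi> :: "real ^ 'm \<Rightarrow> real ^ 'n" and D :: "real ^ 'm \<Rightarrow> real ^ 'm \<Rightarrow> real ^ 'n"
  assumes "open U" and "openin (top_of_set M) (\<phi> ` U)"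
    and \<psi>: "continuous_on (\<phi> ` U) \<psi>" "\<And>x. x \<in> U \<Longrightarrow> \<psi> (\<phi> x) = x"
    and D: "\<And>x. x \<in> U \<Longrightarrow> (\<phi> has_derivative D x) (at x)"
    and inj: "\<And>x h. x \<in> U \<Longrightarrow> D x h = 0 \<Longrightarrow> h = 0"
    and cont: "\<And>h. continuous_on U (\<lambda>x. D x h)"
  shows "local_parametrization M U \<phi> (\<lambda>x. matrix (D x))"
proof -
  have lin: "linear (D x)" if "x \<in> U" for x
    using D[OF that] by (rule has_derivative_linear)
  have mat: "(\<lambda>h. matrix (D x) *v h) = D x" if "x \<in> U" for x
    using lin[OF that] by (simp add: fun_eq_iff)
  have "continuous_on U \<phi>"
    using D by (meson continuous_at_imp_continuous_on has_derivative_continuous)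
  then have "homeomorphism U (\<phi> ` U) \<phi> \<psi>"
    using \<psi> by (auto simp: homeomorphism_def image_iff)
  moreover have "inj (D x)" if "x \<in> U" for x
    using inj[OF that] by (simp add: linear_injective_0[OF lin[OF that]])
  moreover have "continuous_on U (\<lambda>x. matrix (D x))"
    unfolding matrix_def by (intro continuous_on_vec_lambda continuous_intros cont)
  ultimately show ?thesis
    unfolding local_parametrization_def using assms(1,2) D mat by auto
qed

section \<open>Stereographic charts of great spheres\<close>

definition stereo_weight :: "real ^ 'm \<Rightarrow> real"
  where "stereo_weight u = 1 / (1 + u \<bullet> u)"

lemma stereo_weight_pos: "0 < stereo_weight u"
  using inner_ge_zero[of u] by (simp add: stereo_weight_def add_pos_nonneg)

lemma stereo_weight_inner: "stereo_weight u * (u \<bullet> u) = 1 - stereo_weight u"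
proof -
  have "1 + u \<bullet> u \<noteq> 0" using inner_ge_zero[of u] by linarith
  then show ?thesis by (simp add: stereo_weight_def field_simps)
qed

text \<open>Inverse stereographic projection from \<open>p\<close>, with the parameter scaled by the
  radius: the origin goes to the antipode \<open>- p\<close>, and \<open>p\<close> itself is only
  approached as \<open>u\<close> tends to infinity. The conformal factor is
  \<open>2 * r * stereo_weight u\<close>.\<close>

definition stereo :: "real \<Rightarrow> real ^ 'n \<Rightarrow> (real ^ 'm \<Rightarrow> real ^ 'n) \<Rightarrow> real ^ 'm \<Rightarrow> real ^ 'n"
  where "stereo r p B u = (1 - 2 * stereo_weight u) *\<^sub>R p + (2 * r * stereo_weight u) *\<^sub>R B u"

definition stereo_deriv ::
  "real \<Rightarrow> real ^ 'n \<Rightarrow> (real ^ 'm \<Rightarrow> real ^ 'n) \<Rightarrow> real ^ 'm \<Rightarrow> real ^ 'm \<Rightarrow> real ^ 'n"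
  where "stereo_deriv r p B u h = (4 * (u \<bullet> h) * (stereo_weight u)\<^sup>2) *\<^sub>R p +
    ((2 * r * stereo_weight u) *\<^sub>R B h - (4 * r * (u \<bullet> h) * (stereo_weight u)\<^sup>2) *\<^sub>R B u)"

text \<open>\<open>B\<close> identifies the parameter space with the orthogonal complement of \<open>p\<close> in \<open>K\<close>; \<open>p\<close> is the centre of the stereographic projection of \<open>sphere 0 r \<inter> K\<close>.\<close>

locale stereographic =
  fixes r :: real and K :: "(real ^ 'n) set" and p :: "real ^ 'n" and B :: "real ^ 'm \<Rightarrow> real ^ 'n"
  assumes r_pos: "0 < r" and subspace_K: "subspace K" and p_K: "p \<in> K" and norm_p: "norm p = r"
    and linear_B: "linear B" and norm_B: "\<And>u. norm (B u) = norm u"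
    and range_B: "range B = {y \<in> K. p \<bullet> y = 0}"
begin

abbreviation "\<phi> \<equiv> stereo r p B"
abbreviation "D \<equiv> stereo_deriv r p B"

lemma p_p: "p \<bullet> p = r\<^sup>2"
  using norm_p by (simp add: dot_square_norm)

lemma B_K: "B u \<in> K" and p_B [simp]: "p \<bullet> B u = 0" and B_p [simp]: "B u \<bullet> p = 0"
  using range_B by (auto simp: inner_commute)

lemma B_B [simp]: "B u \<bullet> B v = u \<bullet> v"
proof -
  have "(B u) \<bullet> (B v) = ((norm (B (u + v)))\<^sup>2 - (norm (B u))\<^sup>2 - (norm (B v))\<^sup>2) / 2"
    by (simp add: dot_norm linear_add[OF linear_B])
  also have "\<dots> = u \<bullet> v" by (simp add: norm_B dot_norm)
  finally show ?thesis .
qed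

text \<open>The adjoint serves as left inverse of \<open>B\<close>. It is linear on the whole
  ambient space, which makes the inverse of the chart visibly continuous.\<close>

lemma adjoint_B [simp]: "adjoint B (B u) = u"
proof -
  have "v \<bullet> adjoint B (B u) = v \<bullet> u" for v
    by (simp add: adjoint_works[OF linear_B])
  then show ?thesis by (metis vector_eq_ldot)
qed

lemma adjoint_B_p [simp]: "adjoint B p = 0"
proof -
  have "v \<bullet> adjoint B p = v \<bullet> 0" for v
    by (simp add: adjoint_works[OF linear_B])
  then show ?thesis by (metis vector_eq_ldot)
qed

lemma linear_adjoint_B: "linear (adjoint B)"
  by (rule adjoint_linear[OF linear_B])

lemma adjoint_B_stereo: "adjoint B (\<phi> u) = (2 * r * stereo_weight u) *\<^sub>R u"
  by (simp add: stereo_def linear_add[OF linear_adjoint_B] linear_scale[OF linear_adjoint_B])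

lemma stereo_p: "\<phi> u \<bullet> p = r\<^sup>2 - 2 * r\<^sup>2 * stereo_weight u"
  by (simp add: stereo_def inner_add_left p_p algebra_simps)

lemma stereo_stereo: "\<phi> u \<bullet> \<phi> u = r\<^sup>2"
proof -
  have "\<phi> u \<bullet> \<phi> u = (1 - 2 * stereo_weight u)\<^sup>2 * r\<^sup>2 + (2 * r * stereo_weight u)\<^sup>2 * (u \<bullet> u)"
    by (simp add: stereo_def inner_add_left inner_add_right p_p power2_eq_square)
  then show ?thesis using stereo_weight_inner[of u] by algebra
qed

lemma stereo_K: "\<phi> u \<in> K"
  unfolding stereo_def using subspace_K p_K B_K by (intro subspace_add subspace_scale) auto

lemma stereo_sphere: "\<phi> u \<in> sphere 0 r \<inter> K"
  using stereo_stereo[of u] stereo_K r_pos by (simp add: norm_eq_sqrt_inner)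

lemma stereo_neq: "\<phi> u \<noteq> p"
  using stereo_p[of u] p_p stereo_weight_pos[of u] r_pos by auto

text \<open>Conformality. The terms with the product
  \<open>(u \<bullet> h) * (u \<bullet> h')\<close> add up to a multiple of
  \<open>stereo_weight u * (1 + u \<bullet> u) - 1\<close>, which is 0.\<close>

lemma stereo_deriv_stereo_deriv: "D u h \<bullet> D u h' = (2 * r * stereo_weight u)\<^sup>2 * (h \<bullet> h')"
proof -
  have "D u h \<bullet> D u h' =
    (4 * (u \<bullet> h) * (stereo_weight u)\<^sup>2) * (4 * (u \<bullet> h') * (stereo_weight u)\<^sup>2) * r\<^sup>2 +
    (2 * r * stereo_weight u)\<^sup>2 * (h \<bullet> h')
    - (2 * r * stereo_weight u) * (4 * r * (u \<bullet> h') * (stereo_weight u)\<^sup>2) * (u \<bullet> h)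
    - (2 * r * stereo_weight u) * (4 * r * (u \<bullet> h) * (stereo_weight u)\<^sup>2) * (u \<bullet> h')
    + (4 * r * (u \<bullet> h) * (stereo_weight u)\<^sup>2) * (4 * r * (u \<bullet> h') * (stereo_weight u)\<^sup>2) * (u \<bullet> u)"
    by (simp add: stereo_deriv_def inner_add_left inner_add_right inner_diff_left inner_diff_right
        p_p power2_eq_square inner_commute[of h u] algebra_simps)
  then show ?thesis using stereo_weight_inner[of u] by algebra
qed

text \<open>Tangent vectors are orthogonal to the radius. In the suspension this removes the cross
  terms between latitude and equator.\<close>

lemma stereo_deriv_stereo: "D u h \<bullet> \<phi> u = 0" "\<phi> u \<bullet> D u h = 0"
proof -
  have "D u h \<bullet> \<phi> u =
    (4 * (u \<bullet> h) * (stereo_weight u)\<^sup>2) * (1 - 2 * stereo_weight u) * r\<^sup>2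
    + (2 * r * stereo_weight u)\<^sup>2 * (u \<bullet> h)
    - (4 * r * (u \<bullet> h) * (stereo_weight u)\<^sup>2) * (2 * r * stereo_weight u) * (u \<bullet> u)"
    by (simp add: stereo_deriv_def stereo_def inner_add_left inner_add_right inner_diff_left inner_diff_right
        p_p power2_eq_square inner_commute[of h u] algebra_simps)
  then show "D u h \<bullet> \<phi> u = 0" using stereo_weight_inner[of u] by algebra
  then show "\<phi> u \<bullet> D u h = 0" by (simp add: inner_commute)
qed

lemma stereo_deriv_K: "D u h \<in> K"
  unfolding stereo_deriv_def using subspace_K p_K B_K
  by (intro subspace_add subspace_scale subspace_diff) auto

lemma stereo_deriv_eq_0: assumes "D u h = 0" shows "h = 0"
proof -
  have "(2 * r * stereo_weight u)\<^sup>2 * (h \<bullet> h) = 0"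
    using stereo_deriv_stereo_deriv[of u h h] assms by simp
  then show ?thesis using r_pos stereo_weight_pos[of u] by simp
qed

lemma bounded_linear_B: "bounded_linear B"
  using linear_B by (simp add: linear_conv_bounded_linear)

lemma has_derivative_stereo: "(\<phi> has_derivative D u) (at u)"
proof -
  have ne: "1 + u \<bullet> u \<noteq> 0" using inner_ge_zero[of u] by linarith
  have w: "(stereo_weight has_derivative (\<lambda>h. - 2 * (u \<bullet> h) * (stereo_weight u)\<^sup>2)) (at u)"
    unfolding stereo_weight_def[abs_def] using ne
    by (auto intro!: derivative_eq_intros simp: fun_eq_iff inner_commute power2_eq_square divide_simps)
  show ?thesis
    unfolding stereo_def[abs_def] stereo_deriv_def[abs_def]
    by (rule derivative_eq_intros w bounded_linear.has_derivative[OF bounded_linear_B] refl)+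
       (auto simp: fun_eq_iff algebra_simps)
qed

lemma continuous_on_stereo_weight: "continuous_on A (stereo_weight :: real ^ 'm \<Rightarrow> real)"
  unfolding stereo_weight_def[abs_def]
  by (intro continuous_intros) (metis add_pos_nonneg inner_ge_zero less_irrefl zero_less_one)

lemma continuous_on_stereo_deriv: "continuous_on A (\<lambda>u. D u h)"
  unfolding stereo_deriv_def
  by (intro continuous_intros continuous_on_stereo_weight
      linear_continuous_on_compose[OF continuous_on_id linear_B])

lemma sphere_K_decompose:
  assumes x: "x \<in> sphere 0 r \<inter> K"
  obtains y where "x = ((x \<bullet> p) / r\<^sup>2) *\<^sub>R p + B y" "y \<bullet> y = r\<^sup>2 - (x \<bullet> p)\<^sup>2 / r\<^sup>2"
proof -
  define y' where "y' = x - ((x \<bullet> p) / r\<^sup>2) *\<^sub>R p"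
  have "y' \<in> K" unfolding y'_def using x subspace_K p_K by (intro subspace_diff subspace_scale) auto
  moreover have "p \<bullet> y' = 0" using r_pos by (simp add: y'_def inner_diff_right p_p inner_commute)
  ultimately obtain y where y: "y' = B y" using range_B by blast
  have "x \<bullet> x = r\<^sup>2" using x by (simp add: dot_square_norm)
  then have "y' \<bullet> y' = r\<^sup>2 - (x \<bullet> p)\<^sup>2 / r\<^sup>2"
    using r_pos by (simp add: y'_def inner_diff_left inner_diff_right p_p inner_commute field_simps power2_eq_square)
  moreover have "y' \<bullet> y' = y \<bullet> y" by (simp add: y)
  moreover have "x = ((x \<bullet> p) / r\<^sup>2) *\<^sub>R p + B y" unfolding y[symmetric] y'_def by simp
  ultimately show ?thesis using that[of y] by simp
qed

lemma inner_p_less: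
  assumes x: "x \<in> sphere 0 r \<inter> K" "x \<noteq> p" shows "x \<bullet> p < r\<^sup>2"
proof -
  obtain y where y: "x = ((x \<bullet> p) / r\<^sup>2) *\<^sub>R p + B y" "y \<bullet> y = r\<^sup>2 - (x \<bullet> p)\<^sup>2 / r\<^sup>2"
    using sphere_K_decompose x by blast
  have "x \<bullet> p \<le> norm x * norm p" by (rule norm_cauchy_schwarz)
  then have "x \<bullet> p \<le> r\<^sup>2" using x norm_p by (simp add: power2_eq_square)
  moreover have "x \<bullet> p \<noteq> r\<^sup>2"
  proof
    assume *: "x \<bullet> p = r\<^sup>2"
    then have "y \<bullet> y = 0" using y(2) r_pos by (simp add: power2_eq_square)
    then have "x = p" using y(1) * r_pos linear_0[OF linear_B] by simp
    then show False using x by simp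
  qed
  ultimately show ?thesis by simp
qed

text \<open>The second formula locates the hemisphere \<open>x \<bullet> p \<le> 0\<close> in the
  parameter space: there the quotient is at most 1, so the hemisphere is covered by the closed unit
  ball.\<close>

lemma stereo_surj:
  assumes x: "x \<in> sphere 0 r \<inter> K" "x \<noteq> p"
  shows "\<phi> ((r / (r\<^sup>2 - x \<bullet> p)) *\<^sub>R adjoint B x) = x"
    and "((r / (r\<^sup>2 - x \<bullet> p)) *\<^sub>R adjoint B x) \<bullet> ((r / (r\<^sup>2 - x \<bullet> p)) *\<^sub>R adjoint B x) = (r\<^sup>2 + x \<bullet> p) / (r\<^sup>2 - x \<bullet> p)"
proof -
  define s where "s = x \<bullet> p"
  define u where "u = (r / (r\<^sup>2 - x \<bullet> p)) *\<^sub>R adjoint B x"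
  obtain y where y: "x = (s / r\<^sup>2) *\<^sub>R p + B y" "y \<bullet> y = r\<^sup>2 - s\<^sup>2 / r\<^sup>2"
    unfolding s_def using sphere_K_decompose x by blast
  have s: "s < r\<^sup>2" unfolding s_def by (rule inner_p_less[OF x])
  have "adjoint B x = y" 
    by (subst y(1)) (simp add: linear_add[OF linear_adjoint_B] linear_scale[OF linear_adjoint_B])
  then have u: "u = (r / (r\<^sup>2 - s)) *\<^sub>R y" by (simp add: u_def s_def)
  have "u \<bullet> u = (r / (r\<^sup>2 - s))\<^sup>2 * (r\<^sup>2 - s\<^sup>2 / r\<^sup>2)"
    by (simp add: u y(2) power2_eq_square)
  also have "\<dots> = (r\<^sup>2 + s) / (r\<^sup>2 - s)"
  proof -
    have "r\<^sup>2 - s\<^sup>2 / r\<^sup>2 = (r\<^sup>2 - s) * (r\<^sup>2 + s) / r\<^sup>2"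
      using r_pos by (simp add: field_simps power2_eq_square)
    then show ?thesis using s r_pos by (simp add: power_divide power2_eq_square)
  qed
  finally have uu: "u \<bullet> u = (r\<^sup>2 + s) / (r\<^sup>2 - s)" .
  then show "((r / (r\<^sup>2 - x \<bullet> p)) *\<^sub>R adjoint B x) \<bullet> ((r / (r\<^sup>2 - x \<bullet> p)) *\<^sub>R adjoint B x) = (r\<^sup>2 + x \<bullet> p) / (r\<^sup>2 - x \<bullet> p)"
    by (simp add: u_def s_def)
  have w: "stereo_weight u = (r\<^sup>2 - s) / (2 * r\<^sup>2)"
    using s r_pos by (simp add: stereo_weight_def uu field_simps)
  have "\<phi> u = x"
    unfolding stereo_def w using s r_pos
    by (subst y(1)) (simp add: u linear_scale[OF linear_B] field_simps power2_eq_square)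
  then show "\<phi> ((r / (r\<^sup>2 - x \<bullet> p)) *\<^sub>R adjoint B x) = x" by (simp add: u_def)
qed

lemma stereo_left_inverse: "(r / (r\<^sup>2 - \<phi> u \<bullet> p)) *\<^sub>R adjoint B (\<phi> u) = u"
  using r_pos stereo_weight_pos[of u] by (simp add: adjoint_B_stereo stereo_p power2_eq_square)

lemma stereo_image_UNIV: "\<phi> ` UNIV = sphere 0 r \<inter> K - {p}"
proof (intro equalityI subsetI)
  show "x \<in> sphere 0 r \<inter> K - {p}" if "x \<in> \<phi> ` UNIV" for x
    using that stereo_sphere stereo_neq by auto
  show "x \<in> \<phi> ` UNIV" if "x \<in> sphere 0 r \<inter> K - {p}" for x
    using that by (intro image_eqI[where x="(r / (r\<^sup>2 - x \<bullet> p)) *\<^sub>R adjoint B x"]) (auto simp: stereo_surj(1))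
qed

lemma continuous_on_adjoint_B: "continuous_on A (adjoint B)"
  using linear_adjoint_B by (simp add: linear_continuous_on linear_conv_bounded_linear)

lemma local_parametrization_stereo:
  "local_parametrization (sphere 0 r \<inter> K) UNIV \<phi> (\<lambda>u. matrix (D u))"
proof (rule local_parametrizationI[where \<psi>="\<lambda>x. (r / (r\<^sup>2 - x \<bullet> p)) *\<^sub>R adjoint B x"])
  show "openin (top_of_set (sphere 0 r \<inter> K)) (\<phi> ` UNIV)"
    unfolding stereo_image_UNIV by (intro openin_diff openin_subtopology_self closedin_singleton)
       (use p_K norm_p in auto)
  show "continuous_on (\<phi> ` UNIV) (\<lambda>x. (r / (r\<^sup>2 - x \<bullet> p)) *\<^sub>R adjoint B x)"
    unfolding stereo_image_UNIV using inner_p_less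
    by (intro continuous_intros continuous_on_adjoint_B) force
qed (auto simp: stereo_left_inverse has_derivative_stereo stereo_deriv_eq_0 continuous_on_stereo_deriv)

text \<open>By conformality the Gram matrix is a scalar multiple of the identity.\<close>

lemma det_gram_stereo:
  "sqrt (det (transpose (matrix (D u)) ** matrix (D u))) = (2 * r * stereo_weight u) ^ CARD('m)"
proof -
  have lin: "linear (D u)" using has_derivative_stereo by (rule has_derivative_linear)
  define c where "c = 2 * r * stereo_weight u"
  have c: "0 < c" using r_pos stereo_weight_pos[of u] by (simp add: c_def)
  have g: "(transpose (matrix (D u)) ** matrix (D u)) $ i $ j = (if i = j then c\<^sup>2 else 0)" for i j
    by (simp add: gram_entry lin stereo_deriv_stereo_deriv c_def inner_axis_axis)
  have "det (transpose (matrix (D u)) ** matrix (D u)) = (\<Prod>i\<in>(UNIV::'m set). c\<^sup>2)"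
    by (subst det_diagonal) (auto simp: g)
  also have "\<dots> = (c ^ CARD('m))\<^sup>2" by (simp add: power_mult[symmetric] mult.commute)
  finally show ?thesis using c by (simp add: c_def)
qed

lemma emeasure_stereo_image:
  assumes "riemannian_volume TYPE('m) (sphere 0 r \<inter> K) \<mu>" and "V \<in> sets borel"
  shows "emeasure \<mu> (\<phi> ` V) = (\<integral>\<^sup>+u\<in>V. ennreal ((2 * r * stereo_weight u) ^ CARD('m)) \<partial>lborel)"
  using assms local_parametrization_stereo unfolding riemannian_volume_def det_gram_stereo[symmetric]
  by blast

end

text \<open>The orthogonal complement of \<open>p\<close> in \<open>K\<close> has dimension
  \<open>CARD('m)\<close>, and subspaces of equal dimension are isometric.\<close>

lemma ex_stereographic:
  fixes K :: "(real ^ 'n) set"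
  assumes K: "subspace K" "dim K = CARD('m::finite) + 1" and p: "p \<in> K" "norm p = r" "0 < r"
  shows "\<exists>B :: real ^ 'm \<Rightarrow> real ^ 'n. stereographic r K p B"
proof -
  define S where "S = {y \<in> K. p \<bullet> y = 0}"
  have "S = {y \<in> K. \<forall>x \<in> span {p}. orthogonal x y}"
    by (auto simp: S_def orthogonal_def span_singleton)
  then have "dim S + dim (span {p}) = dim K"
    using dim_subspace_orthogonal_to_vectors[of "span {p}" K] K p
    by (simp add: span_minimal)
  moreover have "dim (span {p}) = 1" using p by (auto simp: dim_insert)
  ultimately have "dim S = CARD('m)" using K by simp
  moreover have "subspace S" using K(1) unfolding S_def
    by (auto simp: subspace_def inner_add_right)
  ultimately obtain B :: "real ^ 'm \<Rightarrow> real ^ 'n" where "linear B" "range B = S" "\<And>x. norm (B x) = norm x"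
    using isometries_subspaces[OF subspace_UNIV, of S] by (metis UNIV_I dim_UNIV DIM_cart DIM_real mult.right_neutral)
  then show ?thesis using assms by (intro exI[of _ B]) (auto simp: stereographic_def S_def)
qed

section \<open>Latitude\<close>

text \<open>Clamping makes the function continuous on the whole space; on the sphere it changes nothing.\<close>

definition latitude :: "real \<Rightarrow> real ^ 'n \<Rightarrow> real ^ 'n \<Rightarrow> real"
  where "latitude r \<nu> x = arcsin (max (-1) (min 1 (x \<bullet> \<nu> / r)))"

lemma continuous_latitude: "continuous_on A (latitude r \<nu>)"
  unfolding latitude_def divide_inverse by (intro continuous_intros) auto

lemma latitude_measurable [measurable]: "latitude r \<nu> \<in> borel_measurable borel"
  by (rule borel_measurable_continuous_onI[OF continuous_latitude])

lemma latitude_bounds: "- (pi / 2) \<le> latitude r \<nu> x" "latitude r \<nu> x \<le> pi / 2"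
  unfolding latitude_def by (intro arcsin_lbound arcsin_ubound; simp)+

lemma sin_latitude:
  assumes "norm x = r" "0 < r" "norm \<nu> = 1"
  shows "r * sin (latitude r \<nu> x) = x \<bullet> \<nu>"
proof -
  have "\<bar>x \<bullet> \<nu>\<bar> \<le> r" using Cauchy_Schwarz_ineq2[of x \<nu>] assms by simp
  then have "-1 \<le> x \<bullet> \<nu> / r" "x \<bullet> \<nu> / r \<le> 1" using assms by (auto simp: field_simps abs_le_iff)
  then show ?thesis using assms by (simp add: latitude_def)
qed

lemma latitude_eqI:
  assumes "x \<bullet> \<nu> = r * sin t" "0 < r" "- (pi / 2) \<le> t" "t \<le> pi / 2"
  shows "latitude r \<nu> x = t"
  using assms by (simp add: latitude_def arcsin_sin)

text \<open>
  The chart \<open>(u, t) \<mapsto> cos t \<phi>(u) + r sin t \<nu>\<close> of the sphere, built from a stereographic chart \<open>\<phi>\<close> of the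
  equator orthogonal to \<open>\<nu>\<close>: its metric tensor is block diagonal, so the volume splits into
  \<open>r cos\<^sup>l t dt\<close> times the volume of the equator. The coordinate \<open>z\<close> carries \<open>t\<close>.
\<close>

locale suspension = coordinate_split e z + stereographic r "{x. \<nu> \<bullet> x = 0}" p B
  for e :: "'l::finite \<Rightarrow> 'm::finite" and z r and p :: "real ^ 'n" and B :: "real ^ 'l \<Rightarrow> real ^ 'n"
    and \<nu> :: "real ^ 'n" +
  assumes norm_\<nu>: "norm \<nu> = 1"
begin

definition horiz :: "real ^ 'm \<Rightarrow> real ^ 'l" where "horiz x = (\<chi> j. x $ e j)"

definition susp :: "real ^ 'm \<Rightarrow> real ^ 'n"
  where "susp x = cos (x $ z) *\<^sub>R \<phi> (horiz x) + (r * sin (x $ z)) *\<^sub>R \<nu>"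

definition susp_deriv :: "real ^ 'm \<Rightarrow> real ^ 'm \<Rightarrow> real ^ 'n"
  where "susp_deriv x h = cos (x $ z) *\<^sub>R D (horiz x) (horiz h)
    - (sin (x $ z) * h $ z) *\<^sub>R \<phi> (horiz x) + (r * cos (x $ z) * h $ z) *\<^sub>R \<nu>"

lemma \<nu>_\<nu>: "\<nu> \<bullet> \<nu> = 1" using norm_\<nu> by (simp add: norm_eq_1)

lemma ortho [simp]: "\<nu> \<bullet> \<phi> u = 0" "\<phi> u \<bullet> \<nu> = 0" "\<nu> \<bullet> D u h = 0" "D u h \<bullet> \<nu> = 0" "\<nu> \<bullet> p = 0" "p \<bullet> \<nu> = 0"
  "\<nu> \<bullet> B u = 0" "B u \<bullet> \<nu> = 0"
  using stereo_K[of u] stereo_deriv_K[of u h] p_K B_K[of u] by (auto simp: inner_commute)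

lemma horiz_join [simp]: "horiz (vec_join e z u t) = u"
  by (simp add: horiz_def vec_join_nth vec_eq_iff)

lemma join_horiz: "vec_join e z (horiz x) (x $ z) = x"
proof -
  have "vec_join e z (horiz x) (x $ z) $ i = x $ i" for i
    by (rule index_cases[of i]) (auto simp: vec_join_nth horiz_def)
  then show ?thesis by (simp add: vec_eq_iff)
qed

lemma horiz_bounded_linear: "bounded_linear horiz"
proof -
  have "linear horiz" by (auto simp: linear_iff horiz_def vec_eq_iff)
  then show ?thesis by (simp add: linear_conv_bounded_linear)
qed

lemma susp_\<nu>: "susp x \<bullet> \<nu> = r * sin (x $ z)"
  by (simp add: susp_def inner_add_left \<nu>_\<nu>)

lemma susp_p: "susp x \<bullet> p = cos (x $ z) * (\<phi> (horiz x) \<bullet> p)"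
  by (simp add: susp_def inner_add_left)

lemma susp_sphere: "norm (susp x) = r"
proof -
  have "susp x \<bullet> susp x = r\<^sup>2 * (cos (x $ z))\<^sup>2 + r\<^sup>2 * (sin (x $ z))\<^sup>2"
    by (simp add: susp_def inner_add_left inner_add_right stereo_stereo \<nu>_\<nu> power2_eq_square algebra_simps)
  then show ?thesis using r_pos by (simp add: norm_eq_sqrt_inner distrib_left[symmetric])
qed

text \<open>The vectors \<open>\<phi> u\<close>, \<open>D u h\<close> and \<nu> are mutually
  orthogonal, so only squares survive; the two parts in the latitude direction combine by
  \<open>sin^2 + cos^2 = 1\<close>.\<close>

lemma susp_deriv_susp_deriv:
  "susp_deriv x h \<bullet> susp_deriv x h' = (cos (x $ z) * (2 * r * stereo_weight (horiz x)))\<^sup>2 * (horiz h \<bullet> horiz h')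
    + r\<^sup>2 * (h $ z * h' $ z)"
proof -
  have "susp_deriv x h \<bullet> susp_deriv x h' = (cos (x $ z))\<^sup>2 * (D (horiz x) (horiz h) \<bullet> D (horiz x) (horiz h'))
    + (h $ z * h' $ z) * r\<^sup>2 * (sin (x $ z))\<^sup>2 + (h $ z * h' $ z) * r\<^sup>2 * (cos (x $ z))\<^sup>2"
    by (simp add: susp_deriv_def inner_add_left inner_add_right inner_diff_left inner_diff_right
        stereo_stereo stereo_deriv_stereo \<nu>_\<nu> power2_eq_square algebra_simps)
  then show ?thesis by (simp add: stereo_deriv_stereo_deriv power_mult_distrib sin_squared_eq algebra_simps)
qed

lemma susp_deriv_eq_0:
  assumes "susp_deriv x h = 0" "cos (x $ z) \<noteq> 0" shows "h = 0"
proof -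
  define c where "c = (cos (x $ z) * (2 * r * stereo_weight (horiz x)))\<^sup>2"
  have c: "0 < c" using assms r_pos stereo_weight_pos[of "horiz x"] by (auto simp: c_def)
  have "c * (horiz h \<bullet> horiz h) + r\<^sup>2 * (h $ z * h $ z) = 0"
    using susp_deriv_susp_deriv[of x h h] assms by (simp add: c_def)
  moreover have "0 \<le> c * (horiz h \<bullet> horiz h)" "0 \<le> r\<^sup>2 * (h $ z * h $ z)" using c by auto
  ultimately have "c * (horiz h \<bullet> horiz h) = 0" "r\<^sup>2 * (h $ z * h $ z) = 0" by linarith+
  then have "horiz h = 0" "h $ z = 0" using c r_pos by auto
  then have "h = vec_join e z 0 0" using join_horiz[of h] by simp
  then show ?thesis by (simp add: vec_join_def vec_eq_iff)
qed

lemma has_derivative_susp: "(susp has_derivative susp_deriv x) (at x)"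
proof -
  have h: "((\<lambda>y. \<phi> (horiz y)) has_derivative (\<lambda>h. D (horiz x) (horiz h))) (at x)"
    by (rule has_derivative_compose[OF bounded_linear.has_derivative[OF horiz_bounded_linear has_derivative_ident] has_derivative_stereo])
  have t: "((\<lambda>y. y $ z) has_derivative (\<lambda>h. h $ z)) (at x)"
    by (rule bounded_linear.has_derivative[OF bounded_linear_vec_nth has_derivative_ident])
  have c: "((\<lambda>y. cos (y $ z)) has_derivative (\<lambda>h. h $ z * - sin (x $ z))) (at x)"
    and s: "((\<lambda>y. sin (y $ z)) has_derivative (\<lambda>h. h $ z * cos (x $ z))) (at x)"
    by (rule derivative_eq_intros t refl | simp)+
  show ?thesis
    unfolding susp_def[abs_def] susp_deriv_def[abs_def]
    by (rule derivative_eq_intros h c s refl)+ (auto simp: fun_eq_iff algebra_simps)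
qed

lemma continuous_on_susp_deriv: "continuous_on A (\<lambda>x. susp_deriv x h)"
proof -
  have "continuous_on A (\<lambda>x. D (horiz x) (horiz h))"
    by (rule continuous_on_compose2[OF continuous_on_stereo_deriv[of UNIV]])
       (auto intro: linear_continuous_on horiz_bounded_linear)
  moreover have "continuous_on UNIV \<phi>"
    using has_derivative_stereo by (meson continuous_at_imp_continuous_on has_derivative_continuous)
  then have "continuous_on A (\<lambda>x. \<phi> (horiz x))"
    by (rule continuous_on_compose2) (auto intro: linear_continuous_on horiz_bounded_linear)
  ultimately show ?thesis unfolding susp_deriv_def by (intro continuous_intros)
qed

lemma sphere_susp:
  assumes x: "norm x = r" and t: "latitude r \<nu> x = t" "- (pi / 2) < t" "t < pi / 2"
  obtains y where "norm y = r" "\<nu> \<bullet> y = 0" "x = cos t *\<^sub>R y + (r * sin t) *\<^sub>R \<nu>" "x \<bullet> p = cos t * (y \<bullet> p)"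
proof -
  have ct: "0 < cos t" using t by (intro cos_gt_zero_pi) auto
  have st: "x \<bullet> \<nu> = r * sin t" using sin_latitude[OF x r_pos norm_\<nu>] t by simp
  have xx: "x \<bullet> x = r\<^sup>2" using x by (simp add: dot_square_norm)
  define y where "y = (1 / cos t) *\<^sub>R (x - (r * sin t) *\<^sub>R \<nu>)"
  have "y \<bullet> y = (1 / cos t)\<^sup>2 * (r\<^sup>2 - (r * sin t)\<^sup>2)"
    by (simp add: y_def inner_diff_left inner_diff_right st inner_commute[of \<nu> x] \<nu>_\<nu> xx power2_eq_square algebra_simps)
  also have "\<dots> = (1 / cos t)\<^sup>2 * (r\<^sup>2 * (cos t)\<^sup>2)" by (simp add: cos_squared_eq power_mult_distrib algebra_simps)
  also have "\<dots> = r\<^sup>2" using ct by (simp add: power_divide)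
  finally have "norm y = r" using r_pos by (simp add: norm_eq_sqrt_inner)
  moreover have "\<nu> \<bullet> y = 0" by (simp add: y_def inner_diff_right st inner_commute[of \<nu> x] \<nu>_\<nu>)
  moreover have xy: "x = cos t *\<^sub>R y + (r * sin t) *\<^sub>R \<nu>" using ct by (simp add: y_def)
  moreover have "x \<bullet> p = cos t * (y \<bullet> p)" by (subst xy) (simp add: inner_add_left)
  ultimately show ?thesis using that by blast
qed

text \<open>A point of latitude \<open>t\<close> has inner product
  \<open>cos t * (y \<bullet> p)\<close> with \<open>p\<close>, where \<open>y\<close> is its foot
  on the equator. The inequality therefore says that the foot differs from \<open>p\<close>: the
  chart omits the meridian through \<open>p\<close>.\<close>

lemma susp_image:
  assumes T: "T \<subseteq> {-(pi / 2)<..<pi / 2}"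
  shows "susp ` {x. x $ z \<in> T} =
    {x \<in> sphere 0 r. latitude r \<nu> x \<in> T \<and> x \<bullet> p < r\<^sup>2 * cos (latitude r \<nu> x)}"
proof (intro equalityI subsetI)
  fix y assume "y \<in> susp ` {x. x $ z \<in> T}"
  then obtain x where x: "y = susp x" "x $ z \<in> T" by auto
  then have t: "- (pi / 2) < x $ z" "x $ z < pi / 2" using T by auto
  then have lat: "latitude r \<nu> y = x $ z"
    by (intro latitude_eqI) (auto simp: x susp_\<nu> r_pos)
  have "0 < cos (x $ z)" using t by (intro cos_gt_zero_pi) auto
  moreover have "\<phi> (horiz x) \<bullet> p < r\<^sup>2" using stereo_sphere stereo_neq by (intro inner_p_less) auto
  ultimately show "y \<in> {x \<in> sphere 0 r. latitude r \<nu> x \<in> T \<and> x \<bullet> p < r\<^sup>2 * cos (latitude r \<nu> x)}"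
    using x lat by (auto simp: susp_sphere susp_p mult.commute)
next
  fix x assume "x \<in> {x \<in> sphere 0 r. latitude r \<nu> x \<in> T \<and> x \<bullet> p < r\<^sup>2 * cos (latitude r \<nu> x)}"
  then have x: "norm x = r" "latitude r \<nu> x \<in> T" "x \<bullet> p < r\<^sup>2 * cos (latitude r \<nu> x)" by auto
  define t where "t = latitude r \<nu> x"
  have t: "- (pi / 2) < t" "t < pi / 2" using x T by (auto simp: t_def)
  obtain y where y: "norm y = r" "\<nu> \<bullet> y = 0" "x = cos t *\<^sub>R y + (r * sin t) *\<^sub>R \<nu>" "x \<bullet> p = cos t * (y \<bullet> p)"
    using sphere_susp[OF x(1) t_def[symmetric] t] .
  have "y \<noteq> p" using x(3) y(4) by (auto simp: p_p t_def[symmetric] mult.commute)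
  then have "y \<in> range \<phi>" unfolding stereo_image_UNIV using y by auto
  then obtain u where u: "y = \<phi> u" by auto
  have "x = susp (vec_join e z u t)" using y(3) u by (simp add: susp_def vec_join_nth)
  then show "x \<in> susp ` {x. x $ z \<in> T}" using x by (auto simp: vec_join_nth t_def)
qed

text \<open>The meridian through \<open>- p\<close> is the coordinate line over the origin, since
  \<open>stereo\<close> sends 0 to \<open>- p\<close>. Used with \<open>- p\<close> in place of
  \<open>p\<close>, this captures exactly the meridian missed by the chart belonging to
  \<open>p\<close>.\<close>

lemma susp_image_axis:
  assumes T: "T \<subseteq> {-(pi / 2)<..<pi / 2}" and x: "norm x = r" "latitude r \<nu> x \<in> T" "\<not> x \<bullet> (- p) < r\<^sup>2 * cos (latitude r \<nu> x)"
  shows "x \<in> susp ` {x. x $ z \<in> T \<and> horiz x = 0}"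
proof -
  define t where "t = latitude r \<nu> x"
  have t: "- (pi / 2) < t" "t < pi / 2" using x T by (auto simp: t_def)
  have ct: "0 < cos t" using t by (intro cos_gt_zero_pi) auto
  obtain y where y: "norm y = r" "\<nu> \<bullet> y = 0" "x = cos t *\<^sub>R y + (r * sin t) *\<^sub>R \<nu>" "x \<bullet> p = cos t * (y \<bullet> p)"
    using sphere_susp[OF x(1) t_def[symmetric] t] .
  have "cos t * r\<^sup>2 \<le> cos t * ((- y) \<bullet> p)" using x(3) y(4) by (simp add: t_def[symmetric] not_less mult.commute)
  then have "r\<^sup>2 \<le> (- y) \<bullet> p" by (simp only: mult_le_cancel_left_pos[OF ct])
  then have "- y = p" using inner_p_less[of "- y"] y(1,2) by force
  then have yp: "y = \<phi> 0" using linear_0[OF linear_B] by (auto simp: stereo_def stereo_weight_def)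
  have "x = susp (vec_join e z 0 t)" using y(3) yp by (simp add: susp_def vec_join_nth)
  then show ?thesis using x by (auto simp: vec_join_nth t_def)
qed

lemma open_strip: "open {x. x $ z \<in> {-(pi / 2)<..<pi / 2}}"
proof -
  have "open ((\<lambda>x :: real ^ 'm. x $ z) -` {-(pi / 2)<..<pi / 2})"
    by (intro open_vimage continuous_intros)
  then show ?thesis by (simp add: vimage_def)
qed

text \<open>The inverse reads off the latitude and applies the inverse stereographic chart to the
  foot on the equator. The foot need not be formed: both \<open>adjoint B x\<close> and the
  denominator carry the factor \<open>cos t\<close>, which cancels.\<close>

lemma local_parametrization_susp:
  "local_parametrization (sphere 0 r) {x. x $ z \<in> {-(pi / 2)<..<pi / 2}} susp (\<lambda>x. matrix (susp_deriv x))"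
proof (rule local_parametrizationI[OF open_strip, where \<psi>="\<lambda>x. vec_join e z
    ((r / (r\<^sup>2 * cos (latitude r \<nu> x) - x \<bullet> p)) *\<^sub>R adjoint B x) (latitude r \<nu> x)"])
  let ?U = "{x. x $ z \<in> {-(pi / 2)<..<pi / 2}}"
  have im: "susp ` ?U = sphere 0 r \<inter> {x. latitude r \<nu> x \<in> {-(pi / 2)<..<pi / 2} \<and> x \<bullet> p < r\<^sup>2 * cos (latitude r \<nu> x)}"
    by (subst susp_image) auto
  have "open {x. latitude r \<nu> x \<in> {-(pi / 2)<..<pi / 2} \<and> x \<bullet> p < r\<^sup>2 * cos (latitude r \<nu> x)}"
    unfolding greaterThanLessThan_iff
    by (intro open_Collect_conj open_Collect_less continuous_intros continuous_latitude)
  then show "openin (top_of_set (sphere 0 r)) (susp ` ?U)"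
    unfolding im by (rule openin_open_Int)
  show "continuous_on (susp ` ?U) (\<lambda>x. vec_join e z
    ((r / (r\<^sup>2 * cos (latitude r \<nu> x) - x \<bullet> p)) *\<^sub>R adjoint B x) (latitude r \<nu> x))"
  proof -
    have "continuous_on (susp ` ?U) (\<lambda>x. (r / (r\<^sup>2 * cos (latitude r \<nu> x) - x \<bullet> p)) *\<^sub>R adjoint B x)"
      unfolding im by (intro continuous_intros continuous_latitude continuous_on_adjoint_B) force
    then show ?thesis by (rule continuous_on_vec_join[OF _ continuous_latitude])
  qed
  fix x assume x: "x \<in> ?U"
  then have lat: "latitude r \<nu> (susp x) = x $ z"
    by (intro latitude_eqI) (auto simp: susp_\<nu> r_pos)
  have ct: "0 < cos (x $ z)" using x by (intro cos_gt_zero_pi) auto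
  have adj: "adjoint B \<nu> = 0"
  proof -
    have "v \<bullet> adjoint B \<nu> = v \<bullet> 0" for v by (simp add: adjoint_works[OF linear_B])
    then show ?thesis by (metis vector_eq_ldot)
  qed
  have a: "adjoint B (susp x) = (cos (x $ z) * (2 * r * stereo_weight (horiz x))) *\<^sub>R horiz x"
    by (simp add: susp_def linear_add[OF linear_adjoint_B] linear_scale[OF linear_adjoint_B] adj adjoint_B_stereo)
  have b: "r\<^sup>2 * cos (x $ z) - susp x \<bullet> p = cos (x $ z) * (2 * r\<^sup>2 * stereo_weight (horiz x))"
    by (simp add: susp_p stereo_p algebra_simps)
  have "(r / (r\<^sup>2 * cos (x $ z) - susp x \<bullet> p)) *\<^sub>R adjoint B (susp x) = horiz x"
    unfolding a b using ct r_pos stereo_weight_pos[of "horiz x"] by (simp add: power2_eq_square)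
  then show "vec_join e z ((r / (r\<^sup>2 * cos (latitude r \<nu> (susp x)) - susp x \<bullet> p)) *\<^sub>R adjoint B (susp x))
    (latitude r \<nu> (susp x)) = x"
    by (simp add: lat join_horiz)
  show "(susp has_derivative susp_deriv x) (at x)" by (rule has_derivative_susp)
  show "h = 0" if "susp_deriv x h = 0" for h using susp_deriv_eq_0[OF that] ct by simp
qed (rule continuous_on_susp_deriv)

text \<open>The Gram matrix is diagonal, with \<open>r^2\<close> at the index \<open>z\<close> and
  the squared conformal factor of the equator times \<open>cos^2 t\<close> at each of the other
  indices.\<close>

lemma det_gram_susp:
  assumes "0 \<le> cos (x $ z)"
  shows "sqrt (det (transpose (matrix (susp_deriv x)) ** matrix (susp_deriv x))) =
    r * cos (x $ z) ^ CARD('l) * (2 * r * stereo_weight (horiz x)) ^ CARD('l)"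
proof -
  have lin: "linear (susp_deriv x)" using has_derivative_susp by (rule has_derivative_linear)
  define c where "c = cos (x $ z) * (2 * r * stereo_weight (horiz x))"
  have c: "0 \<le> c" using assms r_pos stereo_weight_pos[of "horiz x"] by (simp add: c_def)
  let ?G = "transpose (matrix (susp_deriv x)) ** matrix (susp_deriv x)"
  have g: "?G $ i $ j = c\<^sup>2 * (horiz (axis i 1) \<bullet> horiz (axis j 1)) + r\<^sup>2 * (axis i 1 $ z * axis j 1 $ z)" for i j
    by (simp add: gram_entry lin susp_deriv_susp_deriv c_def)
  have hz: "horiz (axis z 1) = 0" by (simp add: horiz_def vec_eq_iff axis_def e_neq)
  have he: "horiz (axis (e j) 1) = axis j 1" for j
    using inj_e by (auto simp: horiz_def vec_eq_iff axis_def inj_eq)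
  have z: "axis z 1 $ z = (1::real)" "axis (e j) 1 $ z = (0::real)" for j
    by (simp_all add: axis_def e_neq[symmetric])
  have off: "?G $ i $ j = 0" if "i \<noteq> j" for i j
    using that by (rule_tac index_cases[of i]; rule_tac index_cases[of j])
      (auto simp: g hz he inner_axis_axis z e_neq)
  have "det ?G = (\<Prod>i\<in>UNIV. ?G $ i $ i)" by (rule det_diagonal[OF off])
  also have "\<dots> = r\<^sup>2 * (\<Prod>j\<in>(UNIV::'l set). c\<^sup>2)"
    by (subst prod_split) (auto simp: g hz he inner_axis_axis z e_neq)
  also have "\<dots> = (r * c ^ CARD('l))\<^sup>2" by (simp add: power_mult_distrib power_mult[symmetric] mult.commute)
  finally have "sqrt (det ?G) = r * c ^ CARD('l)" using c r_pos by simp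
  then show ?thesis by (simp add: c_def power_mult_distrib ac_simps)
qed

lemma horiz_measurable [measurable]: "horiz \<in> borel_measurable borel"
  by (rule borel_measurable_continuous_onI[OF linear_continuous_on[OF horiz_bounded_linear]])

lemma strip_measurable: "T \<in> sets borel \<Longrightarrow> Q \<in> sets borel \<Longrightarrow> {x. x $ z \<in> T \<and> horiz x \<in> Q} \<in> sets borel"
proof -
  assume [measurable]: "T \<in> sets borel" "Q \<in> sets borel"
  have [measurable]: "(\<lambda>x. x $ z) \<in> borel_measurable (borel :: (real ^ 'm) measure)"
    by (intro borel_measurable_continuous_onI continuous_intros)
  show ?thesis by measurable
qed

lemma emeasure_susp_image:
  assumes \<mu>: "riemannian_volume TYPE('m) (sphere 0 r) \<mu>"
    and T: "T \<in> sets borel" "T \<subseteq> {-(pi / 2)<..<pi / 2}" and Q: "Q \<in> sets borel"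
  shows "emeasure \<mu> (susp ` {x. x $ z \<in> T \<and> horiz x \<in> Q}) =
    (\<integral>\<^sup>+t\<in>T. ennreal (r * cos t ^ CARD('l)) \<partial>lborel) *
    (\<integral>\<^sup>+u\<in>Q. ennreal ((2 * r * stereo_weight u) ^ CARD('l)) \<partial>lborel)"
proof -
  note [measurable] = T(1) Q
  have [measurable]: "(stereo_weight :: real ^ 'l \<Rightarrow> real) \<in> borel_measurable borel"
    by (rule borel_measurable_continuous_onI[OF continuous_on_stereo_weight])
  let ?V = "{x. x $ z \<in> T \<and> horiz x \<in> Q}"
  have "emeasure \<mu> (susp ` ?V) = (\<integral>\<^sup>+x\<in>?V. ennreal (sqrt (det (transpose (matrix (susp_deriv x)) ** matrix (susp_deriv x)))) \<partial>lborel)"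
    using \<mu> local_parametrization_susp strip_measurable[OF T(1) Q] T(2) unfolding riemannian_volume_def by blast
  also have "\<dots> = (\<integral>\<^sup>+x. (ennreal (r * cos (x $ z) ^ CARD('l)) * indicator T (x $ z)) *
      (ennreal ((2 * r * stereo_weight (\<chi> j. x $ e j)) ^ CARD('l)) * indicator Q (\<chi> j. x $ e j)) \<partial>lborel)"
  proof (intro nn_integral_cong)
    fix x :: "real ^ 'm"
    have "0 \<le> cos (x $ z)" if "x \<in> ?V" using that T(2) by (intro cos_ge_zero) auto
    then show "ennreal (sqrt (det (transpose (matrix (susp_deriv x)) ** matrix (susp_deriv x)))) * indicator ?V x =
      (ennreal (r * cos (x $ z) ^ CARD('l)) * indicator T (x $ z)) *
      (ennreal ((2 * r * stereo_weight (\<chi> j. x $ e j)) ^ CARD('l)) * indicator Q (\<chi> j. x $ e j))"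
      using r_pos stereo_weight_pos[of "horiz x"]
      by (auto simp: indicator_def det_gram_susp ennreal_mult' horiz_def)
  qed
  also have "\<dots> = (\<integral>\<^sup>+t\<in>T. ennreal (r * cos t ^ CARD('l)) \<partial>lborel) *
    (\<integral>\<^sup>+u\<in>Q. ennreal ((2 * r * stereo_weight u) ^ CARD('l)) \<partial>lborel)"
    by (rule nn_integral_lborel_split) auto
  finally show ?thesis .
qed

end

section \<open>Null points and total volume of great spheres\<close>

lemma riemannian_volume_sets:
  assumes "riemannian_volume TYPE('m::finite) M \<mu>" "closed M"
  shows "A \<in> sets \<mu> \<longleftrightarrow> A \<subseteq> M \<and> A \<in> sets borel" "space \<mu> = M"
proof -
  have s: "sets \<mu> = sets (restrict_space borel M)" using assms by (simp add: riemannian_volume_def)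
  show "A \<in> sets \<mu> \<longleftrightarrow> A \<subseteq> M \<and> A \<in> sets borel"
    unfolding s using assms(2) by (subst sets_restrict_space_iff) auto
  show "space \<mu> = M" using sets_eq_imp_space_eq[OF s] by (simp add: space_restrict_space)
qed

lemma closed_great_sphere:
  fixes K :: "(real ^ 'n) set"
  shows "subspace K \<Longrightarrow> closed (sphere 0 r \<inter> K)"
  by (intro closed_Int closed_sphere closed_subspace)

text \<open>Projecting from the antipode \<open>- x\<close> makes \<open>x\<close> the image of the
  origin, a Lebesgue null set.\<close>

lemma great_sphere_emeasure_singleton:
  fixes K :: "(real ^ 'n) set"
  assumes K: "subspace K" "dim K = CARD('m::finite) + 1" and r: "0 < r"
    and \<mu>: "riemannian_volume TYPE('m) (sphere 0 r \<inter> K) \<mu>" and x: "x \<in> sphere 0 r \<inter> K"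
  shows "emeasure \<mu> {x} = 0"
proof -
  obtain B :: "real ^ 'm \<Rightarrow> real ^ 'n" where "stereographic r K (- x) B"
    using ex_stereographic[OF K, of "- x" r] x r K by (auto simp: subspace_neg)
  then interpret stereographic r K "- x" B .
  have "{x} = \<phi> ` {0}" using linear_0[OF linear_B] by (simp add: stereo_def stereo_weight_def)
  then have "emeasure \<mu> {x} = (\<integral>\<^sup>+u\<in>{0::real ^ 'm}. ennreal ((2 * r * stereo_weight u) ^ CARD('m)) \<partial>lborel)"
    using emeasure_stereo_image[OF \<mu>, of "{0}"] by simp
  also have "\<dots> = 0" by (rule nn_integral_null_set) auto
  finally show ?thesis .
qed

lemma ex_great_sphere_point:
  fixes K :: "(real ^ 'n) set"
  assumes "subspace K" "dim K \<ge> 1" "0 < r" obtains p where "p \<in> K" "norm p = r"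
proof -
  have "\<not> K \<subseteq> {0}" using assms(2) by (metis dim_eq_0 not_one_le_zero)
  then obtain v where v: "v \<in> K" "v \<noteq> 0" by blast
  show ?thesis
    using v assms by (intro that[of "(r / norm v) *\<^sub>R v"]) (auto intro: subspace_scale)
qed

text \<open>The density of a stereographic chart is strictly positive, so already the chart image
  has positive volume. Together with finiteness this lets the volume of \<open>L\<close> be
  cancelled from the counting identity.\<close>

lemma great_sphere_emeasure_pos:
  fixes K :: "(real ^ 'n) set"
  assumes K: "subspace K" "dim K = CARD('m::finite) + 1" and r: "0 < r"
    and \<mu>: "riemannian_volume TYPE('m) (sphere 0 r \<inter> K) \<mu>"
  shows "emeasure \<mu> (sphere 0 r \<inter> K) \<noteq> 0"
proof -
  obtain p where p: "p \<in> K" "norm p = r" using ex_great_sphere_point[OF K(1) _ r] K by auto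
  obtain B :: "real ^ 'm \<Rightarrow> real ^ 'n" where "stereographic r K p B"
    using ex_stereographic[OF K p r] by auto
  then interpret stereographic r K p B .
  have [measurable]: "(stereo_weight :: real ^ 'm \<Rightarrow> real) \<in> borel_measurable borel"
    by (rule borel_measurable_continuous_onI[OF continuous_on_stereo_weight])
  have pos: "\<not> (2 * r * stereo_weight u) ^ CARD('m) \<le> 0" for u :: "real ^ 'm"
    using r stereo_weight_pos[of u] by (simp add: not_le)
  have "emeasure \<mu> (\<phi> ` UNIV) \<noteq> 0"
  proof
    assume "emeasure \<mu> (\<phi> ` UNIV) = 0"
    then have "(\<integral>\<^sup>+u. ennreal ((2 * r * stereo_weight u) ^ CARD('m)) \<partial>(lborel :: (real ^ 'm) measure)) = 0"
      using emeasure_stereo_image[OF \<mu>, of UNIV] by simp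
    then have "AE u in (lborel :: (real ^ 'm) measure). False"
      by (subst (asm) nn_integral_0_iff_AE)
         (auto simp: ennreal_eq_0_iff pos)
    then show False by (simp add: AE_iff_null null_sets_def)
  qed
  moreover have "emeasure \<mu> (\<phi> ` UNIV) \<le> emeasure \<mu> (sphere 0 r \<inter> K)"
    using stereo_sphere closed_great_sphere[OF K(1)] riemannian_volume_sets(1)[OF \<mu>]
    by (intro emeasure_mono) auto
  ultimately show ?thesis by auto
qed

text \<open>Two opposite closed hemispheres cover the sphere. Each lies in the image of the closed
  unit ball under the projection from the opposite pole, where the density is at most
  \<open>(2 * r) ^ CARD('m)\<close>.\<close>

lemma great_sphere_emeasure_finite:
  fixes K :: "(real ^ 'n) set"
  assumes K: "subspace K" "dim K = CARD('m::finite) + 1" and r: "0 < r"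
    and \<mu>: "riemannian_volume TYPE('m) (sphere 0 r \<inter> K) \<mu>"
  shows "emeasure \<mu> (sphere 0 r \<inter> K) < \<infinity>"
proof -
  note cl = closed_great_sphere[OF K(1), of r]
  have half: "\<exists>H \<in> sets \<mu>. emeasure \<mu> H < \<infinity> \<and> {x \<in> sphere 0 r \<inter> K. x \<bullet> p \<le> 0} \<subseteq> H" if p: "p \<in> K" "norm p = r" for p
  proof -
    obtain B :: "real ^ 'm \<Rightarrow> real ^ 'n" where "stereographic r K p B"
      using ex_stereographic[OF K p r] by auto
    then interpret stereographic r K p B .
    have "continuous_on (cball 0 1) \<phi>"
      using has_derivative_stereo by (meson continuous_at_imp_continuous_on has_derivative_continuous)
    then have "compact (\<phi> ` cball 0 1)" by (intro compact_continuous_image) auto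
    then have "\<phi> ` cball 0 1 \<in> sets \<mu>"
      unfolding riemannian_volume_sets(1)[OF \<mu> cl] using stereo_sphere
      by (auto intro: borel_compact simp del: mem_sphere)
    moreover have "emeasure \<mu> (\<phi> ` cball 0 1) < \<infinity>"
    proof -
      have "emeasure \<mu> (\<phi> ` cball 0 1) = (\<integral>\<^sup>+u\<in>cball (0 :: real ^ 'm) 1. ennreal ((2 * r * stereo_weight u) ^ CARD('m)) \<partial>lborel)"
        by (rule emeasure_stereo_image[OF \<mu>]) simp
      also have "\<dots> \<le> (\<integral>\<^sup>+u\<in>cball 0 1. ennreal ((2 * r) ^ CARD('m)) \<partial>(lborel :: (real ^ 'm) measure))"
      proof (intro nn_integral_mono mult_right_mono ennreal_leI power_mono)
        fix u :: "real ^ 'm"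
        have "0 \<le> stereo_weight u * (u \<bullet> u)" using stereo_weight_pos[of u] by simp
        then have "stereo_weight u \<le> 1" using stereo_weight_inner[of u] by linarith
        then show "2 * r * stereo_weight u \<le> 2 * r" using r by (simp add: mult_left_le)
        show "0 \<le> 2 * r * stereo_weight u" using r stereo_weight_pos[of u] by simp
      qed auto
      also have "\<dots> < \<infinity>"
        using emeasure_lborel_cball_finite[of "0 :: real ^ 'm" 1]
        by (simp add: nn_integral_cmult_indicator ennreal_mult_less_top)
      finally show ?thesis .
    qed
    moreover have "{x \<in> sphere 0 r \<inter> K. x \<bullet> p \<le> 0} \<subseteq> \<phi> ` cball 0 1"
    proof
      fix x assume "x \<in> {x \<in> sphere 0 r \<inter> K. x \<bullet> p \<le> 0}"
      then have x: "x \<in> sphere 0 r \<inter> K" "x \<bullet> p \<le> 0" by auto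
      have "x \<noteq> p" using x(2) p_p r by auto
      note u = stereo_surj[OF x(1) this]
      have "(r\<^sup>2 + x \<bullet> p) / (r\<^sup>2 - x \<bullet> p) \<le> 1"
        using x(2) r by (subst divide_le_eq_1_pos) (auto intro: add_pos_nonneg simp: less_le_trans[of "x \<bullet> p" 0, OF _ zero_le_power2] order.strict_trans1[of "x \<bullet> p" 0])
      then have "(r / (r\<^sup>2 - x \<bullet> p)) *\<^sub>R adjoint B x \<in> cball 0 1"
        using u(2) by (simp only: mem_cball_0 norm_eq_sqrt_inner real_sqrt_le_1_iff)
      then show "x \<in> \<phi> ` cball 0 1" using u(1)[symmetric] by (rule rev_image_eqI)
    qed
    ultimately show ?thesis by blast
  qed
  obtain p where p: "p \<in> K" "norm p = r" using ex_great_sphere_point[OF K(1) _ r] K by auto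
  obtain H where H: "H \<in> sets \<mu>" "emeasure \<mu> H < \<infinity>" "{x \<in> sphere 0 r \<inter> K. x \<bullet> p \<le> 0} \<subseteq> H"
    using half[OF p] by auto
  obtain H' where H': "H' \<in> sets \<mu>" "emeasure \<mu> H' < \<infinity>" "{x \<in> sphere 0 r \<inter> K. x \<bullet> (- p) \<le> 0} \<subseteq> H'"
    using half[of "- p"] p K by (auto simp: subspace_neg)
  have "sphere 0 r \<inter> K \<subseteq> H \<union> H'"
  proof
    fix x assume "x \<in> sphere 0 r \<inter> K"
    then show "x \<in> H \<union> H'" using H(3) H'(3) by (cases "x \<bullet> p \<le> 0") auto
  qed
  then have "emeasure \<mu> (sphere 0 r \<inter> K) \<le> emeasure \<mu> (H \<union> H')"
    using H H' by (intro emeasure_mono) auto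
  also have "\<dots> \<le> emeasure \<mu> H + emeasure \<mu> H'" using H H' by (intro emeasure_subadditive) auto
  also have "\<dots> < \<infinity>" using H H' by simp
  finally show ?thesis .
qed

section \<open>Distribution of the latitude under the volume measure\<close>

lemma dim_hyperplane_cart:
  fixes \<nu> :: "real ^ 'n" assumes "norm \<nu> = 1"
  shows "dim {x. \<nu> \<bullet> x = 0} + 1 = CARD('n)"
proof -
  have "\<nu> \<noteq> 0" using assms by auto
  then show ?thesis using dim_hyperplane[of \<nu>] by simp
qed

lemma ex_coordinate_split:
  assumes "CARD('m::finite) = CARD('l::finite) + 1"
  obtains e :: "'l::finite \<Rightarrow> 'm::finite" and z where "coordinate_split e z"
proof -
  fix z :: 'm
  have "card (UNIV :: 'l set) = card (UNIV - {z})" using assms by (simp add: card_Diff_singleton)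
  then obtain e where "bij_betw e (UNIV :: 'l set) (UNIV - {z})"
    using finite_same_card_bij[of "UNIV :: 'l set" "UNIV - {z}"] by auto
  then have "coordinate_split e z" by (auto simp: coordinate_split_def bij_betw_def)
  then show ?thesis by (rule that)
qed

text \<open>\<open>A\<close> is the part inside the chart with centre \<open>p\<close>, where the
  volume is a product; \<open>M\<close> is the meridian which that chart omits. In the chart with
  centre \<open>- p\<close> the set \<open>M\<close> is the image of a coordinate line segment over
  the origin, hence null. On the equator the single point \<open>p\<close> is lost, which is null as
  well.\<close>

lemma emeasure_latitude:
  fixes \<nu> :: "real ^ 'n"
  assumes \<nu>: "norm \<nu> = 1" and r: "0 < r" and n: "CARD('n) = CARD('m::finite) + 1" and m: "CARD('m) = CARD('l::finite) + 1"
    and \<mu>: "riemannian_volume TYPE('m) (sphere 0 r) \<mu>"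
    and \<mu>L: "riemannian_volume TYPE('l) (sphere 0 r \<inter> {x. \<nu> \<bullet> x = 0}) \<mu>L"
    and T: "T \<in> sets borel" "T \<subseteq> {-(pi / 2)<..<pi / 2}"
  shows "emeasure \<mu> {x \<in> sphere 0 r. latitude r \<nu> x \<in> T} =
    (\<integral>\<^sup>+t\<in>T. ennreal (r * cos t ^ CARD('l)) \<partial>lborel) * emeasure \<mu>L (sphere 0 r \<inter> {x. \<nu> \<bullet> x = 0})"
proof -
  define K where "K = {x. \<nu> \<bullet> x = 0}"
  have K: "subspace K" "dim K = CARD('l) + 1"
    using dim_hyperplane_cart[OF \<nu>] n m by (auto simp: K_def subspace_hyperplane)
  obtain p where p: "p \<in> K" "norm p = r" using ex_great_sphere_point[OF K(1) _ r] K by auto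
  obtain B :: "real ^ 'l \<Rightarrow> real ^ 'n" where B: "stereographic r K p B"
    using ex_stereographic[OF K p r] by auto
  have B': "stereographic r K (- p) B"
    using B unfolding stereographic_def by (auto simp: subspace_neg)
  obtain e :: "'l \<Rightarrow> 'm" and z where e: "coordinate_split e z" using ex_coordinate_split[OF m] by blast
  interpret s: suspension e z r p B \<nu>
    using B e \<nu> by (auto simp: suspension_def suspension_axioms_def K_def)
  interpret s': suspension e z r "- p" B \<nu>
    using B' e \<nu> by (auto simp: suspension_def suspension_axioms_def K_def)
  note \<mu>_sets = riemannian_volume_sets(1)[OF \<mu> closed_sphere]
  define A where "A = {x \<in> sphere 0 r. latitude r \<nu> x \<in> T \<and> x \<bullet> p < r\<^sup>2 * cos (latitude r \<nu> x)}"
  define M where "M = {x \<in> sphere 0 r. latitude r \<nu> x \<in> T \<and> \<not> x \<bullet> p < r\<^sup>2 * cos (latitude r \<nu> x)}"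
  note [measurable] = T(1)
  have [measurable]: "(\<lambda>x. x \<bullet> p) \<in> borel_measurable (borel :: (real ^ 'n) measure)" by simp
  have [measurable]: "sphere 0 r \<in> sets (borel :: (real ^ 'n) measure)" by (simp add: borel_closed)
  have "A \<in> sets borel" "M \<in> sets borel" unfolding A_def M_def by measurable
  then have sets: "A \<in> sets \<mu>" "M \<in> sets \<mu>" unfolding \<mu>_sets by (auto simp: A_def M_def)
  have M0: "emeasure \<mu> M = 0"
  proof -
    let ?V = "{x. x $ z \<in> T \<and> s'.horiz x \<in> {0}}"
    have im: "s'.susp ` ?V = M"
    proof (intro equalityI subsetI)
      fix x assume "x \<in> M"
      then show "x \<in> s'.susp ` ?V"
        using s'.susp_image_axis[OF T(2), of x] by (auto simp: M_def)
    next
      fix y assume "y \<in> s'.susp ` ?V"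
      then obtain x where x: "y = s'.susp x" "x $ z \<in> T" "s'.horiz x = 0" by auto
      have "y \<in> s'.susp ` {x. x $ z \<in> T}" using x by auto
      then have "norm y = r" "latitude r \<nu> y \<in> T" unfolding s'.susp_image[OF T(2)] by auto
      moreover have "latitude r \<nu> y = x $ z"
        using x T(2) by (intro latitude_eqI) (auto simp: s'.susp_\<nu> r)
      moreover have "y \<bullet> p = cos (x $ z) * r\<^sup>2"
        using s'.susp_p[of x] x s'.stereo_p[of 0] by (simp add: stereo_weight_def)
      ultimately show "y \<in> M" by (simp add: M_def mult.commute)
    qed
    have "emeasure \<mu> M = (\<integral>\<^sup>+t\<in>T. ennreal (r * cos t ^ CARD('l)) \<partial>lborel) *
       (\<integral>\<^sup>+u\<in>{0 :: real ^ 'l}. ennreal ((2 * r * stereo_weight u) ^ CARD('l)) \<partial>lborel)"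
      using s'.emeasure_susp_image[OF \<mu> T, of "{0}"] im by simp
    also have "(\<integral>\<^sup>+u\<in>{0 :: real ^ 'l}. ennreal ((2 * r * stereo_weight u) ^ CARD('l)) \<partial>lborel) = 0"
      by (rule nn_integral_null_set) auto
    finally show ?thesis by simp
  qed
  have A: "emeasure \<mu> A = (\<integral>\<^sup>+t\<in>T. ennreal (r * cos t ^ CARD('l)) \<partial>lborel) * emeasure \<mu>L (sphere 0 r \<inter> K)"
  proof -
    have "A = s.susp ` {x. x $ z \<in> T \<and> s.horiz x \<in> UNIV}" using s.susp_image[OF T(2)] by (simp add: A_def)
    then have "emeasure \<mu> A = (\<integral>\<^sup>+t\<in>T. ennreal (r * cos t ^ CARD('l)) \<partial>lborel) *
       (\<integral>\<^sup>+u\<in>UNIV. ennreal ((2 * r * stereo_weight u) ^ CARD('l)) \<partial>(lborel :: (real ^ 'l) measure))"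
      using s.emeasure_susp_image[OF \<mu> T, of UNIV] by simp
    also have "(\<integral>\<^sup>+u\<in>UNIV. ennreal ((2 * r * stereo_weight u) ^ CARD('l)) \<partial>(lborel :: (real ^ 'l) measure)) =
        emeasure \<mu>L (sphere 0 r \<inter> K - {p})"
      using s.emeasure_stereo_image[OF \<mu>L, of UNIV] s.stereo_image_UNIV by (simp add: K_def)
    also have "\<dots> = emeasure \<mu>L (sphere 0 r \<inter> K)"
    proof (rule emeasure_Diff_null_set)
      note Ls = riemannian_volume_sets(1)[OF \<mu>L[folded K_def] closed_great_sphere[OF K(1)]]
      have "p \<in> sphere 0 r \<inter> K" using p by simp
      from great_sphere_emeasure_singleton[OF K r \<mu>L[folded K_def] this] this
      show "{p} \<in> null_sets \<mu>L" by (auto simp: null_sets_def Ls)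
      show "sphere 0 r \<inter> K \<in> sets \<mu>L"
        unfolding Ls using closed_great_sphere[OF K(1)] by (auto intro: borel_closed)
    qed
    finally show ?thesis .
  qed
  have "{x \<in> sphere 0 r. latitude r \<nu> x \<in> T} = A \<union> M" "A \<inter> M = {}" by (auto simp: A_def M_def)
  then have "emeasure \<mu> {x \<in> sphere 0 r. latitude r \<nu> x \<in> T} = emeasure \<mu> A + emeasure \<mu> M"
    using sets by (simp add: plus_emeasure)
  then show ?thesis using M0 A by (simp add: K_def)
qed

lemma latitude_pole:
  assumes x: "norm x = r" and r: "0 < r" and \<nu>: "norm \<nu> = 1"
    and lat: "latitude r \<nu> x = pi / 2 \<or> latitude r \<nu> x = - (pi / 2)"
  shows "x = r *\<^sub>R \<nu> \<or> x = - (r *\<^sub>R \<nu>)"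
proof -
  have xx: "x \<bullet> x = r\<^sup>2" "\<nu> \<bullet> \<nu> = 1" using x \<nu> by (auto simp: dot_square_norm)
  have "x \<bullet> \<nu> = r \<or> x \<bullet> \<nu> = - r" using sin_latitude[OF x r \<nu>] lat
    by (metis sin_pi_half sin_minus mult.right_neutral mult_minus_right)
  then show ?thesis
  proof
    assume "x \<bullet> \<nu> = r"
    then have "(x - r *\<^sub>R \<nu>) \<bullet> (x - r *\<^sub>R \<nu>) = 0"
      by (simp add: inner_diff_left inner_diff_right xx inner_commute[of \<nu> x] power2_eq_square)
    then show ?thesis by simp
  next
    assume "x \<bullet> \<nu> = - r"
    then have "(x + r *\<^sub>R \<nu>) \<bullet> (x + r *\<^sub>R \<nu>) = 0"
      by (simp add: inner_add_left inner_add_right xx inner_commute[of \<nu> x] power2_eq_square)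
    then have "x + r *\<^sub>R \<nu> = 0" by simp
    then show ?thesis by (simp add: eq_neg_iff_add_eq_0)
  qed
qed

text \<open>The image of the volume under \<open>latitude\<close> has the density found in
  \<open>emeasure_latitude\<close>. That lemma covers the open interval; its endpoints are attained
  only at the two poles, which are null.\<close>

lemma nn_integral_latitude:
  fixes \<nu> :: "real ^ 'n"
  assumes \<nu>: "norm \<nu> = 1" and r: "0 < r" and n: "CARD('n) = CARD('m::finite) + 1" and m: "CARD('m) = CARD('l::finite) + 1"
    and \<mu>: "riemannian_volume TYPE('m) (sphere 0 r) \<mu>"
    and \<mu>L: "riemannian_volume TYPE('l) (sphere 0 r \<inter> {x. \<nu> \<bullet> x = 0}) \<mu>L"
    and f: "f \<in> borel_measurable borel"
  shows "(\<integral>\<^sup>+x. f (latitude r \<nu> x) \<partial>\<mu>) = emeasure \<mu>L (sphere 0 r \<inter> {x. \<nu> \<bullet> x = 0}) *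
    (\<integral>\<^sup>+t. f t * ennreal (r * cos t ^ CARD('l)) * indicator {-(pi / 2)<..<pi / 2} t \<partial>lborel)"
proof -
  define c where "c = emeasure \<mu>L (sphere 0 r \<inter> {x. \<nu> \<bullet> x = 0})"
  define I where "I = {-(pi / 2)<..<pi / 2}"
  have [measurable]: "I \<in> sets borel" by (simp add: I_def)
  note \<mu>_sets = riemannian_volume_sets[OF \<mu> closed_sphere]
  have sets_\<mu>: "sets \<mu> = sets (restrict_space borel (sphere 0 r))" using \<mu> by (simp add: riemannian_volume_def)
  have lat [measurable]: "latitude r \<nu> \<in> borel_measurable \<mu>"
    unfolding measurable_cong_sets[OF sets_\<mu> refl] by (rule measurable_restrict_space1) measurable
  define h where "h t = ennreal (r * cos t ^ CARD('l)) * indicator I t" for t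
  have [measurable]: "h \<in> borel_measurable borel" unfolding h_def by measurable
  have "distr \<mu> borel (latitude r \<nu>) = density lborel (\<lambda>t. c * h t)"
  proof (rule measure_eqI)
    fix A assume "A \<in> sets (distr \<mu> borel (latitude r \<nu>))"
    then have [measurable]: "A \<in> sets borel" by simp
    have pole: "emeasure \<mu> {x} = 0" if "norm x = r" for x
      using great_sphere_emeasure_singleton[of "UNIV :: (real ^ 'n) set" r \<mu> x, where 'm='m] that \<mu> r n by auto
    have "emeasure (distr \<mu> borel (latitude r \<nu>)) A = emeasure \<mu> {x \<in> space \<mu>. latitude r \<nu> x \<in> A}"
      by (subst emeasure_distr) (auto simp: vimage_def Int_def conj_commute)
    also have "\<dots> = emeasure \<mu> {x \<in> space \<mu>. latitude r \<nu> x \<in> A \<inter> I}"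
    proof (rule emeasure_eq_AE)
      have "AE x in \<mu>. x \<noteq> y" if "norm y = r" for y
        using AE_not_in[of "{y}" \<mu>] pole[OF that] that by (simp add: null_sets_def \<mu>_sets(1))
      then have "AE x in \<mu>. x \<noteq> r *\<^sub>R \<nu>" "AE x in \<mu>. x \<noteq> - (r *\<^sub>R \<nu>)"
        using \<nu> r by simp_all
      with AE_space show "AE x in \<mu>. x \<in> {x \<in> space \<mu>. latitude r \<nu> x \<in> A} \<longleftrightarrow> x \<in> {x \<in> space \<mu>. latitude r \<nu> x \<in> A \<inter> I}"
      proof eventually_elim
        case (elim x)
        then have "latitude r \<nu> x \<noteq> pi / 2" "latitude r \<nu> x \<noteq> - (pi / 2)"
          using latitude_pole[OF _ r \<nu>, of x] by (auto simp: \<mu>_sets(2))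
        then have "latitude r \<nu> x \<in> I"
          using latitude_bounds[of r \<nu> x] unfolding I_def by simp
        then show ?case by simp
      qed
    qed auto
    also have "\<dots> = (\<integral>\<^sup>+t\<in>A \<inter> I. ennreal (r * cos t ^ CARD('l)) \<partial>lborel) * c"
      unfolding c_def \<mu>_sets(2) by (rule emeasure_latitude[OF \<nu> r n m \<mu> \<mu>L]) (auto simp: I_def)
    also have "\<dots> = (\<integral>\<^sup>+t. c * (h t * indicator A t) \<partial>lborel)"
      by (subst nn_integral_cmult)
         (auto simp: h_def mult.commute[of _ c] indicator_def intro!: arg_cong[where f="(*) c"] nn_integral_cong)
    also have "\<dots> = emeasure (density lborel (\<lambda>t. c * h t)) A"
      by (subst emeasure_density) (auto simp: mult.assoc)
    finally show "emeasure (distr \<mu> borel (latitude r \<nu>)) A = emeasure (density lborel (\<lambda>t. c * h t)) A" .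
  qed simp
  then have "(\<integral>\<^sup>+t. f t \<partial>distr \<mu> borel (latitude r \<nu>)) = (\<integral>\<^sup>+t. f t \<partial>density lborel (\<lambda>t. c * h t))" by simp
  then have "(\<integral>\<^sup>+x. f (latitude r \<nu> x) \<partial>\<mu>) = (\<integral>\<^sup>+t. c * h t * f t \<partial>lborel)"
    using f by (simp add: nn_integral_distr nn_integral_density)
  also have "\<dots> = c * (\<integral>\<^sup>+t. h t * f t \<partial>lborel)"
    using f by (subst nn_integral_cmult[symmetric]) (auto simp: mult.assoc)
  finally show ?thesis unfolding c_def h_def I_def by (simp only: ac_simps)
qed

section \<open>Campbell's formula for marked point processes\<close>

lemma points_in_image_mset:
  fixes n :: nat
  shows
  "of_nat (points_in A (image_mset g (mset_set {..<n}))) = (\<Sum>i<n. indicator A (g i) :: ennreal)"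
  by (induction n) (auto simp: points_in_def lessThan_Suc indicator_def add.commute)

lemma measurable_sum_lessThan:
  fixes f :: "nat \<Rightarrow> 'w \<Rightarrow> ennreal"
  assumes "\<kappa> \<in> P \<rightarrow>\<^sub>M count_space UNIV" and [measurable]: "\<And>i. f i \<in> borel_measurable P"
  shows "(\<lambda>\<omega>. \<Sum>i<\<kappa> \<omega>. f i \<omega>) \<in> borel_measurable P"
  by (rule measurable_compose_countable[OF _ assms(1)]) measurable

text \<open>Indicators are the definition of the intensity; the general case follows by induction
  over nonnegative measurable functions. The enumeration of the points makes the sum over a random
  multiset a sum of random length with measurable terms.\<close>

lemma nn_integral_campbell:
  fixes \<kappa> :: "'w \<Rightarrow> nat" and X :: "nat \<Rightarrow> 'w \<Rightarrow> 'x"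
  assumes int: "has_intensity P \<eta> \<Lambda>" and sets: "sets \<Lambda> = sets S"
    and \<kappa> [measurable]: "\<kappa> \<in> P \<rightarrow>\<^sub>M count_space UNIV" and X [measurable]: "\<And>i. X i \<in> P \<rightarrow>\<^sub>M S"
    and \<eta>: "AE \<omega> in P. \<eta> \<omega> = image_mset (\<lambda>i. X i \<omega>) (mset_set {..<\<kappa> \<omega>})"
    and f: "f \<in> borel_measurable S"
  shows "(\<integral>\<^sup>+\<omega>. (\<Sum>i<\<kappa> \<omega>. f (X i \<omega>)) \<partial>P) = (\<integral>\<^sup>+x. f x \<partial>\<Lambda>)"
  using f
proof (induct rule: borel_measurable_induct)
  case (cong f g)
  have "(\<integral>\<^sup>+\<omega>. (\<Sum>i<\<kappa> \<omega>. g (X i \<omega>)) \<partial>P) = (\<integral>\<^sup>+\<omega>. (\<Sum>i<\<kappa> \<omega>. f (X i \<omega>)) \<partial>P)"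
    using cong(3) measurable_space[OF X] by (intro nn_integral_cong sum.cong) auto
  moreover have "(\<integral>\<^sup>+x. g x \<partial>\<Lambda>) = (\<integral>\<^sup>+x. f x \<partial>\<Lambda>)"
    using cong(3) sets_eq_imp_space_eq[OF sets] by (intro nn_integral_cong) auto
  ultimately show ?case using cong(4) by simp
next
  case (set A)
  have "(\<integral>\<^sup>+\<omega>. (\<Sum>i<\<kappa> \<omega>. indicator A (X i \<omega>)) \<partial>P) = (\<integral>\<^sup>+\<omega>. of_nat (points_in A (\<eta> \<omega>)) \<partial>P)"
    using \<eta> by (intro nn_integral_cong_AE) (auto elim!: eventually_mono simp: points_in_image_mset)
  also have "\<dots> = emeasure \<Lambda> A" using int set sets by (simp add: has_intensity_def)
  finally show ?case using set sets by simp
next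
  case (mult u c)
  note [measurable] = mult(2)
  have [measurable]: "(\<lambda>\<omega>. \<Sum>i<\<kappa> \<omega>. u (X i \<omega>)) \<in> borel_measurable P"
    by (rule measurable_sum_lessThan) measurable
  have [measurable]: "u \<in> borel_measurable \<Lambda>" unfolding measurable_cong_sets[OF sets refl] by fact
  show ?case
    by (simp add: sum_distrib_left[symmetric] nn_integral_cmult mult(4))
next
  case (add u v)
  note [measurable] = add(1,4)
  have w1: "(\<lambda>\<omega>. \<Sum>i<\<kappa> \<omega>. w (X i \<omega>)) \<in> borel_measurable P" if [measurable]: "w \<in> borel_measurable S" for w :: "'x \<Rightarrow> ennreal"
    by (rule measurable_sum_lessThan) measurable
  have w2: "w \<in> borel_measurable \<Lambda>" if "w \<in> borel_measurable S" for w :: "'x \<Rightarrow> ennreal"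
    unfolding measurable_cong_sets[OF sets refl] by (rule that)
  have "(\<integral>\<^sup>+\<omega>. (\<Sum>i<\<kappa> \<omega>. v (X i \<omega>) + u (X i \<omega>)) \<partial>P) =
      (\<integral>\<^sup>+\<omega>. (\<Sum>i<\<kappa> \<omega>. v (X i \<omega>)) \<partial>P) + (\<integral>\<^sup>+\<omega>. (\<Sum>i<\<kappa> \<omega>. u (X i \<omega>)) \<partial>P)"
    unfolding sum.distrib by (rule nn_integral_add[OF w1[OF add(4)] w1[OF add(1)]])
  also have "\<dots> = (\<integral>\<^sup>+x. v x \<partial>\<Lambda>) + (\<integral>\<^sup>+x. u x \<partial>\<Lambda>)" by (simp only: add(3,7))
  also have "\<dots> = (\<integral>\<^sup>+x. v x + u x \<partial>\<Lambda>)"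
    by (rule nn_integral_add[symmetric, OF w2[OF add(4)] w2[OF add(1)]])
  finally show ?case .
next
  case (seq U)
  note [measurable] = seq(1)
  have [measurable]: "(\<lambda>\<omega>. \<Sum>i<\<kappa> \<omega>. U j (X i \<omega>)) \<in> borel_measurable P" for j
    by (rule measurable_sum_lessThan) measurable
  have [measurable]: "U j \<in> borel_measurable \<Lambda>" for j
    unfolding measurable_cong_sets[OF sets refl] by (rule seq(1))
  have Suc: "U j x \<le> U (Suc j) x" for j x
    by (rule le_funD, rule incseqD[OF seq(4)]) simp
  have inc: "incseq (\<lambda>j. U j x)" for x
    by (rule incseq_SucI) (rule Suc)
  have "(\<integral>\<^sup>+\<omega>. (\<Sum>i<\<kappa> \<omega>. (SUP j. U j) (X i \<omega>)) \<partial>P) = (\<integral>\<^sup>+\<omega>. (SUP j. \<Sum>i<\<kappa> \<omega>. U j (X i \<omega>)) \<partial>P)"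
  proof (rule nn_integral_cong)
    fix \<omega>
    have "(SUP j. \<Sum>i\<in>{..<\<kappa> \<omega>}. U j (X i \<omega>)) = (\<Sum>i\<in>{..<\<kappa> \<omega>}. SUP j. U j (X i \<omega>))"
      by (rule ennreal_SUP_sum[where f="\<lambda>i j. U j (X i \<omega>)"]) (rule inc)
    then show "(\<Sum>i<\<kappa> \<omega>. (SUP j. U j) (X i \<omega>)) = (SUP j. \<Sum>i<\<kappa> \<omega>. U j (X i \<omega>))"
      by (simp only: SUP_apply)
  qed
  also have "\<dots> = (SUP j. \<integral>\<^sup>+\<omega>. (\<Sum>i<\<kappa> \<omega>. U j (X i \<omega>)) \<partial>P)"
  proof (rule nn_integral_monotone_convergence_SUP)
    show "incseq (\<lambda>j \<omega>. \<Sum>i<\<kappa> \<omega>. U j (X i \<omega>))"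
      by (intro incseq_SucI le_funI sum_mono Suc)
  qed simp
  also have "\<dots> = (SUP j. \<integral>\<^sup>+x. U j x \<partial>\<Lambda>)" by (simp only: seq(3))
  also have "\<dots> = (\<integral>\<^sup>+x. (SUP j. U j x) \<partial>\<Lambda>)"
    by (rule nn_integral_monotone_convergence_SUP[symmetric, OF seq(4)]) simp
  finally show ?case by (simp only: SUP_apply)
qed

text \<open>The marks are integrated out by Fubini, as the joint law is a product.\<close>

theorem nn_integral_points_in_marking:
  fixes \<nu> :: "real measure" and S :: "'x measure" and P :: "'w measure"
  assumes int: "has_intensity P \<eta> \<Lambda>" and sets: "sets \<Lambda> = sets S"
    and \<nu>: "prob_space \<nu>" "sets \<nu> = sets borel"
    and mark: "independent_marking P S \<eta> \<nu> \<xi>"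
    and C: "C \<in> sets (S \<Otimes>\<^sub>M borel)"
  shows "(\<integral>\<^sup>+\<omega>. of_nat (points_in C (\<xi> \<omega>)) \<partial>P) = (\<integral>\<^sup>+x. emeasure \<nu> (Pair x -` C) \<partial>\<Lambda>)"
proof -
  define E where "E = count_space (UNIV :: nat set) \<Otimes>\<^sub>M Pi\<^sub>M (UNIV :: nat set) (\<lambda>_. S)"
  define F where "F = Pi\<^sub>M (UNIV :: nat set) (\<lambda>_. borel :: real measure)"
  define G where "G = Pi\<^sub>M (UNIV :: nat set) (\<lambda>_. \<nu>)"
  obtain \<kappa> :: "'w \<Rightarrow> nat" and X :: "nat \<Rightarrow> 'w \<Rightarrow> 'x" and R :: "nat \<Rightarrow> 'w \<Rightarrow> real" where
    Z: "(\<lambda>\<omega>. (\<kappa> \<omega>, \<lambda>i. X i \<omega>)) \<in> P \<rightarrow>\<^sub>M E" and W: "(\<lambda>\<omega> i. R i \<omega>) \<in> P \<rightarrow>\<^sub>M F"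
    and joint: "distr P (E \<Otimes>\<^sub>M F) (\<lambda>\<omega>. ((\<kappa> \<omega>, \<lambda>i. X i \<omega>), \<lambda>i. R i \<omega>)) =
      distr P E (\<lambda>\<omega>. (\<kappa> \<omega>, \<lambda>i. X i \<omega>)) \<Otimes>\<^sub>M G"
    and AE: "AE \<omega> in P. \<eta> \<omega> = image_mset (\<lambda>i. X i \<omega>) (mset_set {..<\<kappa> \<omega>}) \<and>
          \<xi> \<omega> = image_mset (\<lambda>i. (X i \<omega>, R i \<omega>)) (mset_set {..<\<kappa> \<omega>})"
    using mark unfolding independent_marking_def Let_def E_def F_def G_def by blast
  have AE1: "AE \<omega> in P. \<eta> \<omega> = image_mset (\<lambda>i. X i \<omega>) (mset_set {..<\<kappa> \<omega>})"
    and AE2: "AE \<omega> in P. \<xi> \<omega> = image_mset (\<lambda>i. (X i \<omega>, R i \<omega>)) (mset_set {..<\<kappa> \<omega>})"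
    using AE by auto
  note [measurable] = C
  have \<kappa> [measurable]: "\<kappa> \<in> P \<rightarrow>\<^sub>M count_space UNIV"
    using measurable_compose[OF Z[unfolded E_def] measurable_fst] by simp
  have X' : "(\<lambda>\<omega>. \<lambda>i. X i \<omega>) \<in> P \<rightarrow>\<^sub>M Pi\<^sub>M UNIV (\<lambda>_. S)"
    using measurable_compose[OF Z[unfolded E_def] measurable_snd] by simp
  have X [measurable]: "X i \<in> P \<rightarrow>\<^sub>M S" for i
    using measurable_compose[OF X' measurable_component_singleton[of i]] by simp
  interpret \<nu>: prob_space \<nu> by fact
  interpret G: product_prob_space "\<lambda>_ :: nat. \<nu>" UNIV ..
  interpret PG: prob_space G unfolding G_def by (rule G.prob_space_axioms)
  have sets_G: "sets G = sets F" unfolding F_def G_def by (rule sets_PiM_cong) (auto simp: \<nu>)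
  define h where "h x = emeasure \<nu> (Pair x -` C)" for x
  have C': "C \<in> sets (S \<Otimes>\<^sub>M \<nu>)" using C by (simp cong: sets_pair_measure_cong add: \<nu>(2))
  have h [measurable]: "h \<in> borel_measurable S"
    unfolding h_def by (rule \<nu>.measurable_emeasure_Pair[OF C'])
  \<comment> \<open>The number of marked points in \<open>C\<close> as a function on the space where
    the joint law is a product: positions and number in the first component, marks in the
    second.\<close>
  define g where "g p = (\<Sum>i<fst (fst p). indicator C (snd (fst p) i, snd p i) :: ennreal)"
    for p :: "(nat \<times> (nat \<Rightarrow> 'x)) \<times> (nat \<Rightarrow> real)"
  have g [measurable]: "g \<in> borel_measurable (E \<Otimes>\<^sub>M F)"
  proof -
    have "(\<lambda>p. \<Sum>i<fst (fst p). indicator C (snd (fst p) i, snd p i) :: ennreal) \<in> borel_measurable (E \<Otimes>\<^sub>M F)"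
    proof (rule measurable_sum_lessThan)
      show "(\<lambda>p. fst (fst p)) \<in> E \<Otimes>\<^sub>M F \<rightarrow>\<^sub>M count_space UNIV" unfolding E_def by measurable
      fix i
      have "(\<lambda>p. snd (fst p) i) \<in> E \<Otimes>\<^sub>M F \<rightarrow>\<^sub>M S" unfolding E_def by measurable
      moreover have "(\<lambda>p. snd p i) \<in> E \<Otimes>\<^sub>M F \<rightarrow>\<^sub>M borel" unfolding F_def by measurable
      ultimately have "(\<lambda>p. (snd (fst p) i, snd p i)) \<in> E \<Otimes>\<^sub>M F \<rightarrow>\<^sub>M S \<Otimes>\<^sub>M borel" by measurable
      from measurable_compose[OF this borel_measurable_indicator[OF C]]
      show "(\<lambda>p. indicator C (snd (fst p) i, snd p i) :: ennreal) \<in> borel_measurable (E \<Otimes>\<^sub>M F)" .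
    qed
    then show ?thesis unfolding g_def .
  qed
  have ZW: "(\<lambda>\<omega>. ((\<kappa> \<omega>, \<lambda>i. X i \<omega>), \<lambda>i. R i \<omega>)) \<in> P \<rightarrow>\<^sub>M E \<Otimes>\<^sub>M F"
    using Z W by (rule measurable_Pair)
  \<comment> \<open>With number and positions held fixed, each coordinate of the product measure
    \<open>G\<close> has law \<nu>, so the expected count is the sum of \<open>h\<close> over the
    positions.\<close>
  have inner: "(\<integral>\<^sup>+r. g ((n, x), r) \<partial>G) = (\<Sum>i<n. h (x i))" if "\<And>i. x i \<in> space S" for n x
  proof -
    have m: "(\<lambda>r. r i) \<in> G \<rightarrow>\<^sub>M \<nu>" for i :: nat unfolding G_def by measurable
    have Cx: "Pair (x i) -` C \<in> sets \<nu>" for i by (rule sets_Pair1[OF C'])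
    have eq: "(\<lambda>r. indicator C (x i, r i) :: ennreal) = (\<lambda>r. indicator (Pair (x i) -` C) (r i))" for i
      by (auto simp: indicator_def fun_eq_iff)
    have mi: "(\<lambda>r. indicator C (x i, r i) :: ennreal) \<in> borel_measurable G" for i
      unfolding eq using measurable_compose[OF m borel_measurable_indicator[OF Cx]] .
    have "(\<integral>\<^sup>+r. g ((n, x), r) \<partial>G) = (\<Sum>i<n. \<integral>\<^sup>+r. indicator C (x i, r i) \<partial>G)"
      unfolding g_def by (simp add: nn_integral_sum mi)
    also have "\<dots> = (\<Sum>i<n. h (x i))"
    proof (rule sum.cong[OF refl])
      fix i
      have "(\<integral>\<^sup>+r. indicator C (x i, r i) \<partial>G) = (\<integral>\<^sup>+y. indicator (Pair (x i) -` C) y \<partial>distr G \<nu> (\<lambda>r. r i))"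
        unfolding eq by (rule nn_integral_distr[symmetric, OF m]) (use Cx in simp)
      also have "distr G \<nu> (\<lambda>r. r i) = \<nu>" unfolding G_def by (rule G.PiM_component) simp
      finally show "(\<integral>\<^sup>+r. indicator C (x i, r i) \<partial>G) = h (x i)" using Cx by (simp add: h_def)
    qed
    finally show ?thesis .
  qed
  have "(\<integral>\<^sup>+\<omega>. of_nat (points_in C (\<xi> \<omega>)) \<partial>P) = (\<integral>\<^sup>+\<omega>. g ((\<kappa> \<omega>, \<lambda>i. X i \<omega>), \<lambda>i. R i \<omega>) \<partial>P)"
    using AE2 by (intro nn_integral_cong_AE) (auto elim!: eventually_mono simp: points_in_image_mset g_def)
  also have "\<dots> = (\<integral>\<^sup>+p. g p \<partial>(distr P E (\<lambda>\<omega>. (\<kappa> \<omega>, \<lambda>i. X i \<omega>)) \<Otimes>\<^sub>M G))"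
    unfolding joint[symmetric] by (rule nn_integral_distr[symmetric, OF ZW]) (use g in simp)
  also have "\<dots> = (\<integral>\<^sup>+q. \<integral>\<^sup>+r. g (q, r) \<partial>G \<partial>distr P E (\<lambda>\<omega>. (\<kappa> \<omega>, \<lambda>i. X i \<omega>)))"
    by (rule PG.nn_integral_fst[symmetric])
       (use g in \<open>simp cong: measurable_cong_sets sets_pair_measure_cong add: sets_G\<close>)
  also have "\<dots> = (\<integral>\<^sup>+\<omega>. \<integral>\<^sup>+r. g ((\<kappa> \<omega>, \<lambda>i. X i \<omega>), r) \<partial>G \<partial>P)"
  proof (rule nn_integral_distr[OF Z])
    have "g \<in> borel_measurable (E \<Otimes>\<^sub>M G)"
      using g by (simp cong: measurable_cong_sets sets_pair_measure_cong add: sets_G)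
    then have "(\<lambda>q. \<integral>\<^sup>+r. g (q, r) \<partial>G) \<in> borel_measurable E"
      by (rule PG.borel_measurable_nn_integral_fst)
    then show "(\<lambda>q. \<integral>\<^sup>+r. g (q, r) \<partial>G) \<in> borel_measurable (distr P E (\<lambda>\<omega>. (\<kappa> \<omega>, \<lambda>i. X i \<omega>)))"
      by simp
  qed
  also have "\<dots> = (\<integral>\<^sup>+\<omega>. (\<Sum>i<\<kappa> \<omega>. h (X i \<omega>)) \<partial>P)"
    using measurable_space[OF X] by (intro nn_integral_cong inner) auto
  also have "\<dots> = (\<integral>\<^sup>+x. h x \<partial>\<Lambda>)"
    by (rule nn_integral_campbell[OF int sets \<kappa> X AE1 h])
  finally show ?thesis unfolding h_def .
qed

section \<open>Sections of balls\<close>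

text \<open>The bound \<open>2 < CARD('n)\<close> gives \<open>L\<close> dimension at least one; on
  two isolated points a section would not determine its radius.\<close>

locale hypersurface_section =
  fixes k r :: real and \<nu> :: "real ^ 'n" and L :: "(real ^ 'n) set"
  assumes k: "0 < k" and r: "r = 1 / sqrt k" and norm_\<nu>: "norm \<nu> = 1" and dim: "2 < CARD('n)"
    and L: "L = sphere 0 r \<inter> {x. \<nu> \<bullet> x = 0}"
begin

lemma r_pos: "0 < r" and k_r: "k * r\<^sup>2 = 1"
  using k by (auto simp: r power_divide)

lemma space_form_eq: "space_form k = sphere 0 r"
  by (simp add: space_form_def r)

lemma scaled_inner_bounds:
  assumes "norm x = r" "norm y = r" shows "-1 \<le> k * (x \<bullet> y)" "k * (x \<bullet> y) \<le> 1"
proof -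
  have "\<bar>x \<bullet> y\<bar> \<le> r\<^sup>2" using Cauchy_Schwarz_ineq2[of x y] assms by (simp add: power2_eq_square)
  then have "k * \<bar>x \<bullet> y\<bar> \<le> k * r\<^sup>2" using k by (intro mult_left_mono) auto
  then have "\<bar>k * (x \<bullet> y)\<bar> \<le> 1" using k k_r by (simp add: abs_mult)
  then show "-1 \<le> k * (x \<bullet> y)" "k * (x \<bullet> y) \<le> 1" by (auto simp: abs_le_iff)
qed

lemma scaled_inner_self: "norm x = r \<Longrightarrow> k * (x \<bullet> x) = 1"
  using k_r by (simp add: dot_square_norm)

lemma gdist_mono_iff:
  assumes "norm x = r" "norm y = r" "norm z = r"
  shows "gdist k x y \<le> gdist k x z \<longleftrightarrow> x \<bullet> z \<le> x \<bullet> y"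
proof -
  have "gdist k x y \<le> gdist k x z \<longleftrightarrow> arccos (k * (x \<bullet> y)) \<le> arccos (k * (x \<bullet> z))"
    using k by (simp add: gdist_def divide_le_cancel)
  also have "\<dots> \<longleftrightarrow> k * (x \<bullet> z) \<le> k * (x \<bullet> y)"
    using assms scaled_inner_bounds by (intro arccos_le_mono) (auto simp: abs_le_iff)
  finally show ?thesis using k by simp
qed

lemma gdist_le_iff:
  assumes "norm x = r" "norm y = r" "0 \<le> R" "R \<le> max_radius k"
  shows "gdist k x y \<le> R \<longleftrightarrow> cos (sqrt k * R) \<le> k * (x \<bullet> y)"
proof -
  have R: "0 \<le> sqrt k * R" "sqrt k * R \<le> pi / 2"
    using assms(3,4) k by (auto simp: max_radius_def field_simps)
  have "gdist k x y \<le> R \<longleftrightarrow> arccos (k * (x \<bullet> y)) \<le> sqrt k * R"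
    using k by (simp add: gdist_def field_simps)
  also have "\<dots> \<longleftrightarrow> cos (sqrt k * R) \<le> cos (arccos (k * (x \<bullet> y)))"
    using R scaled_inner_bounds[OF assms(1,2)] pi_gt_zero
    by (intro cos_mono_le_eq[symmetric] arccos_lbound arccos_ubound) linarith+
  finally show ?thesis using scaled_inner_bounds[OF assms(1,2)] by simp
qed

lemma gball_Int:
  assumes "norm x = r" "0 \<le> R" "R \<le> max_radius k"
  shows "gball k x R \<inter> L = {z \<in> L. cos (sqrt k * R) \<le> k * (x \<bullet> z)}"
  using gdist_le_iff[OF assms(1) _ assms(2,3)] by (auto simp: gball_def space_form_eq L)

text \<open>Against points of \<open>L\<close>, the inner products of \<open>x\<close> and of its
  foot \<open>y\<close> differ only by the positive factor \<open>cos t\<close>. Hence the distances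
  from \<open>x\<close> and from \<open>y\<close> order the points of \<open>L\<close> in the same
  way, and a ball about \<open>x\<close> cuts \<open>L\<close> in a ball about
  \<open>y\<close>.\<close>

lemma foot:
  assumes x: "norm x = r" and t: "latitude r \<nu> x = t" "\<bar>t\<bar> < pi / 2"
  obtains y where "y \<in> L" "0 < cos t" "\<And>z. z \<in> L \<Longrightarrow> x \<bullet> z = cos t * (y \<bullet> z)"
proof -
  have ct: "0 < cos t" using t by (intro cos_gt_zero_pi) auto
  have st: "x \<bullet> \<nu> = r * sin t" using sin_latitude[OF x r_pos norm_\<nu>] t by simp
  have \<nu>: "\<nu> \<bullet> \<nu> = 1" using norm_\<nu> by (simp add: norm_eq_1)
  have xx: "x \<bullet> x = r\<^sup>2" using x by (simp add: dot_square_norm)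
  define y where "y = (1 / cos t) *\<^sub>R (x - (r * sin t) *\<^sub>R \<nu>)"
  have "y \<bullet> y = (1 / cos t)\<^sup>2 * (r\<^sup>2 - (r * sin t)\<^sup>2)"
    by (simp add: y_def inner_diff_left inner_diff_right st inner_commute[of \<nu> x] \<nu> xx power2_eq_square algebra_simps)
  also have "\<dots> = (1 / cos t)\<^sup>2 * (r\<^sup>2 * (cos t)\<^sup>2)" by (simp add: cos_squared_eq power_mult_distrib algebra_simps)
  also have "\<dots> = r\<^sup>2" using ct by (simp add: power_divide)
  finally have "norm y = r" using r_pos by (simp add: norm_eq_sqrt_inner)
  moreover have "\<nu> \<bullet> y = 0" by (simp add: y_def inner_diff_right st inner_commute[of \<nu> x] \<nu>)
  ultimately have "y \<in> L" by (simp add: L)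
  moreover have "x \<bullet> z = cos t * (y \<bullet> z)" if "z \<in> L" for z
    using that ct by (simp add: y_def L inner_diff_left)
  ultimately show ?thesis using that ct by blast
qed

text \<open>Minimizing the distance from \<open>x\<close> over \<open>L\<close> is maximizing
  \<open>y \<bullet> z\<close>, and the maximum is attained only at \<open>z = y\<close>. Uniqueness
  is what pins down the choice in \<open>gproj\<close>.\<close>

lemma gproj_foot:
  assumes x: "norm x = r" and y: "y \<in> L" and c: "0 < c" "\<And>z. z \<in> L \<Longrightarrow> x \<bullet> z = c * (y \<bullet> z)"
  shows "gproj k L x = y"
proof -
  have yn: "norm y = r" using y by (simp add: L)
  have yy: "y \<bullet> y = r\<^sup>2" using yn by (simp add: dot_square_norm)
  have le: "y \<bullet> z \<le> r\<^sup>2" if "norm z = r" for z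
    using norm_cauchy_schwarz[of y z] that yn by (simp add: power2_eq_square)
  have iff: "gdist k x u \<le> gdist k x z \<longleftrightarrow> y \<bullet> z \<le> y \<bullet> u" if "u \<in> L" "z \<in> L" for u z
    using that c x by (subst gdist_mono_iff) (auto simp: L)
  show ?thesis unfolding gproj_def
  proof (rule some_equality)
    show "y \<in> L \<and> (\<forall>z\<in>L. gdist k x y \<le> gdist k x z)"
      using y le by (auto simp: iff yy L)
    fix u assume u: "u \<in> L \<and> (\<forall>z\<in>L. gdist k x u \<le> gdist k x z)"
    then have "r\<^sup>2 \<le> y \<bullet> u" using y iff[of u y] by (simp add: yy)
    moreover have "u \<bullet> u = r\<^sup>2" using u by (simp add: L dot_square_norm)
    ultimately have "(u - y) \<bullet> (u - y) \<le> 0"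
      by (simp add: inner_diff_left inner_diff_right yy inner_commute[of u y])
    then have "(u - y) \<bullet> (u - y) = 0" using inner_ge_zero[of "u - y"] by linarith
    then show "u = y" by simp
  qed
qed

text \<open>A vector \<open>w\<close> orthogonal to both \<nu> and \<open>y\<close> exists because
  the ambient dimension exceeds 2; turning from \<open>y\<close> towards \<open>w\<close> inside
  \<open>L\<close> realizes every angle.\<close>

lemma ex_scaled_inner:
  assumes y: "y \<in> L" and c: "\<bar>c\<bar> \<le> 1"
  obtains z where "z \<in> L" "k * (y \<bullet> z) = c"
proof -
  have "dim {\<nu>, y} \<le> card {\<nu>, y}" by (intro dim_le_card') auto
  also have "\<dots> \<le> 2" by (simp add: card_insert_if)
  finally have "dim {\<nu>, y} < DIM(real ^ 'n)" using dim by simp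
  then obtain w where w: "w \<noteq> 0" "\<And>v. v \<in> span {\<nu>, y} \<Longrightarrow> orthogonal w v"
    using orthogonal_to_subspace_exists by blast
  then have wo: "w \<bullet> \<nu> = 0" "w \<bullet> y = 0" by (auto simp: orthogonal_def span_base)
  define z where "z = c *\<^sub>R y + (sqrt (1 - c\<^sup>2) * r / norm w) *\<^sub>R w"
  have yy: "y \<bullet> y = r\<^sup>2" "\<nu> \<bullet> y = 0" using y by (auto simp: L dot_square_norm)
  have ww: "w \<bullet> w = (norm w)\<^sup>2" "norm w > 0" using w by (auto simp: dot_square_norm)
  have c1: "c\<^sup>2 \<le> 1" using c by (simp add: abs_square_le_1)
  have "z \<bullet> z = c\<^sup>2 * r\<^sup>2 + (sqrt (1 - c\<^sup>2) * r / norm w)\<^sup>2 * (norm w)\<^sup>2"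
    by (simp add: z_def inner_add_left inner_add_right yy wo inner_commute[of y w] ww(1) power2_eq_square)
  also have "(sqrt (1 - c\<^sup>2) * r / norm w)\<^sup>2 * (norm w)\<^sup>2 = (1 - c\<^sup>2) * r\<^sup>2"
    using ww(2) c1 by (simp add: power_divide power_mult_distrib)
  finally have "z \<bullet> z = r\<^sup>2" by (simp add: algebra_simps)
  then have "norm z = r" using r_pos by (simp add: norm_eq_sqrt_inner)
  moreover have "\<nu> \<bullet> z = 0" by (simp add: z_def inner_add_right yy wo inner_commute[of \<nu> w])
  moreover have "k * (y \<bullet> z) = c"
    using k_r by (simp add: z_def inner_add_right yy wo inner_commute[of y w] mult.left_commute)
  ultimately show ?thesis using that by (simp add: L)
qed

context
  fixes x :: "real ^ 'n" and R :: real
  assumes x: "norm x = r" and lat: "\<bar>latitude r \<nu> x\<bar> < pi / 2" and R: "0 \<le> R" "R \<le> max_radius k"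
begin

lemma R_angle: "0 \<le> sqrt k * R" "sqrt k * R \<le> pi / 2"
  using R k by (auto simp: max_radius_def field_simps)

text \<open>A ball meets \<open>L\<close> exactly when it contains the foot of its centre, and the
  scaled inner product of centre and foot is \<open>cos t\<close>.\<close>

lemma gball_hits_iff: "gball k x R \<inter> L \<noteq> {} \<longleftrightarrow> \<bar>latitude r \<nu> x\<bar> \<le> sqrt k * R"
proof -
  define t where "t = latitude r \<nu> x"
  obtain y where y: "y \<in> L" "0 < cos t" "\<And>z. z \<in> L \<Longrightarrow> x \<bullet> z = cos t * (y \<bullet> z)"
    using foot[OF x, of t] lat by (auto simp: t_def)
  have yn: "norm y = r" using y by (simp add: L)
  have "gball k x R \<inter> L \<noteq> {} \<longleftrightarrow> cos (sqrt k * R) \<le> cos t"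
  proof
    assume "gball k x R \<inter> L \<noteq> {}"
    then obtain z where z: "z \<in> L" "cos (sqrt k * R) \<le> k * (x \<bullet> z)"
      unfolding gball_Int[OF x R] by auto
    have "k * (x \<bullet> z) = cos t * (k * (y \<bullet> z))" using y(3)[OF z(1)] by simp
    also have "\<dots> \<le> cos t * 1" using scaled_inner_bounds(2)[OF yn, of z] z y(2)
      by (intro mult_left_mono) (auto simp: L)
    finally show "cos (sqrt k * R) \<le> cos t" using z by simp
  next
    assume "cos (sqrt k * R) \<le> cos t"
    moreover have "k * (x \<bullet> y) = cos t * (k * (y \<bullet> y))" using y(3)[OF y(1)] by simp
    ultimately have "y \<in> gball k x R \<inter> L"
      unfolding gball_Int[OF x R] using y(1) scaled_inner_self[OF yn] by simp
    then show "gball k x R \<inter> L \<noteq> {}" by blast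
  qed
  also have "\<dots> \<longleftrightarrow> cos (sqrt k * R) \<le> cos \<bar>t\<bar>" by simp
  also have "\<dots> \<longleftrightarrow> \<bar>t\<bar> \<le> sqrt k * R"
    using R_angle lat pi_gt_zero by (intro cos_mono_le_eq) (auto simp: t_def)
  finally show ?thesis by (simp add: t_def)
qed

lemma gproj_in_L: "gproj k L x \<in> L"
  using foot[OF x refl lat] gproj_foot[OF x] by metis

lemma section_cos_ratio:
  assumes "\<bar>latitude r \<nu> x\<bar> \<le> sqrt k * R"
  shows "0 \<le> cos (sqrt k * R) / cos (latitude r \<nu> x)" "cos (sqrt k * R) / cos (latitude r \<nu> x) \<le> 1"
proof -
  have ct: "0 < cos (latitude r \<nu> x)" using lat by (intro cos_gt_zero_pi) auto
  have "cos (sqrt k * R) \<le> cos \<bar>latitude r \<nu> x\<bar>"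
    using assms R_angle pi_gt_zero by (intro cos_monotone_0_pi_le) auto
  moreover have "0 \<le> cos (sqrt k * R)" using R_angle by (intro cos_ge_zero) auto
  ultimately show "0 \<le> cos (sqrt k * R) / cos (latitude r \<nu> x)" "cos (sqrt k * R) / cos (latitude r \<nu> x) \<le> 1"
    using ct by auto
qed

lemma section_radius_eq:
  assumes hit: "\<bar>latitude r \<nu> x\<bar> \<le> sqrt k * R"
  shows "section_radius k L x R = arccos (cos (sqrt k * R) / cos (latitude r \<nu> x)) / sqrt k"
proof -
  define t where "t = latitude r \<nu> x"
  define q where "q = cos (sqrt k * R) / cos t"
  obtain y where y: "y \<in> L" "0 < cos t" "\<And>z. z \<in> L \<Longrightarrow> x \<bullet> z = cos t * (y \<bullet> z)"
    using foot[OF x, of t] lat by (auto simp: t_def)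
  have yn: "norm y = r" using y by (simp add: L)
  have proj: "gproj k L x = y" by (rule gproj_foot[OF x y])
  have q: "0 \<le> q" "q \<le> 1" using section_cos_ratio[OF hit] by (auto simp: q_def t_def)
  have sec: "gball k x R \<inter> L = {z \<in> L. q \<le> k * (y \<bullet> z)}"
    unfolding gball_Int[OF x R] q_def using y by (auto simp: field_simps)
  have acos: "0 \<le> arccos q" "arccos q \<le> pi / 2" "cos (arccos q) = q"
    using q arccos_le_pi2[of q] by (auto simp: arccos_lbound)
  show ?thesis unfolding section_radius_def proj t_def[symmetric] q_def[symmetric]
  proof (rule the_equality)
    show "0 \<le> arccos q / sqrt k \<and> arccos q / sqrt k \<le> max_radius k \<and>
      gball k x R \<inter> L = gball k y (arccos q / sqrt k) \<inter> L"
    proof (intro conjI)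
      show *: "0 \<le> arccos q / sqrt k" "arccos q / sqrt k \<le> max_radius k"
        using acos k by (auto simp: max_radius_def field_simps)
      show "gball k x R \<inter> L = gball k y (arccos q / sqrt k) \<inter> L"
        unfolding sec gball_Int[OF yn *] using acos k by simp
    qed
  next
    fix \<rho> assume \<rho>: "0 \<le> \<rho> \<and> \<rho> \<le> max_radius k \<and> gball k x R \<inter> L = gball k y \<rho> \<inter> L"
    then have \<rho>': "0 \<le> sqrt k * \<rho>" "sqrt k * \<rho> \<le> pi / 2"
      using k by (auto simp: max_radius_def field_simps)
    have eq: "{z \<in> L. q \<le> k * (y \<bullet> z)} = {z \<in> L. cos (sqrt k * \<rho>) \<le> k * (y \<bullet> z)}"
      using \<rho> sec gball_Int[OF yn, of \<rho>] by simp
    \<comment> \<open>Uniqueness of the radius: a point of \<open>L\<close> lying exactly on the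
      boundary of one of the two equal balls satisfies the inequality of the other. Doing this for
      both balls makes the thresholds equal.\<close>
    have "cos (sqrt k * \<rho>) \<le> q"
    proof -
      obtain z where "z \<in> L" "k * (y \<bullet> z) = q" using ex_scaled_inner[OF y(1), of q] q by auto
      then show ?thesis using eq by blast
    qed
    moreover have "q \<le> cos (sqrt k * \<rho>)"
    proof -
      obtain z where "z \<in> L" "k * (y \<bullet> z) = cos (sqrt k * \<rho>)" using ex_scaled_inner[OF y(1), of "cos (sqrt k * \<rho>)"] by auto
      then show ?thesis using eq by (metis (mono_tags, lifting) mem_Collect_eq order_refl)
    qed
    ultimately have "q = cos (sqrt k * \<rho>)" by simp
    then have "arccos q = sqrt k * \<rho>" using \<rho>' by (simp add: arccos_cos)
    then show "\<rho> = arccos q / sqrt k" using k by simp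
  qed
qed

end

end

lemma geodesic_hypersurfaceE:
  fixes L :: "(real ^ 'n) set"
  assumes "geodesic_hypersurface k L"
  obtains \<nu> where "norm \<nu> = 1" "L = space_form k \<inter> {x. \<nu> \<bullet> x = 0}"
proof -
  obtain H where H: "subspace H" "dim H + 1 = CARD('n)" "L = space_form k \<inter> H"
    using assms by (auto simp: geodesic_hypersurface_def)
  then have "dim H < DIM(real ^ 'n)" by simp
  then obtain w where w: "w \<noteq> 0" "\<And>v. v \<in> span H \<Longrightarrow> orthogonal w v"
    using orthogonal_to_subspace_exists by blast
  define \<nu> where "\<nu> = (1 / norm w) *\<^sub>R w"
  have \<nu>: "norm \<nu> = 1" using w by (simp add: \<nu>_def)
  have "H \<subseteq> {x. \<nu> \<bullet> x = 0}" using w(2) by (auto simp: \<nu>_def orthogonal_def span_base)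
  then have "H = {x. \<nu> \<bullet> x = 0}"
    using H dim_hyperplane_cart[OF \<nu>] by (intro subspace_dim_equal subspace_hyperplane) auto
  then show ?thesis using that[OF \<nu>] H by simp
qed

section \<open>The law of the induced radii\<close>

lemma points_in_measurable:
  assumes "A \<in> sets S"
  shows "points_in A \<in> config_space S \<rightarrow>\<^sub>M count_space UNIV"
proof -
  let ?\<Omega> = "{m. set_mset m \<subseteq> space S}"
  let ?G = "{{m. set_mset m \<subseteq> space S \<and> points_in A m = n} |A n. A \<in> sets S}"
  have G: "?G \<subseteq> Pow ?\<Omega>" by auto
  have sp: "space (config_space S) = ?\<Omega>" unfolding config_space_def by (rule space_measure_of[OF G])
  have st: "sets (config_space S) = sigma_sets ?\<Omega> ?G" unfolding config_space_def by (rule sets_measure_of[OF G])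
  have "points_in A -` {n} \<inter> space (config_space S) \<in> sets (config_space S)" for n
  proof -
    have "points_in A -` {n} \<inter> space (config_space S) = {m. set_mset m \<subseteq> space S \<and> points_in A m = n}"
      unfolding sp by auto
    also have "\<dots> \<in> sigma_sets ?\<Omega> ?G" using assms by (intro sigma_sets.Basic) auto
    finally show ?thesis unfolding st .
  qed
  then show ?thesis by (subst measurable_count_space_eq2_countable) auto
qed

lemma space_config_space: "space (config_space S) = {m. set_mset m \<subseteq> space S}"
  unfolding config_space_def by (rule space_measure_of) auto

lemma points_in_eq_0_iff: "points_in A m = 0 \<longleftrightarrow> (\<forall>x\<in>#m. x \<notin> A)"
  by (induction m) (auto simp: points_in_def)

lemma points_in_cong: "(\<And>x. x \<in># m \<Longrightarrow> x \<in> A \<longleftrightarrow> x \<in> B) \<Longrightarrow> points_in A m = points_in B m"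
  unfolding points_in_def by (metis (mono_tags, lifting) filter_mset_cong)

text \<open>The count is pulled back to the original balls. The set on the right involves choices,
  so its measurability is not evident; it is replaced later by a measurable set that agrees with it
  almost surely on the points that occur.\<close>

lemma points_in_induced_balls:
  "points_in A (induced_balls k L m) =
    points_in {(x, R). gball k x R \<inter> L \<noteq> {} \<and> (gproj k L x, section_radius k L x R) \<in> A} m"
  by (induction m) (auto simp: points_in_def induced_balls_def)

text \<open>Radius of the section of a ball of radius \<open>R\<close> whose centre has latitude \<open>t\<close> (clamped as for \<open>latitude\<close>).\<close>

definition cut_radius :: "real \<Rightarrow> real \<Rightarrow> real \<Rightarrow> real"
  where "cut_radius k t R = arccos (max (-1) (min 1 (cos (sqrt k * R) / cos t))) / sqrt k"

text \<open>The strict bound by \<open>pi / 2\<close> excludes the poles of \<open>L\<close>, where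
  the foot is arbitrary; the bounds on \<open>R\<close> exclude marks that occur with probability
  0.\<close>

definition cuts :: "real \<Rightarrow> real \<Rightarrow> real \<Rightarrow> bool"
  where "cuts k t R \<longleftrightarrow> 0 < R \<and> R \<le> max_radius k \<and> \<bar>t\<bar> < pi / 2 \<and> \<bar>t\<bar> \<le> sqrt k * R"

lemma cut_radius_measurable [measurable]:
  assumes [measurable]: "f \<in> borel_measurable M" "g \<in> borel_measurable M"
  shows "(\<lambda>x. cut_radius k (f x) (g x)) \<in> borel_measurable M"
  unfolding cut_radius_def
  by (intro borel_measurable_divide measurable_compose[OF _ borel_measurable_arccos_clamp]) measurable

lemma cuts_measurable [measurable]:
  assumes [measurable]: "f \<in> borel_measurable M" "g \<in> borel_measurable M"
  shows "Measurable.pred M (\<lambda>x. cuts k (f x) (g x))"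
  unfolding cuts_def by measurable

context hypersurface_section
begin

text \<open>Away from the exceptional points, the choice-based description of a section becomes a
  condition on latitude and radius alone, which is measurable.\<close>

lemma cut_ball_iff:
  assumes "norm x = r" "0 < R" "R \<le> max_radius k" "\<bar>latitude r \<nu> x\<bar> < pi / 2"
  shows "gball k x R \<inter> L \<noteq> {} \<and> (gproj k L x, section_radius k L x R) \<in> L \<times> B \<longleftrightarrow>
    cuts k (latitude r \<nu> x) R \<and> cut_radius k (latitude r \<nu> x) R \<in> B"
proof -
  have R: "0 \<le> R" using assms by simp
  note a = assms(1,4) R assms(3)
  have hit: "gball k x R \<inter> L \<noteq> {} \<longleftrightarrow> cuts k (latitude r \<nu> x) R"
    using gball_hits_iff[OF a] assms by (simp add: cuts_def)
  have "section_radius k L x R = cut_radius k (latitude r \<nu> x) R" if "cuts k (latitude r \<nu> x) R"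
    using that section_radius_eq[OF a] section_cos_ratio[OF a]
    by (simp add: cuts_def cut_radius_def max_def min_def)
  then show ?thesis using hit gproj_in_L[OF a] by auto
qed

text \<open>The expected number of induced balls with radius in \<open>B\<close> is computed twice:
  from the intensity of the induced process on the rectangle \<open>L \<times> B\<close>, and from
  the original process by counting the balls that produce them. The volume of \<open>L\<close> is a
  factor of both results.\<close>

theorem induced_radius_law:
  fixes N N' :: real and \<mu> \<mu>L :: "(real ^ 'n) measure" and P :: "'w measure"
  assumes m: "CARD('n) = CARD('m::finite) + 1" and l: "CARD('m) = CARD('l::finite) + 1"
    and \<mu>: "riemannian_volume TYPE('m) (space_form k) \<mu>"
    and \<mu>L: "riemannian_volume TYPE('l) L \<mu>L"
    and N: "0 < N" and int: "has_intensity P \<eta> (scale_measure (ennreal N) \<mu>)"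
    and \<rho>: "prob_space \<rho>" "sets \<rho> = sets borel" "AE R in \<rho>. 0 < R \<and> R \<le> max_radius k"
    and mark: "independent_marking P (restrict_space borel (space_form k)) \<eta> \<rho> \<xi>"
    and \<rho>': "prob_space \<rho>'" "sets \<rho>' = sets borel"
    and ind: "has_intensity P (\<lambda>\<omega>. induced_balls k L (\<xi> \<omega>)) (scale_measure (ennreal N') (\<mu>L \<Otimes>\<^sub>M \<rho>'))"
    and B: "B \<in> sets borel"
  shows "ennreal N' * emeasure \<rho>' B = ennreal N *
    (\<integral>\<^sup>+t. emeasure \<rho> {R. cuts k t R \<and> cut_radius k t R \<in> B} * ennreal (r * cos t ^ CARD('l)) * indicator {-(pi / 2)<..<pi / 2} t \<partial>lborel)"
proof -
  define S where "S = restrict_space (borel :: (real ^ 'n) measure) (sphere 0 r)"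
  have spS: "space S = sphere 0 r" by (simp add: S_def space_restrict_space)
  interpret \<rho>: prob_space \<rho> by fact
  interpret \<rho>': prob_space \<rho>' by fact
  note [measurable] = B
  have lat [measurable]: "latitude r \<nu> \<in> borel_measurable S"
    unfolding S_def by (rule measurable_restrict_space1) measurable
  have \<mu>': "riemannian_volume TYPE('m) (sphere 0 r) \<mu>" using \<mu> by (simp add: space_form_eq)
  have \<mu>L': "riemannian_volume TYPE('l) (sphere 0 r \<inter> {x. \<nu> \<bullet> x = 0}) \<mu>L" using \<mu>L by (simp add: L)
  have sets\<mu>: "sets \<mu> = sets S" using \<mu>' by (simp add: riemannian_volume_def S_def)
  then have sets\<Lambda>: "sets (scale_measure (ennreal N) \<mu>) = sets S" by simp
  have mark': "independent_marking P S \<eta> \<rho> \<xi>" using mark by (simp add: S_def space_form_eq)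
  then have \<xi>: "\<xi> \<in> P \<rightarrow>\<^sub>M config_space (S \<Otimes>\<^sub>M borel)"
    by (simp add: independent_marking_def point_process_def)
  note campbell = nn_integral_points_in_marking[OF int sets\<Lambda> \<rho>(1,2) mark']
  define C where "C = {p \<in> space (S \<Otimes>\<^sub>M borel). cuts k (latitude r \<nu> (fst p)) (snd p) \<and> cut_radius k (latitude r \<nu> (fst p)) (snd p) \<in> B}"
  \<comment> \<open>The marked points to which the geometry does not apply: inadmissible radii, or
    centres at a pole of \<open>L\<close>.\<close>
  define bad where "bad = {p \<in> space (S \<Otimes>\<^sub>M (borel :: real measure)). \<not> (0 < snd p \<and> snd p \<le> max_radius k \<and> \<bar>latitude r \<nu> (fst p)\<bar> < pi / 2)}"
  have C [measurable]: "C \<in> sets (S \<Otimes>\<^sub>M borel)" unfolding C_def by measurable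
  have bad [measurable]: "bad \<in> sets (S \<Otimes>\<^sub>M borel)" unfolding bad_def by measurable
  have sp: "space (S \<Otimes>\<^sub>M (borel :: real measure)) = sphere 0 r \<times> UNIV" by (simp add: space_pair_measure spS)
  have latint: "(\<integral>\<^sup>+x. f (latitude r \<nu> x) \<partial>\<mu>) = emeasure \<mu>L L *
    (\<integral>\<^sup>+t. f t * ennreal (r * cos t ^ CARD('l)) * indicator {-(pi / 2)<..<pi / 2} t \<partial>lborel)"
    if "f \<in> borel_measurable borel" for f
    using nn_integral_latitude[OF norm_\<nu> r_pos m l \<mu>' \<mu>L' that] by (simp add: L)
  have bad0: "(\<integral>\<^sup>+\<omega>. of_nat (points_in bad (\<xi> \<omega>)) \<partial>P) = 0"
  proof -
    define T where "T = - {-(pi / 2)<..<pi / 2}"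
    have null: "emeasure \<rho> {R. \<not> (0 < R \<and> R \<le> max_radius k)} = 0"
      using \<rho>(3) by (subst (asm) AE_iff_measurable[OF _ refl]) (auto simp: \<rho>(2) sets_eq_imp_space_eq[OF \<rho>(2)])
    \<comment> \<open>If the latitude lies in the open interval, only the radius can be at fault,
      and inadmissible radii are null for \<rho>. The remaining latitudes are ruled out by the
      formula for the distribution of the latitude, which integrates over the open interval
      only.\<close>
    have le: "emeasure \<rho> (Pair x -` bad) \<le> indicator T (latitude r \<nu> x)" for x
    proof (cases "latitude r \<nu> x \<in> T")
      case False
      then have "Pair x -` bad \<subseteq> {R. \<not> (0 < R \<and> R \<le> max_radius k)}" by (auto simp: bad_def T_def)
      then have "emeasure \<rho> (Pair x -` bad) \<le> emeasure \<rho> {R. \<not> (0 < R \<and> R \<le> max_radius k)}"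
        by (intro emeasure_mono) (auto simp: \<rho>(2))
      then show ?thesis using null by simp
    qed (simp add: \<rho>.emeasure_le_1)
    have [measurable]: "(indicator T :: real \<Rightarrow> ennreal) \<in> borel_measurable borel" unfolding T_def by measurable
    have "(\<integral>\<^sup>+\<omega>. of_nat (points_in bad (\<xi> \<omega>)) \<partial>P) = ennreal N * (\<integral>\<^sup>+x. emeasure \<rho> (Pair x -` bad) \<partial>\<mu>)"
    proof -
      have "(\<lambda>x. emeasure \<rho> (Pair x -` bad)) \<in> borel_measurable S"
        by (rule \<rho>.measurable_emeasure_Pair) (use bad in \<open>simp cong: sets_pair_measure_cong add: \<rho>(2)\<close>)
      then show ?thesis
        unfolding campbell[OF bad]
        by (intro nn_integral_scale_measure) (simp add: measurable_cong_sets[OF sets\<mu> refl])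
    qed
    also have "\<dots> \<le> ennreal N * (\<integral>\<^sup>+x. indicator T (latitude r \<nu> x) \<partial>\<mu>)"
      by (intro mult_left_mono nn_integral_mono le) simp
    also have "(\<integral>\<^sup>+x. indicator T (latitude r \<nu> x) \<partial>\<mu>) = emeasure \<mu>L L *
      (\<integral>\<^sup>+t. indicator T t * ennreal (r * cos t ^ CARD('l)) * indicator {-(pi / 2)<..<pi / 2} t \<partial>lborel)"
      by (rule latint) simp
    also have "(\<integral>\<^sup>+t. indicator T t * ennreal (r * cos t ^ CARD('l)) * indicator {-(pi / 2)<..<pi / 2} t \<partial>lborel) = (\<integral>\<^sup>+t. 0 \<partial>(lborel :: real measure))"
      by (intro nn_integral_cong) (auto simp: T_def indicator_def)
    finally show ?thesis by simp
  qed
  have meas: "(\<lambda>\<omega>. of_nat (points_in bad (\<xi> \<omega>)) :: ennreal) \<in> borel_measurable P"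
    using measurable_compose[OF measurable_compose[OF \<xi> points_in_measurable[OF bad]], of of_nat borel] by simp
  \<comment> \<open>A count is nonnegative, so expectation 0 means that almost surely no bad point
    occurs.\<close>
  have AE_bad: "AE \<omega> in P. points_in bad (\<xi> \<omega>) = 0"
    using bad0 by (subst (asm) nn_integral_0_iff_AE[OF meas]) simp
  have h: "(\<lambda>t. emeasure \<rho> {R. cuts k t R \<and> cut_radius k t R \<in> B}) \<in> borel_measurable borel"
  proof -
    have [measurable_cong]: "sets \<rho> = sets borel" by fact
    have "{p \<in> space (borel \<Otimes>\<^sub>M \<rho>). cuts k (fst p) (snd p) \<and> cut_radius k (fst p) (snd p) \<in> B} \<in> sets (borel \<Otimes>\<^sub>M \<rho>)"
      by measurable
    from \<rho>.measurable_emeasure_Pair[OF this]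
    show ?thesis by (simp add: space_pair_measure sets_eq_imp_space_eq[OF \<rho>(2)] vimage_def)
  qed
  have Ls: "L \<in> sets \<mu>L"
    using riemannian_volume_sets[OF \<mu>L'] closed_great_sphere[OF subspace_hyperplane[of \<nu>], of r]
    by (auto simp: L intro: borel_closed)
  have "ennreal N' * (emeasure \<mu>L L * emeasure \<rho>' B) = emeasure (scale_measure (ennreal N') (\<mu>L \<Otimes>\<^sub>M \<rho>')) (L \<times> B)"
    using Ls \<rho>'(2) B by (simp add: \<rho>'.emeasure_pair_measure_Times)
  also have "\<dots> = (\<integral>\<^sup>+\<omega>. of_nat (points_in (L \<times> B) (induced_balls k L (\<xi> \<omega>))) \<partial>P)"
    using Ls ind \<rho>'(2) B unfolding has_intensity_def
    by (metis pair_measureI sets_scale_measure)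
  also have "\<dots> = (\<integral>\<^sup>+\<omega>. of_nat (points_in C (\<xi> \<omega>)) \<partial>P)"
  proof (rule nn_integral_cong_AE)
    show "AE \<omega> in P. (of_nat (points_in (L \<times> B) (induced_balls k L (\<xi> \<omega>))) :: ennreal) = of_nat (points_in C (\<xi> \<omega>))"
      using AE_bad AE_space
    proof eventually_elim
      case (elim \<omega>)
      have sub: "set_mset (\<xi> \<omega>) \<subseteq> sphere 0 r \<times> UNIV"
        using measurable_space[OF \<xi> elim(2)] by (simp add: space_config_space sp)
      have "points_in (L \<times> B) (induced_balls k L (\<xi> \<omega>)) = points_in C (\<xi> \<omega>)"
        unfolding points_in_induced_balls
      proof (rule points_in_cong)
        fix p assume p: "p \<in># \<xi> \<omega>"
        obtain x R where pxR: "p = (x, R)" by (cases p)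
        have x: "norm x = r" using p pxR sub by auto
        have "p \<notin> bad" using elim(1) p unfolding points_in_eq_0_iff by blast
        then have b: "0 < R" "R \<le> max_radius k" "\<bar>latitude r \<nu> x\<bar> < pi / 2"
          using x unfolding bad_def sp pxR by auto
        show "p \<in> {(x, R). gball k x R \<inter> L \<noteq> {} \<and> (gproj k L x, section_radius k L x R) \<in> L \<times> B} \<longleftrightarrow> p \<in> C"
          using cut_ball_iff[OF x b, of B] x unfolding C_def sp pxR by simp
      qed
      then show ?case by simp
    qed
  qed
  also have "\<dots> = (\<integral>\<^sup>+x. emeasure \<rho> (Pair x -` C) \<partial>scale_measure (ennreal N) \<mu>)" by (rule campbell[OF C])
  also have "\<dots> = (\<integral>\<^sup>+x. emeasure \<rho> {R. cuts k (latitude r \<nu> x) R \<and> cut_radius k (latitude r \<nu> x) R \<in> B} \<partial>scale_measure (ennreal N) \<mu>)"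
    using sets_eq_imp_space_eq[OF sets\<Lambda>]
    by (intro nn_integral_cong arg_cong[where f="emeasure \<rho>"]) (auto simp: C_def sp spS)
  also have "\<dots> = ennreal N * (\<integral>\<^sup>+x. emeasure \<rho> {R. cuts k (latitude r \<nu> x) R \<and> cut_radius k (latitude r \<nu> x) R \<in> B} \<partial>\<mu>)"
  proof (rule nn_integral_scale_measure)
    have "latitude r \<nu> \<in> borel_measurable \<mu>" using lat by (simp add: measurable_cong_sets[OF sets\<mu> refl])
    from measurable_compose[OF this h]
    show "(\<lambda>x. emeasure \<rho> {R. cuts k (latitude r \<nu> x) R \<and> cut_radius k (latitude r \<nu> x) R \<in> B}) \<in> borel_measurable \<mu>" .
  qed
  also have "\<dots> = ennreal N * (emeasure \<mu>L L *
    (\<integral>\<^sup>+t. emeasure \<rho> {R. cuts k t R \<and> cut_radius k t R \<in> B} * ennreal (r * cos t ^ CARD('l)) * indicator {-(pi / 2)<..<pi / 2} t \<partial>lborel))"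
    by (subst latint[OF h]) (rule refl)
  finally have main: "emeasure \<mu>L L * (ennreal N' * emeasure \<rho>' B) = emeasure \<mu>L L * (ennreal N *
    (\<integral>\<^sup>+t. emeasure \<rho> {R. cuts k t R \<and> cut_radius k t R \<in> B} * ennreal (r * cos t ^ CARD('l)) * indicator {-(pi / 2)<..<pi / 2} t \<partial>lborel))"
    by (simp only: ac_simps)
  have K: "subspace {x. \<nu> \<bullet> x = 0}" "dim {x. \<nu> \<bullet> x = 0} = CARD('l) + 1"
    using dim_hyperplane_cart[OF norm_\<nu>] m l by (auto simp: subspace_hyperplane)
  have "emeasure \<mu>L L \<noteq> 0" "emeasure \<mu>L L \<noteq> \<top>"
    using great_sphere_emeasure_pos[OF K r_pos \<mu>L'] great_sphere_emeasure_finite[OF K r_pos \<mu>L'] by (auto simp: L)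
  then show ?thesis using main by (simp add: ennreal_mult_cancel_left)
qed

end

section \<open>Integrating the inversion kernel against the law of the induced radii\<close>

context hypersurface_section
begin

text \<open>The law for all Borel sets is an equality of two measures on the line: a multiple of
  \<open>\<rho>'\<close>, and a multiple of the image of a weighted product measure under
  \<open>cut_radius\<close>. The order of integration is then exchanged, because the kernel is to be
  integrated over \<open>t\<close> for fixed \<open>R\<close>.\<close>

theorem nn_integral_induced_radius:
  fixes N N' :: real and \<mu> \<mu>L :: "(real ^ 'n) measure" and P :: "'w measure"
  assumes m: "CARD('n) = CARD('m::finite) + 1" and l: "CARD('m) = CARD('l::finite) + 1"
    and \<mu>: "riemannian_volume TYPE('m) (space_form k) \<mu>"
    and \<mu>L: "riemannian_volume TYPE('l) L \<mu>L"
    and N: "0 < N" and int: "has_intensity P \<eta> (scale_measure (ennreal N) \<mu>)"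
    and \<rho>: "prob_space \<rho>" "sets \<rho> = sets borel" "AE R in \<rho>. 0 < R \<and> R \<le> max_radius k"
    and mark: "independent_marking P (restrict_space borel (space_form k)) \<eta> \<rho> \<xi>"
    and \<rho>': "prob_space \<rho>'" "sets \<rho>' = sets borel"
    and ind: "has_intensity P (\<lambda>\<omega>. induced_balls k L (\<xi> \<omega>)) (scale_measure (ennreal N') (\<mu>L \<Otimes>\<^sub>M \<rho>'))"
    and g: "g \<in> borel_measurable borel"
  shows "ennreal N' * (\<integral>\<^sup>+y. g y \<partial>\<rho>') = ennreal N *
    (\<integral>\<^sup>+R. \<integral>\<^sup>+t. (if cuts k t R then ennreal (r * cos t ^ CARD('l)) * g (cut_radius k t R) else 0) \<partial>lborel \<partial>\<rho>)"
proof -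
  interpret \<rho>: prob_space \<rho> by fact
  interpret pair: pair_sigma_finite lborel \<rho> ..
  have [measurable_cong]: "sets \<rho> = sets borel" by fact
  note [measurable] = g
  define w where "w p = (if cuts k (fst p) (snd p) then ennreal (r * cos (fst p) ^ CARD('l)) else 0)" for p
  have w [measurable]: "w \<in> borel_measurable (lborel \<Otimes>\<^sub>M \<rho>)" unfolding w_def by measurable
  define M where "M = density (lborel \<Otimes>\<^sub>M \<rho>) w"
  have c [measurable]: "(\<lambda>p. cut_radius k (fst p) (snd p)) \<in> borel_measurable (lborel \<Otimes>\<^sub>M \<rho>)" by measurable
  have cM: "(\<lambda>p. cut_radius k (fst p) (snd p)) \<in> borel_measurable M"
    unfolding M_def by simp
  have "scale_measure (ennreal N') \<rho>' = scale_measure (ennreal N) (distr M borel (\<lambda>p. cut_radius k (fst p) (snd p)))"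
  proof (rule measure_eqI)
    fix B assume "B \<in> sets (scale_measure (ennreal N') \<rho>')"
    then have B [measurable]: "B \<in> sets borel" using \<rho>' by simp
    have "emeasure (distr M borel (\<lambda>p. cut_radius k (fst p) (snd p))) B =
      (\<integral>\<^sup>+y. indicator B y \<partial>distr M borel (\<lambda>p. cut_radius k (fst p) (snd p)))"
      by simp
    also have "\<dots> = (\<integral>\<^sup>+p. indicator B (cut_radius k (fst p) (snd p)) \<partial>M)"
      by (rule nn_integral_distr[OF cM]) simp
    also have "\<dots> = (\<integral>\<^sup>+p. w p * indicator B (cut_radius k (fst p) (snd p)) \<partial>(lborel \<Otimes>\<^sub>M \<rho>))"
      unfolding M_def by (rule nn_integral_density) measurable
    also have "\<dots> = (\<integral>\<^sup>+t. \<integral>\<^sup>+R. w (t, R) * indicator B (cut_radius k t R) \<partial>\<rho> \<partial>lborel)"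
      by (subst \<rho>.nn_integral_fst[symmetric]) simp_all
    also have "\<dots> = (\<integral>\<^sup>+t. emeasure \<rho> {R. cuts k t R \<and> cut_radius k t R \<in> B} * ennreal (r * cos t ^ CARD('l)) * indicator {-(pi / 2)<..<pi / 2} t \<partial>lborel)"
    proof (rule nn_integral_cong)
      fix t :: real
      have set: "{R. cuts k t R \<and> cut_radius k t R \<in> B} \<in> sets \<rho>"
      proof -
        have "{R \<in> space \<rho>. cuts k t R \<and> cut_radius k t R \<in> B} \<in> sets \<rho>" by measurable
        then show ?thesis by (simp add: sets_eq_imp_space_eq[OF \<rho>(2)])
      qed
      have "(\<integral>\<^sup>+R. w (t, R) * indicator B (cut_radius k t R) \<partial>\<rho>) =
        (\<integral>\<^sup>+R. (ennreal (r * cos t ^ CARD('l)) * indicator {-(pi / 2)<..<pi / 2} t) * indicator {R. cuts k t R \<and> cut_radius k t R \<in> B} R \<partial>\<rho>)"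
        by (intro nn_integral_cong) (auto simp: w_def cuts_def indicator_def)
      also have "\<dots> = (ennreal (r * cos t ^ CARD('l)) * indicator {-(pi / 2)<..<pi / 2} t) * emeasure \<rho> {R. cuts k t R \<and> cut_radius k t R \<in> B}"
        by (rule nn_integral_cmult_indicator[OF set])
      finally show "(\<integral>\<^sup>+R. w (t, R) * indicator B (cut_radius k t R) \<partial>\<rho>) =
        emeasure \<rho> {R. cuts k t R \<and> cut_radius k t R \<in> B} * ennreal (r * cos t ^ CARD('l)) * indicator {-(pi / 2)<..<pi / 2} t"
        by (simp only: ac_simps)
    qed
    finally show "emeasure (scale_measure (ennreal N') \<rho>') B =
      emeasure (scale_measure (ennreal N) (distr M borel (\<lambda>p. cut_radius k (fst p) (snd p)))) B"
      using induced_radius_law[OF m l \<mu> \<mu>L N int \<rho> mark \<rho>' ind B] by simp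
  qed (simp add: \<rho>')
  then have "(\<integral>\<^sup>+y. g y \<partial>scale_measure (ennreal N') \<rho>') =
    (\<integral>\<^sup>+y. g y \<partial>scale_measure (ennreal N) (distr M borel (\<lambda>p. cut_radius k (fst p) (snd p))))" by simp
  then have "ennreal N' * (\<integral>\<^sup>+y. g y \<partial>\<rho>') =
    ennreal N * (\<integral>\<^sup>+y. g y \<partial>distr M borel (\<lambda>p. cut_radius k (fst p) (snd p)))"
    using g by (simp add: nn_integral_scale_measure measurable_cong_sets[OF \<rho>'(2) refl])
  also have "(\<integral>\<^sup>+y. g y \<partial>distr M borel (\<lambda>p. cut_radius k (fst p) (snd p))) = (\<integral>\<^sup>+p. g (cut_radius k (fst p) (snd p)) \<partial>M)"
    by (rule nn_integral_distr[OF cM]) simp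
  also have "\<dots> = (\<integral>\<^sup>+p. w p * g (cut_radius k (fst p) (snd p)) \<partial>(lborel \<Otimes>\<^sub>M \<rho>))"
    unfolding M_def by (rule nn_integral_density) measurable
  also have "\<dots> = (\<integral>\<^sup>+R. \<integral>\<^sup>+t. w (t, R) * g (cut_radius k t R) \<partial>lborel \<partial>\<rho>)"
    by (subst pair.nn_integral_snd[symmetric]) (simp_all add: case_prod_unfold)
  also have "\<dots> = (\<integral>\<^sup>+R. \<integral>\<^sup>+t. (if cuts k t R then ennreal (r * cos t ^ CARD('l)) * g (cut_radius k t R) else 0) \<partial>lborel \<partial>\<rho>)"
    by (intro nn_integral_cong) (simp add: w_def)
  finally show ?thesis .
qed

text \<open>Radii are turned into angles by the factor \<open>sqrt k\<close>. Values of
  \<open>g\<close> beyond \<open>max_radius k\<close> are left open, since under \<open>cuts\<close>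
  a section radius never exceeds it. The exponent \<open>n + 1\<close> is the dimension of
  \<open>L\<close>.\<close>

lemma nn_integral_cut_inversion_kernel:
  assumes a: "0 < a" "a < max_radius k" and R: "0 < R" "R \<le> max_radius k"
    and g: "\<And>y. a < y \<Longrightarrow> y \<le> max_radius k \<Longrightarrow> g y = ennreal (inversion_kernel n (sqrt k * a) (sqrt k * y))"
      "\<And>y. y \<le> a \<Longrightarrow> g y = 0"
  shows "(\<integral>\<^sup>+t. (if cuts k t R then ennreal (r * cos t ^ (n + 1)) * g (cut_radius k t R) else 0) \<partial>lborel) =
    ennreal (r * pi) * indicator {a<..max_radius k} R"
proof -
  define a' R' where "a' = sqrt k * a" and "R' = sqrt k * R"
  have a': "0 < a'" "a' < pi / 2" using a k by (auto simp: a'_def max_radius_def field_simps)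
  have R': "0 < R'" "R' \<le> pi / 2" using R k by (auto simp: R'_def max_radius_def field_simps)
  have ca: "0 < cos a'" using a' by (intro cos_gt_zero) auto
  have cR: "0 \<le> cos R'" using R' by (intro cos_ge_zero) auto
  have eq: "(if cuts k t R then ennreal (r * cos t ^ (n + 1)) * g (cut_radius k t R) else 0) =
    ennreal r * (ennreal (cos t ^ (n + 1)) * ennreal (inversion_kernel n a' (arccos (cos R' / cos t))) *
     indicator {t. -R' \<le> t \<and> t \<le> R' \<and> cos R' < cos a' * cos t} t)" for t
  proof (cases "cuts k t R")
    case True
    then have t: "\<bar>t\<bar> < pi / 2" "\<bar>t\<bar> \<le> R'" by (auto simp: cuts_def R'_def)
    have ct: "0 < cos t" using t by (intro cos_gt_zero_pi) auto
    have "cos R' \<le> cos \<bar>t\<bar>" using t R' pi_gt_zero by (intro cos_monotone_0_pi_le) auto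
    then have q: "0 \<le> cos R' / cos t" "cos R' / cos t \<le> 1" using ct cR by auto
    then have cut: "cut_radius k t R = arccos (cos R' / cos t) / sqrt k"
      by (simp add: cut_radius_def R'_def max_def min_def)
    have ac: "0 \<le> arccos (cos R' / cos t)" "arccos (cos R' / cos t) \<le> pi / 2"
      using arccos_bounds_unit[OF q] by auto
    have "a < cut_radius k t R \<longleftrightarrow> a' < arccos (cos R' / cos t)"
      using k by (simp add: cut a'_def field_simps)
    also have "\<dots> \<longleftrightarrow> cos R' / cos t < cos a'"
      using cos_gt_iff_less_arccos(1)[OF q, of a'] a' by auto
    also have "\<dots> \<longleftrightarrow> cos R' < cos a' * cos t" using ct by (simp add: field_simps)
    finally have iff: "a < cut_radius k t R \<longleftrightarrow> cos R' < cos a' * cos t" .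
    have le: "cut_radius k t R \<le> max_radius k"
      using ac k by (simp add: cut max_radius_def field_simps)
    show ?thesis
    proof (cases "a < cut_radius k t R")
      case gt: True
      have "g (cut_radius k t R) = ennreal (inversion_kernel n a' (arccos (cos R' / cos t)))"
        using g(1)[OF gt le] k by (simp add: cut a'_def)
      then show ?thesis using True t gt iff r_pos ct by (auto simp: indicator_def ennreal_mult' mult.assoc)
    next
      case False
      then show ?thesis using True g(2)[of "cut_radius k t R"] iff by (auto simp: indicator_def)
    qed
  next
    case False
    \<comment> \<open>The strict inequality forces \<open>cos t > 0\<close>, so it excludes the
      poles just as \<open>cuts\<close> does.\<close>
    have "\<not> (-R' \<le> t \<and> t \<le> R' \<and> cos R' < cos a' * cos t)"
    proof
      assume *: "-R' \<le> t \<and> t \<le> R' \<and> cos R' < cos a' * cos t"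
      then have "0 < cos a' * cos t" using cR by linarith
      then have "0 < cos t" using ca by (simp add: zero_less_mult_iff)
      then have "\<bar>t\<bar> \<noteq> pi / 2" by (metis cos_abs_real cos_pi_half less_irrefl)
      then have "cuts k t R" using * R R' by (auto simp: cuts_def R'_def)
      then show False using False by simp
    qed
    then show ?thesis using False by (simp add: indicator_def)
  qed
  show ?thesis
  proof (cases "a < R")
    case True
    have "a' < R'" using True k by (simp add: a'_def R'_def)
    have "(\<integral>\<^sup>+t. ennreal r * (ennreal (cos t ^ (n + 1)) * ennreal (inversion_kernel n a' (arccos (cos R' / cos t))) *
     indicator {t. -R' \<le> t \<and> t \<le> R' \<and> cos R' < cos a' * cos t} t) \<partial>lborel) = ennreal r * ennreal pi"
      using nn_integral_inversion_kernel[OF a'(1) \<open>a' < R'\<close> R'(2), of n]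
      by (subst nn_integral_cmult) simp_all
    then show ?thesis unfolding eq using True R r_pos by (simp add: ennreal_mult')
  next
    case False
    \<comment> \<open>A ball of radius at most \<open>a\<close> cannot have a section of radius
      larger than \<open>a\<close>, so the indicator vanishes for all \<open>t\<close>.\<close>
    have "cos R' \<ge> cos a' * cos t" for t
    proof -
      have "R' \<le> a'" using False k by (simp add: a'_def R'_def)
      then have "cos a' \<le> cos R'" using R' a' by (intro cos_monotone_0_pi_le) auto
      moreover have "cos a' * cos t \<le> cos a'" using ca by (simp add: mult_left_le)
      ultimately show ?thesis by linarith
    qed
    then show ?thesis unfolding eq using False by (simp add: not_less[symmetric])
  qed
qed

end

text \<open>Integrability is asserted along with the identity because the integral of a
  non-integrable function is 0 by convention, so that the identity alone would not exclude divergent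
  integrals. It holds because the nonnegative integral of the whole kernel turns out finite and each
  of its two nonnegative summands is bounded by a multiple of it.\<close>

theorem theorem5p3:
  fixes d :: nat and k a N N' :: real
    and L :: "(real ^ 'n) set"
    and \<mu> \<mu>\<^sub>L :: "(real ^ 'n) measure"
    and P :: "'w measure"
    and \<eta> :: "'w \<Rightarrow> (real ^ 'n) multiset"
    and \<xi> :: "'w \<Rightarrow> ((real ^ 'n) \<times> real) multiset"
    and \<nu> \<nu>' :: "real measure"
  assumes "d \<ge> 2" and "k > 0"
    and "CARD('n) = d + 1" and "CARD('m::finite) = d" and "CARD('l::finite) = d - 1"
    and "riemannian_volume TYPE('m) (space_form k) \<mu>"
    and "geodesic_hypersurface k L"
    and "riemannian_volume TYPE('l) L \<mu>\<^sub>L"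
    and "prob_space P"
    and "point_process P (restrict_space borel (space_form k)) \<eta>"
    and "isometry_invariant k P \<eta>"
    and "N > 0" and "has_intensity P \<eta> (scale_measure (ennreal N) \<mu>)"
    and "prob_space \<nu>" and "sets \<nu> = sets borel" and "AE r in \<nu>. 0 < r \<and> r \<le> max_radius k"
    and "independent_marking P (restrict_space borel (space_form k)) \<eta> \<nu> \<xi>"
    and "N' > 0"
    and "prob_space \<nu>'" and "sets \<nu>' = sets borel" and "AE r in \<nu>'. 0 < r \<and> r \<le> max_radius k"
    and "has_intensity P (\<lambda>\<omega>. induced_balls k L (\<xi> \<omega>)) (scale_measure (ennreal N') (\<mu>\<^sub>L \<Otimes>\<^sub>M \<nu>'))"
    and "0 < a" and "a < max_radius k"
  shows
    "set_integrable \<nu>' {a<..max_radius k} (\<lambda>y. cos (sqrt k * y) ^ (d - 1) /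
       sqrt ((cos (sqrt k * a))\<^sup>2 - (cos (sqrt k * y))\<^sup>2)) \<and>
     set_integrable \<nu>' {a<..max_radius k} (\<lambda>y.
       LINT \<theta>:{0..arccos (cos (sqrt k * y) / cos (sqrt k * a))}|lborel. cos \<theta> ^ (d - 2)) \<and>
     measure \<nu> {a<..max_radius k} =
       N' * sqrt k / (N * pi) *
       (1 / cos (sqrt k * a) ^ (d - 2) *
          (LINT y:{a<..max_radius k}|\<nu>'. cos (sqrt k * y) ^ (d - 1) /
             sqrt ((cos (sqrt k * a))\<^sup>2 - (cos (sqrt k * y))\<^sup>2))
        + (real d - 1) *
          (LINT y:{a<..max_radius k}|\<nu>'.
             LINT \<theta>:{0..arccos (cos (sqrt k * y) / cos (sqrt k * a))}|lborel. cos \<theta> ^ (d - 2)))"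
proof -
  define n where "n = d - 2"
  have n: "d = n + 2" using \<open>d \<ge> 2\<close> by (simp add: n_def)
  define A where "A = {a<..max_radius k}"
  define c where "c = cos (sqrt k * a)"
  define I1 where "I1 y = cos (sqrt k * y) ^ (n + 1) / sqrt (c\<^sup>2 - (cos (sqrt k * y))\<^sup>2)" for y
  define I2 where "I2 y = cos_power_integral n (cos (sqrt k * y) / c)" for y
  \<comment> \<open>The clamped variant is measurable on the whole line and agrees with
    \<open>I2\<close> on \<open>A\<close>, where the ratio lies between 0 and 1.\<close>
  define I2' where "I2' y = cos_power_integral n (max (-1) (min 1 (cos (sqrt k * y) / c)))" for y
  obtain w where w: "norm w = 1" "L = space_form k \<inter> {x. w \<bullet> x = 0}"
    using geodesic_hypersurfaceE[OF \<open>geodesic_hypersurface k L\<close>] .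
  interpret hypersurface_section k "1 / sqrt k" w L
    using w \<open>k > 0\<close> \<open>CARD('n) = d + 1\<close> \<open>d \<ge> 2\<close> by unfold_locales (auto simp: space_form_def)
  interpret \<nu>: prob_space \<nu> by fact
  interpret \<nu>': prob_space \<nu>' by fact
  have ang: "0 < sqrt k * a" "sqrt k * a < pi / 2"
    using \<open>0 < a\<close> \<open>a < max_radius k\<close> k by (auto simp: max_radius_def field_simps)
  have c: "0 < c" unfolding c_def using ang by (intro cos_gt_zero) auto
  have cosA: "0 \<le> cos (sqrt k * y)" "cos (sqrt k * y) < c" if "y \<in> A" for y
  proof -
    have y: "sqrt k * a < sqrt k * y" "sqrt k * y \<le> pi / 2"
      using that k by (auto simp: A_def max_radius_def field_simps)
    then show "0 \<le> cos (sqrt k * y)" using ang by (intro cos_ge_zero) auto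
    show "cos (sqrt k * y) < c" unfolding c_def using y ang by (intro cos_monotone_0_pi) auto
  qed
  have I1_nonneg: "0 \<le> I1 y" if "y \<in> A" for y
    using cosA[OF that] by (simp add: I1_def power_mono)
  have ratio: "0 \<le> cos (sqrt k * y) / c" "cos (sqrt k * y) / c \<le> 1" if "y \<in> A" for y
    using cosA[OF that] c by simp_all
  have I2_nonneg: "0 \<le> I2 y" and I2'_eq: "I2' y = I2 y" if "y \<in> A" for y
    using ratio[OF that] by (simp_all add: I2_def I2'_def cos_power_integral_nonneg)
  have [measurable]: "A \<in> sets borel" by (simp add: A_def)
  have I1_meas [measurable]: "I1 \<in> borel_measurable borel" unfolding I1_def by measurable
  have I2'_meas [measurable]: "I2' \<in> borel_measurable borel"
    unfolding I2'_def by (rule measurable_compose[OF _ borel_measurable_cos_power_integral_clamp]) measurable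
  define f1 where "f1 y = indicator A y * I1 y" for y
  define f2 where "f2 y = indicator A y * I2 y" for y
  \<comment> \<open>The kernel of the theorem cut off to \<open>A\<close>, so that it is nonnegative
    and defined everywhere.\<close>
  define f where "f y = f1 y / c ^ n + (real n + 1) * f2 y" for y
  have f2_eq: "f2 = (\<lambda>y. indicator A y * I2' y)" by (auto simp: f2_def I2'_eq indicator_def)
  have [measurable]: "f1 \<in> borel_measurable borel" "f2 \<in> borel_measurable borel" "f \<in> borel_measurable borel"
    unfolding f_def f1_def f2_eq by measurable
  have [measurable_cong]: "sets \<nu>' = sets borel" by fact
  have f1_nonneg: "0 \<le> f1 y" and f2_nonneg: "0 \<le> f2 y" for y
    using I1_nonneg I2_nonneg by (auto simp: f1_def f2_def indicator_def)
  have f_nonneg: "0 \<le> f y" for y using f1_nonneg f2_nonneg c by (simp add: f_def)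
  have f_kernel: "f y = inversion_kernel n (sqrt k * a) (sqrt k * y)" if "y \<in> A" for y
    using that by (simp add: f_def f1_def f2_def I1_def I2_def inversion_kernel_def c_def)
  have card: "CARD('n) = CARD('m) + 1" "CARD('m) = CARD('l) + 1" "CARD('l) = n + 1"
    using \<open>CARD('n) = d + 1\<close> \<open>CARD('m) = d\<close> \<open>CARD('l) = d - 1\<close> n by auto
  have "ennreal N' * (\<integral>\<^sup>+y. ennreal (f y) \<partial>\<nu>') = ennreal N *
    (\<integral>\<^sup>+R. \<integral>\<^sup>+t. (if cuts k t R then ennreal (1 / sqrt k * cos t ^ CARD('l)) * ennreal (f (cut_radius k t R)) else 0) \<partial>lborel \<partial>\<nu>)"
    by (rule nn_integral_induced_radius[where \<mu>L=\<mu>\<^sub>L]) (use assms card in simp_all)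
  also have "(\<integral>\<^sup>+R. \<integral>\<^sup>+t. (if cuts k t R then ennreal (1 / sqrt k * cos t ^ CARD('l)) * ennreal (f (cut_radius k t R)) else 0) \<partial>lborel \<partial>\<nu>)
    = (\<integral>\<^sup>+R. ennreal (1 / sqrt k * pi) * indicator A R \<partial>\<nu>)"
  proof (rule nn_integral_cong_AE, use \<open>AE r in \<nu>. 0 < r \<and> r \<le> max_radius k\<close> in eventually_elim)
    case (elim R)
    show ?case unfolding card(3) A_def
      by (rule nn_integral_cut_inversion_kernel)
         (use assms elim f_kernel in \<open>auto simp: A_def f_def f1_def f2_def\<close>)
  qed
  also have "\<dots> = ennreal (1 / sqrt k * pi) * emeasure \<nu> A"
    by (rule nn_integral_cmult_indicator) (simp add: \<open>sets \<nu> = sets borel\<close>)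
  finally have "ennreal N' * (\<integral>\<^sup>+y. ennreal (f y) \<partial>\<nu>') = ennreal (N * (1 / sqrt k * pi * measure \<nu> A))"
    using k \<open>N > 0\<close> by (simp add: \<nu>.emeasure_eq_measure ennreal_mult'[symmetric])
  also have "\<dots> = ennreal N' * ennreal (N * pi / (N' * sqrt k) * measure \<nu> A)"
    using \<open>N' > 0\<close> by (simp add: ennreal_mult'[symmetric] mult.assoc)
  finally have nn: "(\<integral>\<^sup>+y. ennreal (f y) \<partial>\<nu>') = ennreal (N * pi / (N' * sqrt k) * measure \<nu> A)"
    using \<open>N' > 0\<close> by (simp add: ennreal_mult_cancel_left)
  \<comment> \<open>The right-hand side of \<open>nn\<close> is a real number, and finiteness of the
    nonnegative integral gives integrability.\<close>
  have f_int: "integrable \<nu>' f"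
    by (rule integrableI_nonneg) (auto simp: f_nonneg nn)
  have f1_int: "integrable \<nu>' f1"
  proof (rule Bochner_Integration.integrable_bound)
    show "integrable \<nu>' (\<lambda>y. c ^ n * f y)" using f_int by simp
    have "c ^ n * f y = f1 y + c ^ n * ((real n + 1) * f2 y)" for y using c by (simp add: f_def field_simps)
    then have "f1 y \<le> c ^ n * f y" for y using c f2_nonneg[of y] by simp
    then show "AE y in \<nu>'. norm (f1 y) \<le> norm (c ^ n * f y)"
      using f1_nonneg f_nonneg c by (simp add: abs_mult)
  qed simp
  have f2_int: "integrable \<nu>' f2"
  proof (rule Bochner_Integration.integrable_bound[OF f_int])
    have "f2 y \<le> f y" for y
    proof -
      have "0 \<le> f1 y / c ^ n" "0 \<le> real n * f2 y" using f1_nonneg f2_nonneg c by simp_all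
      then show ?thesis by (simp add: f_def algebra_simps)
    qed
    then show "AE y in \<nu>'. norm (f2 y) \<le> norm (f y)"
      using f2_nonneg f_nonneg by simp
  qed simp
  have "N * pi / (N' * sqrt k) * measure \<nu> A = (\<integral>y. f y \<partial>\<nu>')"
    using nn \<open>N > 0\<close> \<open>N' > 0\<close> k f_nonneg by (subst integral_eq_nn_integral) simp_all
  also have "\<dots> = (\<integral>y. f1 y \<partial>\<nu>') / c ^ n + (real n + 1) * (\<integral>y. f2 y \<partial>\<nu>')"
    unfolding f_def using f1_int f2_int by simp
  finally have val: "measure \<nu> A = N' * sqrt k / (N * pi) *
    (1 / c ^ n * (\<integral>y. f1 y \<partial>\<nu>') + (real n + 1) * (\<integral>y. f2 y \<partial>\<nu>'))"
    using \<open>N > 0\<close> \<open>N' > 0\<close> k by (simp add: field_simps)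
  have e: "d - 1 = n + 1" "d - 2 = n" "real d - 1 = real n + 1" using n by auto
  show ?thesis
    using f1_int f2_int val
    unfolding e set_integrable_def set_lebesgue_integral_def real_scaleR_def
      f1_def f2_def I1_def I2_def A_def c_def cos_power_integral_def
    by simp
qed

end
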